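(* Let $K\subset[0,1]\subset\mathbb{C}$ be the Cantor-type compact set, and $\mu$ the probability measure on it, constructed in the context, let $U^\mu(z)=\int\ln|z-w|\,d\mu(w)$, let $X=\overline{\mathbb{C}}\setminus K$, where $\overline{\mathbb{C}}=\mathbb{C}\cup\{\infty\}$ is the Riemann sphere, and let $\phi=-U^\mu$ on $X\setminus\{\infty\}$, $\phi(\infty)=-\infty$. Then $(X,\phi)$ is an $S^*$-parabolic Stein manifold, and every polynomial on $(X,\phi)$ is constant. In particular, $(X,\phi)$ is not regular.
   Context: Construction of $K$ and $\mu$. Put $\delta=1/4$ and $t_m=4^{m-1}$ for $m=1,2,\dots$. Let $K_0=[0,1]$. Given $K_{m-1}$, a disjoint union of $2^{m-1}$ closed intervals, let $K_m$ be obtained by replacing each interval $[a,b]$ of $K_{m-1}$ by $[a,a+\delta^{t_m}]\cup[b-\delta^{t_m},b]$; thus $K_m=\bigcup_{j=1}^{2^m}[a_{mj},b_{mj}]$ is a disjoint union of $2^m$ intervals of length $\delta^{t_m}$. Set $K=\bigcap_{m\ge1}K_m$. Let $\mu_m=\frac{1}{2\cdot 2^m}\sum_{j=1}^{2^m}(\delta_{a_{mj}}+\delta_{b_{mj}})$, where $\delta_c$ is the unit point mass at $c$, and let $\mu$ be the weak limit of $\mu_m$ as $m\to\infty$. Definitions. A Stein manifold $X$ of dimension $n$ is called $S$-parabolic if there is a plurisubharmonic function $\rho$ on $X$ such that $\{z\in X:\rho(z)<C\}$ is relatively compact in $X$ for all $C\in\mathbb{R}$ (exhaustion) and $\rho$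 is a maximal plurisubharmonic function outside some compact subset of $X$ (i.e. $(dd^c\rho)^n=0$ there); such a $\rho$ is called a special exhaustion function. If $\rho$ is in addition continuous (here, continuous as a map into $[-\infty,\infty)$), then $(X,\rho)$ is called $S^*$-parabolic. $O(X)$ denotes the space of holomorphic functions on $X$ with the topology of uniform convergence on compact sets. With $\rho^+=\max\{0,\rho\}$, a function $f\in O(X)$ is a polynomial on $(X,\rho)$ if there are an integer $d\ge0$ and a constant $c>0$ such that $\ln|f(z)|\le d\,\rho^+(z)+c$ for all $z\in X$. $(X,\rho)$ is regular if the space of all polynomials on $(X,\rho)$ is dense in $O(X)$. *)

theory Defs
  imports "HOL-Probability.Probability"
begin

section \<open>Complex manifolds and holomorphic functions\<close>

definition holomorphic_SCV :: "(complex ^ 'n::finite) set \<Rightarrow> (complex ^ 'n \<Rightarrow> complex) \<Rightarrow> bool" where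
  "holomorphic_SCV S f \<longleftrightarrow>
     (\<forall>x\<in>S. \<exists>f'. (f has_derivative f') (at x) \<and> (\<forall>c v. f' (c *s v) = c * f' v))"

type_synonym ('a, 'n) atlas = "('a set \<times> ('a \<Rightarrow> complex ^ 'n)) set"

text \<open>A manifold is given by its underlying topology \<open>T\<close> and a holomorphic atlas \<open>A\<close> of charts
  \<open>(U, h)\<close>; its complex dimension is \<open>CARD('n)\<close>.  It is not required to be connected.\<close>

definition complex_manifold :: "'a topology \<Rightarrow> ('a, 'n::finite) atlas \<Rightarrow> bool" where
  "complex_manifold T A \<longleftrightarrow>
     Hausdorff_space T \<and> second_countable T \<and>
     (\<Union>(U, h)\<in>A. U) = topspace T \<and>
     (\<forall>(U, h)\<in>A. openin T U \<and> open (h ` U) \<and>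
        homeomorphic_map (subtopology T U) (top_of_set (h ` U)) h) \<and>
     (\<forall>(U, h)\<in>A. \<forall>(V, k)\<in>A. \<forall>i.
        holomorphic_SCV (h ` (U \<inter> V)) (\<lambda>x. k (inv_into U h x) $ i))"

text \<open>Functions on a manifold are total functions on \<open>'a\<close>, of which only the values on
  \<open>topspace T\<close> are relevant.\<close>

definition holo_fun :: "'a topology \<Rightarrow> ('a, 'n::finite) atlas \<Rightarrow> ('a \<Rightarrow> complex) \<Rightarrow> bool" where
  "holo_fun T A f \<longleftrightarrow> (\<forall>(U, h)\<in>A. holomorphic_SCV (h ` U) (\<lambda>x. f (inv_into U h x)))"

definition holo_hull :: "'a topology \<Rightarrow> ('a, 'n::finite) atlas \<Rightarrow> 'a set \<Rightarrow> 'a set" where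
  "holo_hull T A L =
     {x \<in> topspace T. \<forall>f. holo_fun T A f \<longrightarrow>
        (\<forall>M. (\<forall>y\<in>L. cmod (f y) \<le> M) \<longrightarrow> cmod (f x) \<le> M)}"

definition stein_manifold :: "'a topology \<Rightarrow> ('a, 'n::finite) atlas \<Rightarrow> bool" where
  "stein_manifold T A \<longleftrightarrow>
     complex_manifold T A \<and>
     (\<forall>L. compactin T L \<longrightarrow> compactin T (holo_hull T A L)) \<and>
     (\<forall>x\<in>topspace T. \<forall>y\<in>topspace T. x \<noteq> y \<longrightarrow> (\<exists>f. holo_fun T A f \<and> f x \<noteq> f y))"

section \<open>Plurisubharmonic and maximal plurisubharmonic functions\<close>

definition usc_on :: "'a topology \<Rightarrow> 'a set \<Rightarrow> ('a \<Rightarrow> ereal) \<Rightarrow> bool" where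
  "usc_on T S u \<longleftrightarrow>
     (\<forall>x\<in>S. u x \<noteq> \<infinity>) \<and> (\<forall>c. openin (subtopology T S) {x \<in> S. u x < c})"

text \<open>Mean over \<open>[0, 2\<pi>]\<close> with values in \<open>[-\<infinity>, \<infinity>)\<close>: \<open>e2ennreal\<close> truncates negative values
  to \<open>0\<close>, and for the functions to which this is applied (upper semicontinuous with values
  \<open>< \<infinity>\<close>) the integral of the positive part is finite.\<close>

definition circle_mean :: "(real \<Rightarrow> ereal) \<Rightarrow> ereal" where
  "circle_mean f = ereal (1 / (2 * pi)) *
     (enn2ereal (\<integral>\<^sup>+ t\<in>{0..2*pi}. e2ennreal (f t) \<partial>lborel)
      - enn2ereal (\<integral>\<^sup>+ t\<in>{0..2*pi}. e2ennreal (- f t) \<partial>lborel))"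

text \<open>Plurisubharmonicity on an open subset \<open>W\<close>; the function \<open>-\<infinity>\<close> is allowed.\<close>

definition psh_on :: "'a topology \<Rightarrow> ('a, 'n::finite) atlas \<Rightarrow> 'a set \<Rightarrow> ('a \<Rightarrow> ereal) \<Rightarrow> bool" where
  "psh_on T A W u \<longleftrightarrow>
     usc_on T W u \<and>
     (\<forall>(U, h)\<in>A. \<forall>a b.
        (\<forall>\<zeta>. cmod \<zeta> \<le> 1 \<longrightarrow> a + \<zeta> *s b \<in> h ` (U \<inter> W)) \<longrightarrow>
        u (inv_into U h a) \<le> circle_mean (\<lambda>t. u (inv_into U h (a + cis t *s b))))"

text \<open>Pluripotential-theoretic maximality on the open set \<open>W\<close>, i.e. \<open>(dd\<^sup>cu)\<^sup>n = 0\<close> there; in dimension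
  one, harmonicity.\<close>

definition maximal_psh_on :: "'a topology \<Rightarrow> ('a, 'n::finite) atlas \<Rightarrow> 'a set \<Rightarrow> ('a \<Rightarrow> ereal) \<Rightarrow> bool" where
  "maximal_psh_on T A W u \<longleftrightarrow>
     psh_on T A W u \<and>
     (\<forall>G v. openin T G \<and> compactin T (T closure_of G) \<and> T closure_of G \<subseteq> W \<and>
        usc_on T (T closure_of G) v \<and> psh_on T A G v \<and>
        (\<forall>x\<in>T frontier_of G. v x \<le> u x) \<longrightarrow> (\<forall>x\<in>G. v x \<le> u x))"

section \<open>Parabolic manifolds, polynomials and regularity\<close>

definition special_exhaustion :: "'a topology \<Rightarrow> ('a, 'n::finite) atlas \<Rightarrow> ('a \<Rightarrow> ereal) \<Rightarrow> bool" where
  "special_exhaustion T A \<rho> \<longleftrightarrow>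
     psh_on T A (topspace T) \<rho> \<and>
     (\<forall>C::real. compactin T (T closure_of {x \<in> topspace T. \<rho> x < ereal C})) \<and>
     (\<exists>L. compactin T L \<and> maximal_psh_on T A (topspace T - L) \<rho>)"

definition S_star_parabolic :: "'a topology \<Rightarrow> ('a, 'n::finite) atlas \<Rightarrow> ('a \<Rightarrow> ereal) \<Rightarrow> bool" where
  "S_star_parabolic T A \<rho> \<longleftrightarrow>
     stein_manifold T A \<and> special_exhaustion T A \<rho> \<and> continuous_map T euclidean \<rho>"

text \<open>\<open>ln\<close> with the convention \<open>ln 0 = -\<infinity>\<close>.\<close>

definition ln_ereal :: "real \<Rightarrow> ereal" where
  "ln_ereal r = (if r = 0 then -\<infinity> else ereal (ln r))"

definition polynomial_fun ::
  "'a topology \<Rightarrow> ('a, 'n::finite) atlas \<Rightarrow> ('a \<Rightarrow> ereal) \<Rightarrow> ('a \<Rightarrow> complex) \<Rightarrow> bool" where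
  "polynomial_fun T A \<rho> f \<longleftrightarrow>
     holo_fun T A f \<and>
     (\<exists>(d::nat) (c::real). c > 0 \<and>
        (\<forall>x\<in>topspace T. ln_ereal (cmod (f x)) \<le> ereal (real d) * max 0 (\<rho> x) + ereal c))"

text \<open>Density of the polynomials for the topology of uniform convergence on compact sets.\<close>

definition regular_parabolic :: "'a topology \<Rightarrow> ('a, 'n::finite) atlas \<Rightarrow> ('a \<Rightarrow> ereal) \<Rightarrow> bool" where
  "regular_parabolic T A \<rho> \<longleftrightarrow>
     (\<forall>f L \<epsilon>. holo_fun T A f \<and> compactin T L \<and> (0::real) < \<epsilon> \<longrightarrow>
        (\<exists>p. polynomial_fun T A \<rho> p \<and> (\<forall>x\<in>L. cmod (f x - p x) < \<epsilon>)))"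

section \<open>Open subsets of the Riemann sphere\<close>

text \<open>Points of the sphere: \<open>Some z\<close> for \<open>z\<close> in the complex plane, and \<open>None\<close> for the point at
  infinity.\<close>

definition sphere_topology :: "complex option topology" where
  "sphere_topology = Alexandroff_compactification euclidean"

definition sphere_atlas :: "(complex option, 1) atlas" where
  "sphere_atlas =
     {(range Some, \<lambda>p. vec (the p)),
      (UNIV - {Some 0}, \<lambda>p. case p of None \<Rightarrow> vec 0 | Some z \<Rightarrow> vec (1 / z))}"

definition restrict_atlas :: "'a set \<Rightarrow> ('a, 'n::finite) atlas \<Rightarrow> ('a, 'n) atlas" where
  "restrict_atlas S A = (\<lambda>(U, h). (U \<inter> S, h)) ` A"

section \<open>The Cantor-type set and its measure\<close>

text \<open>The endpoint pairs \<open>(a, b)\<close> of the intervals of the m-th stage, where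
  \<open>\<delta> = 1/4\<close> and \<open>t\<^sub>m = 4\<^sup>m\<^sup>-\<^sup>1\<close>.\<close>

primrec cantor_intervals :: "nat \<Rightarrow> (real \<times> real) set" where
  "cantor_intervals 0 = {(0, 1)}"
| "cantor_intervals (Suc m) =
     (\<Union>(a, b)\<in>cantor_intervals m. {(a, a + (1/4) ^ (4 ^ m)), (b - (1/4) ^ (4 ^ m), b)})"

definition cantor_stage :: "nat \<Rightarrow> real set" where
  "cantor_stage m = (\<Union>(a, b)\<in>cantor_intervals m. {a..b})"

definition cantor_K :: "real set" where
  "cantor_K = (\<Inter>m\<in>{1..}. cantor_stage m)"

definition cantor_mu_stage :: "nat \<Rightarrow> real measure" where
  "cantor_mu_stage m = measure_of UNIV (sets borel)
     (\<lambda>S. ennreal (1 / (2 * 2 ^ m)) *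
        (\<Sum>(a, b)\<in>cantor_intervals m. emeasure (return borel a) S + emeasure (return borel b) S))"

definition cantor_mu :: "real measure" where
  "cantor_mu = (THE \<mu>. real_distribution \<mu> \<and> weak_conv_m cantor_mu_stage \<mu>)"

definition log_potential :: "real measure \<Rightarrow> complex \<Rightarrow> real" where
  "log_potential \<mu> z = (\<integral>w. ln (cmod (z - of_real w)) \<partial>\<mu>)"

definition cantor_X :: "complex option topology" where
  "cantor_X = subtopology sphere_topology (- (\<lambda>w. Some (of_real w)) ` cantor_K)"

definition cantor_X_atlas :: "(complex option, 1) atlas" where
  "cantor_X_atlas = restrict_atlas (topspace cantor_X) sphere_atlas"

definition cantor_phi :: "complex option \<Rightarrow> ereal" where
  "cantor_phi p = (case p of None \<Rightarrow> -\<infinity> | Some z \<Rightarrow> ereal (- log_potential cantor_mu z))"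

end

theory Submission
  imports Defs "HOL-Complex_Analysis.Complex_Analysis"
begin

text \<open>
  The lengths of the stages shrink so fast that the Cantor set is polar, and yet the potential of
  the Cantor measure grows slowly when seen from the right circles; the two facts give the positive
  and the negative half of the theorem.

  Growth at the Cantor set (\<open>cantor_phi_large_near_K\<close>).  An interval of stage \<open>m\<close> has length
  \<open>l = 4 ^ - 4 ^ (m - 1)\<close> and mass \<open>2 ^ - m\<close>.  A point within \<open>l\<close> of it sees that
  mass at distance at most \<open>2 * l\<close>, so the exhaustion is at least about \<open>2 ^ - m * 4 ^ (m - 1)\<close>
  there.  This is unbounded in \<open>m\<close>, hence the sublevel sets are relatively compact.  Off the
  Cantor set the potential is an average of the harmonic functions \<open>ln \<bar>z - w\<bar>\<close>, so it has the
  mean value property (\<open>cantor_phi_mean\<close>).  In the coordinate \<open>\<zeta> = 1 / z\<close> at infinity the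
  exhaustion is \<open>ln \<bar>\<zeta>\<bar>\<close> plus a harmonic function, hence subharmonic.  Maximality away from
  infinity is the maximum principle, and the domain is Stein because the functions \<open>1 / (z - k)\<close>
  with \<open>k\<close> in the Cantor set separate points and keep holomorphic hulls away from it.

  Polynomials are constant (\<open>polynomial_growth_imp_constant\<close>).  Surround each of the \<open>2 ^ m\<close>
  intervals of stage \<open>m\<close> by a circle of radius \<open>l\<close>.  For a holomorphic \<open>f\<close> the sum of the integrals
  of \<open>(f z - f z0) / (z - z0)\<close> over these circles does not depend on \<open>m\<close>, since a circle of one
  stage is homologous to the circles of its two children, and by moving the contour to infinity it equals
  \<open>2 * pi * \<i> * (f \<infinity> - f z0)\<close>.  On the circles the exhaustion is at most a small multiple of
  \<open>ln (1 / l)\<close>: with \<open>n = m - k\<close>, the ancestor of stage \<open>n\<close> carries only the mass \<open>2 ^ - n\<close>, and the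
  rest of the mass is at distance at least the length of stage \<open>n\<close>, whose logarithm is \<open>4 ^ k\<close> times
  smaller than that of \<open>l\<close>.  Hence \<open>\<bar>f\<bar>\<close> is \<open>O(l powr (- 1 / 2))\<close> on circles of total length
  \<open>O(2 ^ m * l)\<close>, the sum tends to zero, and \<open>f z0\<close> is the value of \<open>f\<close> at infinity.

  So the polynomials are exactly the constants, and they cannot approximate \<open>1 / z\<close>.
\<close>

section \<open>The stages of the Cantor-type set\<close>

text \<open>The exponents \<open>4 ^ (m - 1)\<close> start at \<open>m = 1\<close>; stage \<open>0\<close> is the unit interval and needs its own
  clause.\<close>

definition stage_len :: "nat \<Rightarrow> real" where
  "stage_len m = (case m of 0 \<Rightarrow> 1 | Suc n \<Rightarrow> (1/4) ^ (4 ^ n))"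

lemma stage_len_0 [simp]: "stage_len 0 = 1"
  and stage_len_Suc: "stage_len (Suc m) = (1/4) ^ (4 ^ m)"
  by (simp_all add: stage_len_def)

lemma stage_len_pos: "stage_len m > 0"
  by (simp add: stage_len_def split: nat.split)

lemma stage_len_Suc_le: "4 * stage_len (Suc m) \<le> stage_len m"
proof (cases m)
  case (Suc n)
  have "(4::nat) ^ Suc n = 4 ^ n + 3 * 4 ^ n" by simp
  then have "stage_len (Suc m) = (1/4) ^ (4 ^ n) * (1/4) ^ (3 * 4 ^ n)"
    by (simp only: stage_len_Suc Suc power_add)
  also have "\<dots> \<le> (1/4) ^ (4 ^ n) * (1/4) ^ 1"
    by (intro mult_left_mono power_decreasing) (use one_le_power[of "4::nat" n] in auto)
  finally show ?thesis by (simp add: Suc stage_len_Suc)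
qed (simp add: stage_len_Suc)

lemma stage_len_antimono: "m \<le> n \<Longrightarrow> stage_len n \<le> stage_len m"
proof (rule lift_Suc_antimono_le[of stage_len])
  show "stage_len (Suc k) \<le> stage_len k" for k
    using stage_len_Suc_le[of k] stage_len_pos[of "Suc k"] by linarith
qed

lemma stage_len_le_1: "stage_len m \<le> 1"
  using stage_len_antimono[of 0 m] by simp

lemma stage_len_le_power: "stage_len m \<le> (1/4) ^ m"
proof (induction m)
  case (Suc m)
  then show ?case using stage_len_Suc_le[of m] by simp
qed simp

lemma cantor_intervals_Suc:
  "cantor_intervals (Suc m) =
     (\<Union>(a, b)\<in>cantor_intervals m. {(a, a + stage_len (Suc m)), (b - stage_len (Suc m), b)})"
  by (simp add: stage_len_Suc)

declare cantor_intervals.simps(2) [simp del]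

lemma in_cantor_stage_iff:
  "x \<in> cantor_stage m \<longleftrightarrow> (\<exists>a b. (a, b) \<in> cantor_intervals m \<and> x \<in> {a..b})"
  unfolding cantor_stage_def by blast

lemma cantor_interval_length:
  "(a, b) \<in> cantor_intervals m \<Longrightarrow> b = a + stage_len m"
  by (cases m) (auto simp: cantor_intervals_Suc)

lemma cantor_interval_child:
  assumes "(a, b) \<in> cantor_intervals (Suc m)"
  obtains c where "(c, c + stage_len m) \<in> cantor_intervals m"
    "b = a + stage_len (Suc m)" "a = c \<or> a = c + stage_len m - stage_len (Suc m)"
proof -
  from assms obtain c d where cd: "(c, d) \<in> cantor_intervals m"
    "(a, b) \<in> {(c, c + stage_len (Suc m)), (d - stage_len (Suc m), d)}"
    unfolding cantor_intervals_Suc by blast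
  moreover have "d = c + stage_len m"
    using cd(1) by (rule cantor_interval_length)
  ultimately show ?thesis by (intro that[of c]) auto
qed

lemma cantor_interval_children:
  assumes "(a, b) \<in> cantor_intervals m"
  shows "(a, a + stage_len (Suc m)) \<in> cantor_intervals (Suc m)"
    "(b - stage_len (Suc m), b) \<in> cantor_intervals (Suc m)"
  using assms unfolding cantor_intervals_Suc by blast+

lemma cantor_interval_bounds:
  "(a, b) \<in> cantor_intervals m \<Longrightarrow> 0 \<le> a \<and> a < b \<and> b \<le> 1"
proof (induction m arbitrary: a b)
  case (Suc m)
  from Suc.prems obtain c where c: "(c, c + stage_len m) \<in> cantor_intervals m"
    "b = a + stage_len (Suc m)" "a = c \<or> a = c + stage_len m - stage_len (Suc m)"
    by (rule cantor_interval_child)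
  then show ?case
    using Suc.IH[OF c(1)] stage_len_Suc_le[of m] stage_len_pos[of "Suc m"] stage_len_pos[of m] by auto
qed simp

text \<open>Lengths shrink at least fourfold, so at least half of a parent, hence at least twice the length
  of a child, remains between its two children.  Gaps between different parents are larger still.\<close>

lemma cantor_interval_gap:
  assumes "(a, b) \<in> cantor_intervals m" "(a', b') \<in> cantor_intervals m" "a < a'"
  shows "b + 2 * stage_len m \<le> a'"
  using assms
proof (induction m arbitrary: a b a' b')
  case (Suc m)
  note le = stage_len_Suc_le[of m] stage_len_pos[of "Suc m"] 
  from Suc.prems(1) obtain c where c: "(c, c + stage_len m) \<in> cantor_intervals m"
    "b = a + stage_len (Suc m)" "a = c \<or> a = c + stage_len m - stage_len (Suc m)"
    by (rule cantor_interval_child)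
  from Suc.prems(2) obtain c' where c': "(c', c' + stage_len m) \<in> cantor_intervals m"
    "b' = a' + stage_len (Suc m)" "a' = c' \<or> a' = c' + stage_len m - stage_len (Suc m)"
    by (rule cantor_interval_child)
  consider "c < c'" | "c = c'" | "c' < c" by linarith
  then show ?case
  proof cases
    case 1
    then show ?thesis using Suc.IH[OF c(1) c'(1)] c c' le by auto
  next
    case 2
    then show ?thesis using c c' le \<open>a < a'\<close> by auto
  next
    case 3
    then show ?thesis using Suc.IH[OF c'(1) c(1)] c c' le \<open>a < a'\<close> by auto
  qed
qed simp

lemma finite_cantor_intervals [simp]: "finite (cantor_intervals m)"
  by (induction m) (auto simp: cantor_intervals_Suc)

lemma cantor_interval_eqI:
  assumes "(a, b) \<in> cantor_intervals m" "(a', b') \<in> cantor_intervals m" "x \<in> {a..b}" "x \<in> {a'..b'}"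
  shows "(a, b) = (a', b')"
proof -
  have "a = a'"
  proof (rule ccontr)
    assume "a \<noteq> a'"
    then have "a < a' \<or> a' < a" by linarith
    then show False
      using cantor_interval_gap[OF assms(1,2)] cantor_interval_gap[OF assms(2,1)] assms(3,4)
        stage_len_pos[of m] by auto
  qed
  then show ?thesis
    using cantor_interval_length[OF assms(1)] cantor_interval_length[OF assms(2)] by simp
qed

text \<open>Sums over a stage are evaluated by recursion; the counting functions and the contour integrals
  below both rest on this.\<close>

lemma sum_cantor_intervals_Suc:
  fixes f :: "real \<times> real \<Rightarrow> 'a::comm_monoid_add"
  shows "(\<Sum>p\<in>cantor_intervals (Suc m). f p) =
    (\<Sum>(a, b)\<in>cantor_intervals m. f (a, a + stage_len (Suc m)) + f (b - stage_len (Suc m), b))"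
proof -
  let ?C = "\<lambda>(a, b). {(a, a + stage_len (Suc m)), (b - stage_len (Suc m), b)}"
  have ineq: "a \<noteq> b - stage_len (Suc m)" if "(a, b) \<in> cantor_intervals m" for a b
    using cantor_interval_length[OF that] stage_len_Suc_le[of m] stage_len_pos[of "Suc m"] by auto
  have "(\<Sum>p\<in>cantor_intervals (Suc m). f p) = (\<Sum>I\<in>cantor_intervals m. \<Sum>p\<in>?C I. f p)"
    unfolding cantor_intervals_Suc
  proof (rule sum.UNION_disjoint)
    have "?C (a, b) \<inter> ?C (c, d) = {}" if I: "(a, b) \<in> cantor_intervals m" and J: "(c, d) \<in> cantor_intervals m"
        and ne: "(a, b) \<noteq> (c, d)" for a b c d
    proof (rule ccontr)
      assume "?C (a, b) \<inter> ?C (c, d) \<noteq> {}"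
      then obtain p where "p \<in> ?C (a, b)" "p \<in> ?C (c, d)" by blast
      then obtain x y where xy: "(x, y) \<in> ?C (a, b)" "(x, y) \<in> ?C (c, d)" by (cases p) blast
      have "x \<in> {a..b}" "x \<in> {c..d}"
        using xy cantor_interval_length[OF I] cantor_interval_length[OF J]
          stage_len_Suc_le[of m] stage_len_pos[of "Suc m"] by auto
      from cantor_interval_eqI[OF I J this] ne show False by simp
    qed
    then show "\<forall>I\<in>cantor_intervals m. \<forall>J\<in>cantor_intervals m. I \<noteq> J \<longrightarrow> ?C I \<inter> ?C J = {}"
      by blast
  qed auto
  also have "\<dots> = (\<Sum>(a, b)\<in>cantor_intervals m. f (a, a + stage_len (Suc m)) + f (b - stage_len (Suc m), b))"
    by (intro sum.cong refl) (use ineq in auto)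
  finally show ?thesis .
qed

lemma card_cantor_intervals: "card (cantor_intervals m) = 2 ^ m"
proof (induction m)
  case (Suc m)
  have "card (cantor_intervals (Suc m)) = (\<Sum>p\<in>cantor_intervals (Suc m). 1)" by simp
  also have "\<dots> = 2 * card (cantor_intervals m)"
    unfolding sum_cantor_intervals_Suc by (simp add: case_prod_unfold)
  finally show ?case using Suc by simp
qed simp

lemma cantor_stage_Suc: "cantor_stage (Suc m) \<subseteq> cantor_stage m"
proof
  fix x assume "x \<in> cantor_stage (Suc m)"
  then obtain a b where ab: "(a, b) \<in> cantor_intervals (Suc m)" "x \<in> {a..b}"
    unfolding in_cantor_stage_iff by blast
  from ab(1) obtain c where c: "(c, c + stage_len m) \<in> cantor_intervals m"
    "b = a + stage_len (Suc m)" "a = c \<or> a = c + stage_len m - stage_len (Suc m)"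
    by (rule cantor_interval_child)
  have "x \<in> {c..c + stage_len m}"
    using ab(2) c(2,3) stage_len_Suc_le[of m] stage_len_pos[of "Suc m"] by auto
  with c(1) show "x \<in> cantor_stage m" unfolding in_cantor_stage_iff by blast
qed

lemma cantor_stage_antimono: "m \<le> n \<Longrightarrow> cantor_stage n \<subseteq> cantor_stage m"
  by (rule lift_Suc_antimono_le[of cantor_stage]) (rule cantor_stage_Suc)

lemma cantor_K_eq: "cantor_K = (\<Inter>m. cantor_stage m)"
proof -
  have "x \<in> cantor_stage m" if "\<forall>m\<in>{1..}. x \<in> cantor_stage m" for x m
    using that cantor_stage_Suc[of 0] by (cases m) auto
  then show ?thesis unfolding cantor_K_def by blast
qed

lemma cantor_K_interval:
  assumes "x \<in> cantor_K"
  obtains a b where "(a, b) \<in> cantor_intervals m" "x \<in> {a..b}"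
  using assms unfolding cantor_K_eq INT_iff in_cantor_stage_iff by blast

lemma closed_cantor_stage: "closed (cantor_stage m)"
  unfolding cantor_stage_def by (intro closed_UN) auto

lemma closed_cantor_K: "closed cantor_K"
  unfolding cantor_K_eq by (intro closed_INT ballI closed_cantor_stage)

lemma cantor_K_subset: "cantor_K \<subseteq> {0..1}"
proof -
  have "cantor_K \<subseteq> cantor_stage 0" unfolding cantor_K_eq by blast
  then show ?thesis by (simp add: cantor_stage_def)
qed

lemma compact_cantor_K: "compact cantor_K"
  using closed_cantor_K cantor_K_subset compact_Icc[of 0 "1::real"]
  by (metis closed_Int_compact inf.absorb1)

lemma zero_in_cantor_K: "0 \<in> cantor_K"
proof -
  have "(0, stage_len m) \<in> cantor_intervals m" for m
  proof (induction m)
    case (Suc m)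
    from cantor_interval_children(1)[OF this] show ?case by simp
  qed simp
  then have "0 \<in> cantor_stage m" for m
    unfolding in_cantor_stage_iff using stage_len_pos[of m] by (intro exI[of _ 0] exI[of _ "stage_len m"]) auto
  then show ?thesis unfolding cantor_K_eq by auto
qed

text \<open>The gap on either side of an interval is twice its length.\<close>

lemma cantor_K_near_interval:
  assumes I: "(a, b) \<in> cantor_intervals m" and w: "w \<in> cantor_K"
    and near: "a - 2 * stage_len m < w" "w < b + 2 * stage_len m"
  shows "w \<in> {a..b}"
proof -
  obtain c d where J: "(c, d) \<in> cantor_intervals m" "w \<in> {c..d}"
    using cantor_K_interval[OF w] by blast
  have "\<not> a < c" "\<not> c < a"
    using cantor_interval_gap[OF I J(1)] cantor_interval_gap[OF J(1) I] near J(2) by auto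
  then have "a = c" by simp
  then show ?thesis
    using J cantor_interval_length[OF I] cantor_interval_length[OF J(1)] by auto
qed

lemma cantor_K_in_child:
  assumes I: "(a, b) \<in> cantor_intervals m" and w: "w \<in> cantor_K" "w \<in> {a..b}"
  shows "w \<in> {a..a + stage_len (Suc m)} \<union> {b - stage_len (Suc m)..b}"
proof -
  obtain c d where J: "(c, d) \<in> cantor_intervals (Suc m)" "w \<in> {c..d}"
    using cantor_K_interval[OF w(1)] by blast
  from J(1) obtain c' where c: "(c', c' + stage_len m) \<in> cantor_intervals m"
    "d = c + stage_len (Suc m)" "c = c' \<or> c = c' + stage_len m - stage_len (Suc m)"
    by (rule cantor_interval_child)
  have "w \<in> {c'..c' + stage_len m}"
    using J(2) c(2,3) stage_len_Suc_le[of m] stage_len_pos[of "Suc m"] by auto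
  from cantor_interval_eqI[OF I c(1) w(2) this] have "a = c'" "b = c' + stage_len m" by auto
  with c J(2) show ?thesis by auto
qed

section \<open>The Cantor measure\<close>

text \<open>Counting the intervals that begin, respectively end, before \<open>x\<close> gives upper and lower
  approximations of the distribution function of the Cantor measure: the first decreases and the
  second increases with the stage, and they differ by at most \<open>2 ^ - m\<close>.\<close>

definition left_count :: "nat \<Rightarrow> real \<Rightarrow> real" where
  "left_count m x = (\<Sum>(a, b)\<in>cantor_intervals m. of_bool (a \<le> x)) / 2 ^ m"

definition right_count :: "nat \<Rightarrow> real \<Rightarrow> real" where
  "right_count m x = (\<Sum>(a, b)\<in>cantor_intervals m. of_bool (b \<le> x)) / 2 ^ m"

text \<open>Neither child begins before its parent.\<close>

lemma left_count_Suc: "left_count (Suc m) x \<le> left_count m x"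
proof -
  have "(\<Sum>p\<in>cantor_intervals (Suc m). (case p of (a, b) \<Rightarrow> of_bool (a \<le> x))) \<le>
        (\<Sum>(a, b)\<in>cantor_intervals m. 2 * of_bool (a \<le> x) :: real)"
    unfolding sum_cantor_intervals_Suc
  proof (rule sum_mono, goal_cases)
    case (1 p)
    obtain a b where ab: "p = (a, b)" by force
    have "a \<le> b - stage_len (Suc m)"
      using cantor_interval_length[of a b m] 1 ab stage_len_Suc_le[of m] stage_len_pos[of "Suc m"] by auto
    then show ?case by (auto simp: ab)
  qed
  also have "\<dots> = 2 * (\<Sum>(a, b)\<in>cantor_intervals m. of_bool (a \<le> x))"
    by (simp add: sum_distrib_left case_prod_unfold)
  finally show ?thesis
    by (simp add: left_count_def field_simps)
qed

text \<open>Neither child ends after its parent.\<close>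

lemma right_count_Suc: "right_count m x \<le> right_count (Suc m) x"
proof -
  have "2 * (\<Sum>(a, b)\<in>cantor_intervals m. of_bool (b \<le> x)) =
        (\<Sum>(a, b)\<in>cantor_intervals m. 2 * of_bool (b \<le> x) :: real)"
    by (simp add: sum_distrib_left case_prod_unfold)
  also have "\<dots> \<le> (\<Sum>p\<in>cantor_intervals (Suc m). (case p of (a, b) \<Rightarrow> of_bool (b \<le> x)))"
    unfolding sum_cantor_intervals_Suc
  proof (rule sum_mono, goal_cases)
    case (1 p)
    obtain a b where ab: "p = (a, b)" by force
    have "a + stage_len (Suc m) \<le> b"
      using cantor_interval_length[of a b m] 1 ab stage_len_Suc_le[of m] stage_len_pos[of "Suc m"] by auto
    then show ?case by (auto simp: ab)
  qed
  finally show ?thesis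
    by (simp add: right_count_def field_simps)
qed

lemma right_count_le_left_count: "right_count m x \<le> left_count m x"
  unfolding left_count_def right_count_def
proof (intro divide_right_mono sum_mono, clarsimp)
  fix a b assume "(a, b) \<in> cantor_intervals m" "b \<le> x"
  then show "a \<le> x" using cantor_interval_bounds[of a b m] by auto
qed auto

text \<open>An interval that has begun but not ended at \<open>x\<close> contains \<open>x\<close>, and at most one does.\<close>

lemma left_count_le_right_count: "left_count m x \<le> right_count m x + 1 / 2 ^ m"
proof -
  let ?S = "{p \<in> cantor_intervals m. fst p \<le> x \<and> x < snd p}"
  have "card ?S \<le> 1"
  proof (subst card_le_Suc0_iff_eq[unfolded One_nat_def[symmetric]])
    show "\<forall>p\<in>?S. \<forall>q\<in>?S. p = q"
      using cantor_interval_eqI[of _ _ m _ _ x] by force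
  qed auto
  have "(\<Sum>(a, b)\<in>cantor_intervals m. of_bool (a \<le> x)) - (\<Sum>(a, b)\<in>cantor_intervals m. of_bool (b \<le> x))
     = (\<Sum>p\<in>cantor_intervals m. of_bool (fst p \<le> x \<and> x < snd p) :: real)"
    unfolding sum_subtractf[symmetric]
    by (intro sum.cong refl) (use cantor_interval_bounds in \<open>fastforce split: prod.splits\<close>)
  also have "\<dots> = card ?S" by (simp add: Int_def)
  also have "\<dots> \<le> 1" using \<open>card ?S \<le> 1\<close> by simp
  finally show ?thesis
    by (simp add: left_count_def right_count_def add_divide_distrib[symmetric] divide_right_mono)
qed

definition cantor_cdf :: "real \<Rightarrow> real" where
  "cantor_cdf x = lim (\<lambda>m. left_count m x)"

lemma left_count_nonneg: "0 \<le> left_count m x"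
  unfolding left_count_def by (intro divide_nonneg_nonneg sum_nonneg) auto

lemma left_count_tendsto: "(\<lambda>m. left_count m x) \<longlonglongrightarrow> cantor_cdf x"
proof -
  have "Bseq (\<lambda>m. left_count m x)"
  proof (rule BseqI')
    have "left_count m x \<le> left_count 0 x" for m
      by (rule lift_Suc_antimono_le[of "\<lambda>m. left_count m x"]) (auto intro: left_count_Suc)
    then show "norm (left_count m x) \<le> left_count 0 x" for m
      using left_count_nonneg[of m x] by simp
  qed
  moreover have "monoseq (\<lambda>m. left_count m x)"
    by (intro decseq_imp_monoseq decseq_SucI left_count_Suc)
  ultimately show ?thesis
    unfolding cantor_cdf_def by (intro convergent_LIMSEQ_iff[THEN iffD1] Bseq_monoseq_convergent)
qed

lemma right_count_tendsto: "(\<lambda>m. right_count m x) \<longlonglongrightarrow> cantor_cdf x"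
proof (rule tendsto_sandwich[OF _ _ _ left_count_tendsto])
  show "(\<lambda>m. left_count m x - (1/2)^m) \<longlonglongrightarrow> cantor_cdf x"
    by (rule tendsto_eq_intros left_count_tendsto LIMSEQ_realpow_zero | simp)+
  show "\<forall>\<^sub>F m in sequentially. left_count m x - (1/2)^m \<le> right_count m x"
    using left_count_le_right_count[of _ x] by (intro always_eventually) (auto simp: power_divide algebra_simps)
qed (intro always_eventually allI right_count_le_left_count)

lemma cantor_cdf_le: "cantor_cdf x \<le> left_count m x"
  by (rule decseq_ge[OF _ left_count_tendsto]) (auto intro: decseq_SucI left_count_Suc)

lemma cantor_cdf_ge: "right_count m x \<le> cantor_cdf x"
  by (rule incseq_le[OF _ right_count_tendsto]) (auto intro: incseq_SucI right_count_Suc)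

lemma cantor_cdf_mono: "x \<le> y \<Longrightarrow> cantor_cdf x \<le> cantor_cdf y"
  by (rule LIMSEQ_le[OF left_count_tendsto left_count_tendsto])
     (auto simp: left_count_def intro!: exI[of _ 0] divide_right_mono sum_mono)

text \<open>The approximation \<open>left_count m\<close> is constant immediately to the right of \<open>x\<close>, and it is within
  \<open>2 ^ - m\<close> of the limit.\<close>

lemma cantor_cdf_right_continuous: "continuous (at_right x) cantor_cdf"
  unfolding continuous_within
proof (rule tendstoI)
  fix e :: real assume "e > 0"
  then obtain m where m: "(1/2) ^ m < e"
    using real_arch_pow_inv[of e "1/2"] by auto
  have "\<forall>\<^sub>F y in at_right x. \<forall>p\<in>cantor_intervals m. fst p \<le> y \<longleftrightarrow> fst p \<le> x"
  proof (intro eventually_ball_finite ballI finite_cantor_intervals)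
    fix p :: "real \<times> real"
    show "\<forall>\<^sub>F y in at_right x. fst p \<le> y \<longleftrightarrow> fst p \<le> x"
    proof (cases "fst p \<le> x")
      case True
      then show ?thesis by (auto simp: eventually_at_filter intro!: always_eventually)
    next
      case False
      then have "\<forall>\<^sub>F y in at_right x. y < fst p"
        unfolding eventually_at_right_field by (intro exI[of _ "fst p"]) auto
      then show ?thesis by eventually_elim (use False in auto)
    qed
  qed
  then have "\<forall>\<^sub>F y in at_right x. left_count m y = left_count m x"
  proof eventually_elim
    case (elim y)
    then show ?case unfolding left_count_def
      by (intro arg_cong2[of _ _ _ _ "(/)"] sum.cong refl) (auto split: prod.splits)
  qed
  moreover have "\<forall>\<^sub>F y in at_right x. x < y"
    by (auto simp: eventually_at_filter)
  ultimately show "\<forall>\<^sub>F y in at_right x. dist (cantor_cdf y) (cantor_cdf x) < e"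
  proof eventually_elim
    case (elim y)
    have "cantor_cdf y \<le> right_count m x + (1/2) ^ m"
      using cantor_cdf_le[of y m] left_count_le_right_count[of m x] elim(1) by (simp add: power_divide)
    then show ?case
      using cantor_cdf_ge[of m x] cantor_cdf_mono[of x y] elim(2) m by (auto simp: dist_real_def)
  qed
qed

lemma cantor_cdf_neg: "x < 0 \<Longrightarrow> cantor_cdf x = 0"
proof -
  assume "x < 0"
  then have "left_count 0 x = 0" by (simp add: left_count_def)
  then show ?thesis
    using cantor_cdf_le[of x 0] LIMSEQ_le_const[OF left_count_tendsto[of x], of 0] left_count_nonneg by force
qed

lemma cantor_cdf_ge_1: "1 \<le> x \<Longrightarrow> cantor_cdf x = 1"
proof -
  assume "1 \<le> x"
  then have "left_count 0 x = 1" "right_count 0 x = 1" by (simp_all add: left_count_def right_count_def)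
  then show ?thesis
    using cantor_cdf_le[of x 0] cantor_cdf_ge[of 0 x] by simp
qed

lemma cantor_cdf_at_bot: "(cantor_cdf \<longlongrightarrow> 0) at_bot"
  by (rule tendsto_eventually) (auto simp: eventually_at_bot_linorder intro!: exI[of _ "-1"] cantor_cdf_neg)

lemma cantor_cdf_at_top: "(cantor_cdf \<longlongrightarrow> 1) at_top"
  by (rule tendsto_eventually) (auto simp: eventually_at_top_linorder intro!: exI[of _ 1] cantor_cdf_ge_1)

text \<open>The two end points of an interval share its mass, whence the average.  The function in the
  definition of the stage measure has to be checked to be countably additive first.\<close>

lemma cdf_cantor_mu_stage: "cdf (cantor_mu_stage m) x = (left_count m x + right_count m x) / 2"
proof -
  let ?f = "\<lambda>S. ennreal (1 / (2 * 2 ^ m)) *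
     (\<Sum>(a, b)\<in>cantor_intervals m. emeasure (return borel a) S + emeasure (return borel b) S)"
  have "emeasure (cantor_mu_stage m) {..x} = ?f {..x}"
    unfolding cantor_mu_stage_def
  proof (rule emeasure_measure_of_sigma)
    show "sigma_algebra UNIV (sets (borel :: real measure))"
      using sets.sigma_algebra_axioms[of "borel :: real measure"] by simp
    show "positive (sets borel) ?f" by (simp add: positive_def)
    show "countably_additive (sets borel) ?f"
      unfolding countably_additive_def
    proof (intro allI impI)
      fix A :: "nat \<Rightarrow> real set"
      assume A: "range A \<subseteq> sets borel" "disjoint_family A"
      have *: "(\<Sum>i. emeasure (return borel a) (A i)) = emeasure (return borel a) (\<Union>i. A i)" for a :: real
        by (rule suminf_emeasure) (use A in auto)
      have "(\<Sum>i. ?f (A i)) = ennreal (1 / (2 * 2 ^ m)) *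
          (\<Sum>i. \<Sum>(a, b)\<in>cantor_intervals m. emeasure (return borel a) (A i) + emeasure (return borel b) (A i))"
        by (rule ennreal_suminf_cmult)
      also have "(\<Sum>i. \<Sum>(a, b)\<in>cantor_intervals m. emeasure (return borel a) (A i) + emeasure (return borel b) (A i))
         = (\<Sum>p\<in>cantor_intervals m. \<Sum>i. emeasure (return borel (fst p)) (A i) + emeasure (return borel (snd p)) (A i))"
        unfolding case_prod_unfold by (intro suminf_sum) auto
      also have "\<dots> = (\<Sum>(a, b)\<in>cantor_intervals m.
           emeasure (return borel a) (\<Union>i. A i) + emeasure (return borel b) (\<Union>i. A i))"
        unfolding case_prod_unfold *[symmetric] by (intro sum.cong refl suminf_add[symmetric]) auto
      finally show "(\<Sum>i. ?f (A i)) = ?f (\<Union>i. A i)" .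
    qed
  qed auto
  also have "\<dots> = ennreal (1 / (2 * 2 ^ m)) *
     (\<Sum>(a, b)\<in>cantor_intervals m. ennreal (of_bool (a \<le> x) + of_bool (b \<le> x)))"
    by (intro arg_cong[of _ _ "(*) _"] sum.cong refl) (auto simp: indicator_def split: prod.splits)
  also have "\<dots> = ennreal (1 / (2 * 2 ^ m)) *
     ennreal (\<Sum>(a, b)\<in>cantor_intervals m. of_bool (a \<le> x) + of_bool (b \<le> x))"
    unfolding case_prod_unfold by (subst sum_ennreal) auto
  also have "\<dots> = ennreal ((1 / (2 * 2 ^ m)) * (\<Sum>(a, b)\<in>cantor_intervals m. of_bool (a \<le> x) + of_bool (b \<le> x)))"
    by (rule ennreal_mult[symmetric]) (auto intro!: sum_nonneg)
  also have "(1 / (2 * 2 ^ m)) * (\<Sum>(a, b)\<in>cantor_intervals m. of_bool (a \<le> x) + of_bool (b \<le> x))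
     = (left_count m x + right_count m x) / 2"
    unfolding left_count_def right_count_def case_prod_unfold sum.distrib by (simp add: field_simps)
  finally show ?thesis
    using left_count_nonneg[of m x]
    by (simp add: cdf_def measure_def right_count_def sum_nonneg case_prod_unfold)
qed

lemmas cantor_cdf_props = cantor_cdf_mono cantor_cdf_right_continuous cantor_cdf_at_bot cantor_cdf_at_top

lemma real_distribution_cantor_cdf: "real_distribution (interval_measure cantor_cdf)"
  by (rule real_distribution_interval_measure) (rule cantor_cdf_props, assumption?)+

lemma cdf_interval_measure_cantor: "cdf (interval_measure cantor_cdf) = cantor_cdf"
  by (rule cdf_interval_measure) (rule cantor_cdf_props, assumption?)+

text \<open>Weak convergence determines a limit only at its continuity points.  These are dense, the atoms
  being countable, so right continuity extends the equality to all points.\<close>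

lemma cantor_mu_eq: "cantor_mu = interval_measure cantor_cdf"
  unfolding cantor_mu_def
proof (rule the_equality)
  have conv: "(\<lambda>m. cdf (cantor_mu_stage m) x) \<longlonglongrightarrow> cantor_cdf x" for x
    unfolding cdf_cantor_mu_stage
    by (rule tendsto_eq_intros left_count_tendsto right_count_tendsto | simp)+
  then show "real_distribution (interval_measure cantor_cdf) \<and>
      weak_conv_m cantor_mu_stage (interval_measure cantor_cdf)"
    using real_distribution_cantor_cdf
    by (simp add: weak_conv_m_def weak_conv_def cdf_interval_measure_cantor)
  fix M assume M: "real_distribution M \<and> weak_conv_m cantor_mu_stage M"
  then interpret M: real_distribution M by simp
  have eq: "cdf M x = cantor_cdf x" if "isCont (cdf M) x" for x
    using M that conv LIMSEQ_unique unfolding weak_conv_m_def weak_conv_def by blast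
  have "cdf M x = cantor_cdf x" for x
  proof (rule ccontr)
    assume "cdf M x \<noteq> cantor_cdf x"
    moreover have "((\<lambda>y. cdf M y - cantor_cdf y) \<longlongrightarrow> cdf M x - cantor_cdf x) (at_right x)"
      using M.cdf_is_right_cont[of x] cantor_cdf_right_continuous[of x]
      unfolding continuous_within by (intro tendsto_diff)
    ultimately have "\<forall>\<^sub>F y in at_right x. cdf M y - cantor_cdf y \<noteq> 0"
      by (intro tendsto_imp_eventually_ne) auto
    then obtain b where b: "x < b" "\<And>y. x < y \<Longrightarrow> y < b \<Longrightarrow> cdf M y \<noteq> cantor_cdf y"
      unfolding eventually_at_right_field by auto
    have "uncountable {x<..<b}" using b(1) by (simp add: uncountable_open_interval)
    then have "\<not> {x<..<b} \<subseteq> {y. measure M {y} > 0}"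
      using M.countable_atoms countable_subset by blast
    then obtain y where "x < y" "y < b" "measure M {y} = 0"
      by (auto simp: zero_less_measure_iff)
    then show False using b(2) eq M.isCont_cdf by blast
  qed
  then show "M = interval_measure cantor_cdf"
    using M real_distribution_cantor_cdf cdf_interval_measure_cantor by (intro cdf_unique) auto
qed

interpretation cantor: real_distribution cantor_mu
  unfolding cantor_mu_eq by (rule real_distribution_cantor_cdf)

lemma cdf_cantor_mu: "cdf cantor_mu = cantor_cdf"
  by (simp add: cantor_mu_eq cdf_interval_measure_cantor)

text \<open>Increments of the distribution function measure half-open intervals.  The closed interval is the
  intersection of such intervals that begin slightly earlier, and the number of right ends up to \<open>b\<close>
  exceeds the number of left ends up to any point before \<open>a\<close>.\<close>

lemma cantor_mu_interval_ge:
  assumes I: "(a, b) \<in> cantor_intervals m"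
  shows "1 / 2 ^ m \<le> measure cantor_mu {a..b}"
proof (rule LIMSEQ_le_const)
  let ?A = "\<lambda>n::nat. {a - 1 / Suc n<..b}"
  have "(\<lambda>n. measure cantor_mu (?A n)) \<longlonglongrightarrow> measure cantor_mu (\<Inter>n. ?A n)"
  proof (rule cantor.finite_Lim_measure_decseq)
    have "1 / (1 + real n) \<le> 1 / (1 + real m)" if "m \<le> n" for m n
      using that by (intro divide_left_mono) auto
    then show "decseq ?A" by (force simp: decseq_def)
  qed auto
  also have "(\<Inter>n. ?A n) = {a..b}"
  proof (intro equalityI subsetI)
    fix x assume x: "x \<in> (\<Inter>n. ?A n)"
    have "(\<lambda>n. a - 1 / Suc n) \<longlonglongrightarrow> a - 0"
      by (intro tendsto_diff tendsto_const LIMSEQ_Suc[OF lim_1_over_n])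
    then have "a - 0 \<le> x"
      by (rule LIMSEQ_le_const2) (use x in \<open>auto intro!: exI[of _ 0] less_imp_le\<close>)
    with x show "x \<in> {a..b}" by auto
  next
    fix x assume x: "x \<in> {a..b}"
    have "x \<in> ?A n" for n
    proof -
      have "0 < 1 / real (Suc n)" by simp
      with x show ?thesis unfolding atLeastAtMost_iff greaterThanAtMost_iff by linarith
    qed
    then show "x \<in> (\<Inter>n. ?A n)" by blast
  qed
  finally show "(\<lambda>n. measure cantor_mu (?A n)) \<longlonglongrightarrow> measure cantor_mu {a..b}" .
  show "\<exists>N. \<forall>n\<ge>N. 1 / 2 ^ m \<le> measure cantor_mu (?A n)"
  proof (intro exI allI impI)
    fix n :: nat
    define c where "c = a - 1 / Suc n"
    have "c < a" by (simp add: c_def)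
    then have "c < b" using cantor_interval_bounds[OF I] by simp
    have "1 = (\<Sum>p\<in>cantor_intervals m. if p = (a, b) then 1 else (0::real))"
      using I by simp
    also have "\<dots> \<le> (\<Sum>p\<in>cantor_intervals m. of_bool (snd p \<le> b) - of_bool (fst p \<le> c))"
    proof (intro sum_mono)
      fix p assume p: "p \<in> cantor_intervals m"
      obtain a' b' where ab': "p = (a', b')" by force
      have "b' \<le> b" if "a' \<le> c"
        using cantor_interval_gap[of a' b' m a b] p ab' I that \<open>c < a\<close> cantor_interval_bounds[OF I]
          stage_len_pos[of m] by auto
      with ab' \<open>c < a\<close> show "(if p = (a, b) then 1 else (0::real)) \<le> of_bool (snd p \<le> b) - of_bool (fst p \<le> c)"
        by auto
    qed
    finally have "1 / 2 ^ m \<le> right_count m b - left_count m c"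
      unfolding right_count_def left_count_def
      by (simp add: sum_subtractf case_prod_unfold diff_divide_distrib[symmetric] divide_right_mono)
    also have "\<dots> \<le> cantor_cdf b - cantor_cdf c"
      using cantor_cdf_le[of c m] cantor_cdf_ge[of m b] by simp
    also have "\<dots> = measure cantor_mu {c<..b}"
      using cantor.cdf_diff_eq[OF \<open>c < b\<close>] by (simp add: cdf_cantor_mu)
    finally show "1 / 2 ^ m \<le> measure cantor_mu (?A n)" by (simp add: c_def)
  qed
qed

lemma cantor_mu_stage_eq_sum:
  "measure cantor_mu (cantor_stage m) = (\<Sum>(a, b)\<in>cantor_intervals m. measure cantor_mu {a..b})"
proof -
  have "measure cantor_mu (\<Union>p\<in>cantor_intervals m. {fst p..snd p}) =
      (\<Sum>p\<in>cantor_intervals m. measure cantor_mu {fst p..snd p})"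
  proof (rule cantor.finite_measure_finite_Union)
    show "disjoint_family_on (\<lambda>p. {fst p..snd p}) (cantor_intervals m)"
      unfolding disjoint_family_on_def
    proof (intro ballI impI, rule ccontr)
      fix p q assume pq: "p \<in> cantor_intervals m" "q \<in> cantor_intervals m" "p \<noteq> q"
        and "{fst p..snd p} \<inter> {fst q..snd q} \<noteq> {}"
      then obtain x where "x \<in> {fst p..snd p}" "x \<in> {fst q..snd q}" by blast
      with pq cantor_interval_eqI[of "fst p" "snd p" m "fst q" "snd q" x] show False by simp
    qed
  qed auto
  then show ?thesis by (simp add: cantor_stage_def case_prod_unfold)
qed

text \<open>The lower bounds for all \<open>2 ^ m\<close> intervals add up to the total mass, so none can be strict.\<close>

lemma cantor_mu_interval:
  assumes I: "(a, b) \<in> cantor_intervals m"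
  shows "measure cantor_mu {a..b} = 1 / 2 ^ m"
proof (rule antisym[OF _ cantor_mu_interval_ge[OF I]])
  have "measure cantor_mu {a..b} + (2 ^ m - 1) / 2 ^ m
      = measure cantor_mu {a..b} + (\<Sum>p\<in>cantor_intervals m - {(a, b)}. 1 / 2 ^ m)"
    using I by (simp add: card_Diff_singleton card_cantor_intervals of_nat_diff)
  also have "\<dots> \<le> measure cantor_mu {a..b} +
      (\<Sum>(a, b)\<in>cantor_intervals m - {(a, b)}. measure cantor_mu {a..b})"
    by (intro add_left_mono sum_mono) (auto intro: cantor_mu_interval_ge)
  also have "\<dots> = measure cantor_mu (cantor_stage m)"
    unfolding cantor_mu_stage_eq_sum using sum.remove[OF finite_cantor_intervals I, of "\<lambda>(a, b). measure cantor_mu {a..b}"]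
    by simp
  also have "\<dots> \<le> 1" by (rule cantor.prob_le_1)
  finally show "measure cantor_mu {a..b} \<le> 1 / 2 ^ m" by (simp add: field_simps)
qed

lemma cantor_mu_K: "measure cantor_mu cantor_K = 1"
proof -
  have "(\<lambda>m. measure cantor_mu (cantor_stage m)) \<longlonglongrightarrow> measure cantor_mu (\<Inter>m. cantor_stage m)"
    by (rule cantor.finite_Lim_measure_decseq)
       (auto intro!: borel_closed closed_cantor_stage simp: decseq_def dest: cantor_stage_antimono)
  moreover have "measure cantor_mu (cantor_stage m) = 1" for m
  proof -
    have "measure cantor_mu (cantor_stage m) = (\<Sum>p\<in>cantor_intervals m. 1 / 2 ^ m)"
      unfolding cantor_mu_stage_eq_sum
      by (intro sum.cong refl) (auto intro: cantor_mu_interval)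
    then show ?thesis by (simp add: card_cantor_intervals)
  qed
  ultimately have "(\<lambda>m::nat. 1) \<longlonglongrightarrow> measure cantor_mu cantor_K"
    unfolding cantor_K_eq by simp
  then show ?thesis
    using LIMSEQ_unique tendsto_const by blast
qed

lemma AE_cantor_mu: "AE w in cantor_mu. w \<in> cantor_K"
  by (rule cantor.AE_prob_1[OF cantor_mu_K])

section \<open>Contours around the stages\<close>

text \<open>The three loops are joined by the connecting paths, each run through in both directions, into one
  closed path with winding number zero around every point outside \<open>S\<close>.\<close>

lemma Cauchy_two_loops:
  assumes S: "open S" and g: "g holomorphic_on S"
    and p: "valid_path p" "pathfinish p = pathstart p" "path_image p \<subseteq> S"
    and p1: "valid_path p1" "pathfinish p1 = pathstart p1" "path_image p1 \<subseteq> S"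
    and p2: "valid_path p2" "pathfinish p2 = pathstart p2" "path_image p2 \<subseteq> S"
    and q1: "valid_path q1" "pathstart q1 = pathstart p" "pathfinish q1 = pathstart p1" "path_image q1 \<subseteq> S"
    and q2: "valid_path q2" "pathstart q2 = pathstart p" "pathfinish q2 = pathstart p2" "path_image q2 \<subseteq> S"
    and w: "\<And>z. z \<notin> S \<Longrightarrow> winding_number p z = winding_number p1 z + winding_number p2 z"
  shows "contour_integral p g = contour_integral p1 g + contour_integral p2 g"
proof -
  let ?l1 = "q1 +++ reversepath p1 +++ reversepath q1"
  let ?l2 = "q2 +++ reversepath p2 +++ reversepath q2"
  let ?L = "p +++ ?l1 +++ ?l2"
  have "(g has_contour_integral 0) ?L"
  proof (rule Cauchy_theorem_global[OF S g])
    show "valid_path ?L" "pathfinish ?L = pathstart ?L"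
      using p p1 p2 q1 q2 by (simp_all add: valid_path_join)
    show "path_image ?L \<subseteq> S"
      using p p1 p2 q1 q2 by (simp add: path_image_join)
    fix z assume "z \<notin> S"
    then have "z \<notin> path_image p" "z \<notin> path_image p1" "z \<notin> path_image p2" "z \<notin> path_image q1" "z \<notin> path_image q2"
      using p p1 p2 q1 q2 by blast+
    then show "winding_number ?L z = 0"
      using p p1 p2 q1 q2 w[OF \<open>z \<notin> S\<close>]
      by (simp add: winding_number_join winding_number_reversepath path_image_join valid_path_imp_path)
  qed
  then have "contour_integral ?L g = 0" by (rule contour_integral_unique)
  moreover have "g contour_integrable_on r" if "valid_path r" "path_image r \<subseteq> S" for r
    using contour_integrable_holomorphic_simple[OF g S that] .
  ultimately have "contour_integral p g + (- contour_integral p1 g - contour_integral p2 g) = 0"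
    using p p1 p2 q1 q2
    by (simp add: contour_integral_join contour_integrable_join valid_path_join path_image_join
        contour_integral_reversepath contour_integrable_reversepath)
  then show ?thesis by (simp add: algebra_simps)
qed

text \<open>The radius is the length of the interval, so the circle stays at least half that length away from
  the interval, and it ends within the gaps on either side.\<close>

definition stage_circle :: "nat \<Rightarrow> real \<times> real \<Rightarrow> real \<Rightarrow> complex" where
  "stage_circle m I = circlepath (of_real ((fst I + snd I) / 2)) (stage_len m)"

lemma segment_from_real_line:
  assumes "z \<in> closed_segment (of_real x) t" "Im t > 0"
  shows "z = of_real x \<or> Im z > 0"
proof -
  from assms(1) obtain u where u: "0 \<le> u" "u \<le> 1" "z = (1 - u) *\<^sub>R of_real x + u *\<^sub>R t"
    by (auto simp: closed_segment_def)
  then show ?thesis using assms(2) by (cases "u = 0") auto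
qed

text \<open>What an interval keeps of the Cantor set lies in its two children, and a point of a child is
  encircled once by the circle of the parent and once by that of the child.\<close>

lemma contour_integral_stage_circle_split:
  assumes I: "(a, b) \<in> cantor_intervals m" and g: "g holomorphic_on - of_real ` cantor_K"
  shows "contour_integral (stage_circle m (a, b)) g =
    contour_integral (stage_circle (Suc m) (a, a + stage_len (Suc m))) g +
    contour_integral (stage_circle (Suc m) (b - stage_len (Suc m), b)) g"
proof -
  define l where "l = stage_len m"
  define k where "k = stage_len (Suc m)"
  have k: "0 < k" "4 * k \<le> l" using stage_len_pos stage_len_Suc_le by (auto simp: k_def l_def)
  have b: "b = a + l" using cantor_interval_length[OF I] by (simp add: l_def)
  define c where "c = a + l / 2"
  define c1 where "c1 = a + k / 2"
  define c2 where "c2 = b - k / 2"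
  define A where "A = {a..a + k} \<union> {b - k..b}"
  define S where "S = ball (complex_of_real c) (2 * l) - of_real ` A"
  have inA: "z \<notin> of_real ` A \<longleftrightarrow> \<not> (Im z = 0 \<and> Re z \<in> A)" for z :: complex
    by (metis Im_complex_of_real Re_complex_of_real complex_is_Real_iff image_iff of_real_Re)
  have "open S"
    unfolding S_def A_def
    by (intro open_Diff open_ball compact_imp_closed compact_continuous_image continuous_intros) auto
  have SK: "S \<inter> of_real ` cantor_K = {}"
  proof (safe, simp_all)
    fix w assume w: "of_real w \<in> S" "w \<in> cantor_K"
    then have "dist c w < 2 * l" by (auto simp: S_def dist_of_real)
    then have "w \<in> {a..b}"
      using cantor_K_near_interval[OF I w(2)] k unfolding b by (auto simp: l_def[symmetric] c_def dist_real_def)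
    then have "w \<in> A"
      using cantor_K_in_child[OF I w(2)] by (simp add: A_def k_def)
    then show False using w(1) by (auto simp: S_def)
  qed
  then have gS: "g holomorphic_on S"
    using g holomorphic_on_subset by blast
  have near: "x \<in> A \<Longrightarrow> dist c x \<le> l / 2" for x
    using k by (auto simp: A_def b c_def dist_real_def)
  have cc1: "dist c c1 \<le> l / 2" "dist c c2 \<le> l / 2"
    using k by (auto simp: b c_def c1_def c2_def dist_real_def)
  have sph: "sphere (complex_of_real c) l \<subseteq> S"
    using near k by (force simp: S_def dist_of_real)
  have d1: "dist c1 x \<noteq> k" "dist c2 x \<noteq> k" if "x \<in> A" for x
    using that k by (auto simp: A_def b c1_def c2_def dist_real_def abs_if split: if_splits)
  have sph1: "sphere (complex_of_real c') k \<subseteq> S" if "c' = c1 \<or> c' = c2" for c'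
  proof
    fix z assume z: "z \<in> sphere (complex_of_real c') k"
    have "dist (complex_of_real c) z \<le> dist (complex_of_real c) (of_real c') + dist (of_real c') z"
      by (rule dist_triangle)
    also have "dist (complex_of_real c) (of_real c') \<le> l / 2" using cc1 that by (auto simp: dist_of_real)
    also have "l / 2 + dist (of_real c') z < 2 * l" using z k by simp
    finally have "z \<in> ball (complex_of_real c) (2 * l)" by simp
    moreover have "z \<notin> of_real ` A"
    proof
      assume "z \<in> of_real ` A"
      then obtain x where "x \<in> A" "z = of_real x" by blast
      with d1[of x] z that show False by (auto simp: dist_of_real)
    qed
    ultimately show "z \<in> S" by (simp add: S_def)
  qed
  \<comment> \<open>The connecting paths go through a point off the real axis, so that they avoid the intervals.\<close>
  let ?t = "Complex c l"
  have con: "path_image (linepath (of_real (c + l)) ?t +++ linepath ?t (of_real (c' + k))) \<subseteq> S"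
    if "c' = c1 \<or> c' = c2" for c'
  proof -
    have t: "?t \<in> ball (complex_of_real c) (2 * l)" using k
      by (auto simp: dist_norm complex_eq_iff cmod_def)
    have *: "closed_segment (of_real x) ?t \<subseteq> S" if "of_real x \<in> S" for x
    proof
      fix z assume z: "z \<in> closed_segment (of_real x) ?t"
      have "closed_segment (of_real x) ?t \<subseteq> ball (complex_of_real c) (2 * l)"
        by (intro closed_segment_subset convex_ball t) (use that in \<open>auto simp: S_def\<close>)
      then have "z \<in> ball (complex_of_real c) (2 * l)" using z by blast
      moreover have "z \<notin> of_real ` A"
        using segment_from_real_line[OF z] that k inA by (auto simp: S_def)
      ultimately show "z \<in> S" by (simp add: S_def)
    qed
    have "of_real (c + l) \<in> S" using sph k by (auto simp: dist_norm)
    moreover have "of_real (c' + k) \<in> S" using sph1[OF that] k by (auto simp: dist_norm)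
    ultimately show ?thesis
      using *[of "c + l"] *[of "c' + k"] by (simp add: path_image_join closed_segment_commute)
  qed
  have win0: "winding_number (circlepath (complex_of_real c') r) z = 0"
    if "z \<notin> cball (of_real c') r" "0 < r" for c' r z
    by (rule winding_number_zero_outside[where s = "cball (of_real c') r"]) (use that in auto)
  have win1: "winding_number (circlepath (complex_of_real c') r) (of_real x) = 1" if "dist c' x < r" for c' r x
    using that by (intro winding_number_circlepath)
      (simp add: dist_real_def abs_minus_commute flip: of_real_diff)
  have "contour_integral (circlepath (of_real c) l) g =
    contour_integral (circlepath (of_real c1) k) g + contour_integral (circlepath (of_real c2) k) g"
  proof (rule Cauchy_two_loops[OF \<open>open S\<close> gS,
      where ?q1.0 = "linepath (of_real (c + l)) ?t +++ linepath ?t (of_real (c1 + k))"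
        and ?q2.0 = "linepath (of_real (c + l)) ?t +++ linepath ?t (of_real (c2 + k))"])
    fix z assume z: "z \<notin> S"
    then consider "2 * l \<le> dist (of_real c) z" | x where "z = of_real x" "x \<in> {a..a+k}"
      | x where "z = of_real x" "x \<in> {b-k..b}"
      by (force simp: S_def A_def)
    then show "winding_number (circlepath (of_real c) l) z =
      winding_number (circlepath (of_real c1) k) z + winding_number (circlepath (of_real c2) k) z"
    proof cases
      case 1
      have "dist (of_real c) z \<le> dist (complex_of_real c) (of_real c') + dist (of_real c') z" for c'
        by (rule dist_triangle)
      from this[of c1] this[of c2] have "k < dist (of_real c1) z" "k < dist (of_real c2) z"
        using 1 cc1 k by (auto simp: dist_of_real)
      then show ?thesis using win0 1 k by simp
    next
      case 2
      then have "dist c x < l" "dist c1 x < k" "k < dist c2 x"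
        using k by (auto simp: b c_def c1_def c2_def dist_real_def abs_if)
      then show ?thesis using 2(1) win1 win0[of z c2 k] k by (simp add: dist_of_real)
    next
      case 3
      then have "dist c x < l" "dist c2 x < k" "k < dist c1 x"
        using k by (auto simp: b c_def c1_def c2_def dist_real_def abs_if)
      then show ?thesis using 3(1) win1 win0[of z c1 k] k by (simp add: dist_of_real)
    qed
  qed (use sph sph1 con k in \<open>auto simp: valid_path_join\<close>)
  then show ?thesis
    by (simp add: stage_circle_def b c_def c1_def c2_def k_def l_def add_divide_distrib diff_divide_distrib algebra_simps)
qed

lemma contour_integral_unit_circle_eq_stage_circles:
  assumes g: "g holomorphic_on - of_real ` cantor_K"
  shows "contour_integral (circlepath (1/2) 1) g =
    (\<Sum>I\<in>cantor_intervals m. contour_integral (stage_circle m I) g)"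
proof (induction m)
  case (Suc m)
  have "(\<Sum>I\<in>cantor_intervals (Suc m). contour_integral (stage_circle (Suc m) I) g) =
     (\<Sum>I\<in>cantor_intervals m. contour_integral (stage_circle m I) g)"
    unfolding sum_cantor_intervals_Suc
    by (intro sum.cong refl) (auto simp: contour_integral_stage_circle_split[OF _ g])
  with Suc show ?case by simp
qed (simp add: stage_circle_def)

text \<open>The second loop of \<open>Cauchy_two_loops\<close> is taken to be a constant path.\<close>

lemma contour_integral_large_circle_eq:
  assumes g: "g holomorphic_on - of_real ` cantor_K" and R: "R \<ge> 1"
  shows "contour_integral (circlepath (1/2) R) g = contour_integral (circlepath (1/2) 1) g"
proof -
  let ?S = "- cball (1/2 :: complex) (1/2)"
  have dist_half: "dist (1/2 :: complex) (of_real w) = dist (1/2) w" for w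
    using dist_of_real[of "1/2" w, where 'a = complex] by simp
  have "contour_integral (circlepath (1/2) R) g = contour_integral (circlepath (1/2) 1) g +
     contour_integral (linepath (of_real (1/2 + R)) (of_real (1/2 + R))) g"
  proof (rule Cauchy_two_loops[of ?S, where ?q1.0 = "linepath (of_real (1/2 + R)) (of_real (1/2 + 1))"
      and ?q2.0 = "linepath (of_real (1/2 + R)) (of_real (1/2 + R))"])
    show "g holomorphic_on ?S"
      using g
    proof (rule holomorphic_on_subset)
      have "of_real w \<in> cball (1/2 :: complex) (1/2)" if "w \<in> cantor_K" for w
        using cantor_K_subset that by (auto simp: dist_half dist_real_def abs_if)
      then show "?S \<subseteq> - of_real ` cantor_K" by blast
    qed
    have *: "x \<in> closed_segment (of_real (1/2 + R)) (of_real (1/2 + 1)) \<Longrightarrow> Re x \<ge> 3/2" for x :: complex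
    proof -
      have "closed_segment (of_real (1/2 + R)) (of_real (1/2 + 1)) \<subseteq> {z. Re z \<ge> 3/2}"
        using R by (intro closed_segment_subset convex_halfspace_Re_ge) auto
      then show "x \<in> closed_segment (of_real (1/2 + R)) (of_real (1/2 + 1)) \<Longrightarrow> Re x \<ge> 3/2" by blast
    qed
    have "x \<in> ?S" if "x \<in> closed_segment (of_real (1/2 + R)) (of_real (1/2 + 1))" for x :: complex
      using *[OF that] abs_Re_le_cmod[of "x - 1/2"] by (simp add: dist_norm norm_minus_commute)
    then show "path_image (linepath (of_real (1/2 + R)) (of_real (1/2 + 1))) \<subseteq> ?S"
      unfolding path_image_linepath by blast
    show "path_image (linepath (of_real (1/2 + R)) (of_real (1/2 + R))) \<subseteq> ?S"
      using R by (auto simp: dist_half dist_real_def simp del: of_real_add of_real_divide)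
    then show "path_image (linepath (of_real (1/2 + R)) (of_real (1/2 + R))) \<subseteq> ?S" .
    fix z assume "z \<notin> ?S"
    then show "winding_number (circlepath (1/2) R) z =
       winding_number (circlepath (1/2) 1) z + winding_number (linepath (of_real (1/2 + R)) (of_real (1/2 + R))) z"
      using R by (subst (1 2) winding_number_circlepath winding_number_trivial)
         (auto simp: dist_norm norm_minus_commute winding_number_circlepath)
  qed (use R in auto)
  then show ?thesis by simp
qed

text \<open>The integral is the coefficient of \<open>1 / z\<close> at infinity, which the circles of large radius reveal.\<close>

lemma contour_integral_circle_at_infinity:
  assumes g: "g holomorphic_on - of_real ` cantor_K"
    and lim: "((\<lambda>z. g z * (z - 1/2)) \<longlongrightarrow> L) at_infinity"
  shows "contour_integral (circlepath (1/2) 1) g = 2 * pi * \<i> * L"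
proof -
  let ?J = "contour_integral (circlepath (1/2) 1) g"
  have "norm (?J - 2 * pi * \<i> * L) \<le> e * (2 * pi)" if "e > 0" for e
  proof -
    from lim \<open>e > 0\<close> have "\<forall>\<^sub>F z in at_infinity. dist (g z * (z - 1/2)) L < e"
      by (rule tendstoD)
    then obtain B where B: "\<And>z. B \<le> norm z \<Longrightarrow> dist (g z * (z - 1/2)) L < e"
      unfolding eventually_at_infinity by blast
    define R where "R = max 1 (B + 1)"
    have R: "R \<ge> 1" "R \<ge> B + 1" by (auto simp: R_def)
    have sub: "sphere (1/2 :: complex) R \<subseteq> - of_real ` cantor_K"
    proof -
      have "of_real w \<notin> sphere (1/2 :: complex) R" if "w \<in> cantor_K" for w
      proof -
        have "w \<in> {0..1}" using cantor_K_subset that by blast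
        then show ?thesis using R dist_of_real[of "1/2" w, where 'a = complex]
          by (auto simp: dist_real_def abs_if)
      qed
      then show ?thesis by blast
    qed
    have "open (- complex_of_real ` cantor_K)"
      by (intro open_Compl compact_imp_closed compact_continuous_image compact_cantor_K continuous_intros)
    then have "g contour_integrable_on circlepath (1/2) R"
      using R sub by (intro contour_integrable_holomorphic_simple[OF g]) auto
    then have 1: "(g has_contour_integral ?J) (circlepath (1/2) R)"
      using contour_integral_large_circle_eq[OF g R(1)] has_contour_integral_integral by metis
    have 2: "((\<lambda>u. L / (u - 1/2)) has_contour_integral (2 * pi * \<i> * L)) (circlepath (1/2) R)"
      using Cauchy_integral_circlepath_simple[of "\<lambda>_. L" "1/2" R "1/2"] R by simp
    have "norm (?J - 2 * pi * \<i> * L) \<le> e / R * (2 * pi * R)"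
    proof (rule has_contour_integral_bound_circlepath[OF has_contour_integral_diff[OF 1 2]])
      fix x :: complex assume x: "norm (x - 1/2) = R"
      have "norm (x - 1/2) \<le> norm x + 1/2" using norm_triangle_ineq4[of x "1/2"] by simp
      then have "B \<le> norm x" using x R by simp
      have "norm (g x - L / (x - 1/2)) * R = norm ((g x - L / (x - 1/2)) * (x - 1/2))"
        using x by (simp add: norm_mult)
      also have "(g x - L / (x - 1/2)) * (x - 1/2) = g x * (x - 1/2) - L"
      proof -
        have "norm (x - 1/2) > 0" using x R by linarith
        then have "x - 1/2 \<noteq> 0" by (simp only: zero_less_norm_iff not_False_eq_True)
        then show ?thesis by (simp add: left_diff_distrib)
      qed
      also have "norm (\<dots>) \<le> e" using B[OF \<open>B \<le> norm x\<close>] by (simp add: dist_norm)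
      finally show "norm (g x - L / (x - 1/2)) \<le> e / R" using R by (simp add: field_simps)
    qed (use R \<open>e > 0\<close> in auto)
    then show ?thesis using R by simp
  qed
  from this[of "e / (2 * pi)" for e] have *: "norm (?J - 2 * pi * \<i> * L) \<le> 0 + e" if "e > 0" for e
    using that by simp
  have "norm (?J - 2 * pi * \<i> * L) \<le> 0" by (rule field_le_epsilon) (rule *)
  then show ?thesis by simp
qed

section \<open>Estimates of the potential\<close>

lemma cantor_K_distance:
  fixes z :: complex
  assumes "z \<notin> of_real ` cantor_K"
  obtains r where "0 < r" "\<And>w. w \<in> cantor_K \<Longrightarrow> r \<le> dist z (of_real w)"
proof -
  have "closed (complex_of_real ` cantor_K)"
    by (intro compact_imp_closed compact_continuous_image compact_cantor_K continuous_intros)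
  from separate_point_closed[OF this assms] show ?thesis
    using that by blast
qed

lemma integrable_log_kernel:
  assumes "z \<notin> of_real ` cantor_K"
  shows "integrable cantor_mu (\<lambda>w. ln (cmod (z - of_real w)))"
proof -
  obtain r where r: "0 < r" "\<And>w. w \<in> cantor_K \<Longrightarrow> r \<le> dist z (of_real w)"
    using cantor_K_distance[OF assms] by blast
  show ?thesis
  proof (rule cantor.integrable_const_bound[where B = "\<bar>ln r\<bar> + \<bar>ln (cmod z + 1)\<bar>"])
    show "AE w in cantor_mu. norm (ln (cmod (z - complex_of_real w))) \<le> \<bar>ln r\<bar> + \<bar>ln (cmod z + 1)\<bar>"
      using AE_cantor_mu
    proof eventually_elim
      case (elim w)
      have "r \<le> cmod (z - of_real w)" using r(2)[OF elim] by (simp add: dist_norm)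
      moreover have "cmod (z - of_real w) \<le> cmod z + 1"
      proof -
        have "cmod (z - of_real w) \<le> cmod z + cmod (of_real w)" by (rule norm_triangle_ineq4)
        moreover have "cmod (of_real w) \<le> 1" using cantor_K_subset elim by auto
        ultimately show ?thesis by simp
      qed
      ultimately have "ln r \<le> ln (cmod (z - of_real w))" "ln (cmod (z - of_real w)) \<le> ln (cmod z + 1)"
        using r(1) by (auto intro!: ln_mono)
      then show ?case unfolding real_norm_def by arith
    qed
  qed simp
qed

lemma integrable_cantor_mu_indicator: "integrable cantor_mu (indicat_real {a..b})"
  by (intro integrable_real_indicator) (auto simp: cantor.emeasure_finite less_top[symmetric])

text \<open>A crude bound on two scales: mass \<open>2 ^ - n\<close> at distance at least \<open>r\<close>, and everything else at
  distance at least \<open>s\<close>.\<close>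

lemma minus_log_potential_le:
  assumes J: "(a, b) \<in> cantor_intervals n"
    and r: "0 < r" "r \<le> 1" "\<And>w. w \<in> cantor_K \<Longrightarrow> r \<le> dist z (of_real w)"
    and s: "0 < s" "s \<le> 1" "\<And>w. w \<in> cantor_K \<Longrightarrow> w \<notin> {a..b} \<Longrightarrow> s \<le> dist z (of_real w)"
  shows "- log_potential cantor_mu z \<le> ln (1 / r) / 2 ^ n + ln (1 / s)"
proof -
  have z: "z \<notin> of_real ` cantor_K" using r(1,3) by force
  have "- log_potential cantor_mu z = (\<integral>w. - ln (cmod (z - of_real w)) \<partial>cantor_mu)"
    by (simp add: log_potential_def)
  also have "\<dots> \<le> (\<integral>w. ln (1 / r) * indicator {a..b} w + ln (1 / s) \<partial>cantor_mu)"
  proof (rule integral_mono_AE)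
    show "AE w in cantor_mu. - ln (cmod (z - of_real w)) \<le> ln (1 / r) * indicator {a..b} w + ln (1 / s)"
      using AE_cantor_mu
    proof eventually_elim
      case (elim w)
      have s_ln: "ln (1 / s) = - ln s" using s(1) by (simp add: ln_div)
      have "r \<le> cmod (z - of_real w)" "w \<notin> {a..b} \<Longrightarrow> s \<le> cmod (z - of_real w)"
        using r s elim by (auto simp: dist_norm)
      then have "ln r \<le> ln (cmod (z - of_real w))" "w \<notin> {a..b} \<Longrightarrow> ln s \<le> ln (cmod (z - of_real w))"
        using r(1) s(1) by (auto intro: ln_mono)
      moreover have "ln s \<le> 0" using s by simp
      moreover have "ln (1 / r) * indicator {a..b} w = (if w \<in> {a..b} then - ln r else 0)"
        using r(1) by (simp add: ln_div)
      ultimately show ?case unfolding s_ln by argo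
    qed
  qed (auto intro!: integrable_log_kernel[OF z] integrable_cantor_mu_indicator)
  also have "\<dots> = ln (1 / r) / 2 ^ n + ln (1 / s)"
    using cantor_mu_interval[OF J] cantor.prob_space by (subst Bochner_Integration.integral_add) (auto simp: integrable_cantor_mu_indicator)
  finally show ?thesis .
qed

text \<open>Only the mass of one interval is used; \<open>s\<close> bounds the negative contribution of distant points.\<close>

lemma le_minus_log_potential:
  assumes z: "z \<notin> of_real ` cantor_K" and J: "(a, b) \<in> cantor_intervals n"
    and r: "0 < r" "\<And>w. w \<in> cantor_K \<Longrightarrow> w \<in> {a..b} \<Longrightarrow> dist z (of_real w) \<le> r"
    and s: "1 \<le> s" "\<And>w. w \<in> cantor_K \<Longrightarrow> dist z (of_real w) \<le> s"
  shows "ln (1 / r) / 2 ^ n - ln s \<le> - log_potential cantor_mu z"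
proof -
  have "ln (1 / r) / 2 ^ n - ln s = (\<integral>w. ln (1 / r) * indicator {a..b} w - ln s \<partial>cantor_mu)"
    using cantor_mu_interval[OF J] cantor.prob_space by (subst Bochner_Integration.integral_diff) (auto simp: integrable_cantor_mu_indicator)
  also have "\<dots> \<le> (\<integral>w. - ln (cmod (z - of_real w)) \<partial>cantor_mu)"
  proof (rule integral_mono_AE)
    show "AE w in cantor_mu. ln (1 / r) * indicator {a..b} w - ln s \<le> - ln (cmod (z - of_real w))"
      using AE_cantor_mu
    proof eventually_elim
      case (elim w)
      have "cmod (z - of_real w) > 0" using z elim by auto
      moreover have "cmod (z - of_real w) \<le> s" "w \<in> {a..b} \<Longrightarrow> cmod (z - of_real w) \<le> r"
        using r s elim by (auto simp: dist_norm)
      ultimately have "ln (cmod (z - of_real w)) \<le> ln s" "w \<in> {a..b} \<Longrightarrow> ln (cmod (z - of_real w)) \<le> ln r"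
        by (auto intro: ln_mono)
      moreover have "0 \<le> ln s" using s by simp
      moreover have "ln (1 / r) * indicator {a..b} w = (if w \<in> {a..b} then - ln r else 0)"
        using r(1) by (simp add: ln_div)
      ultimately show ?case  by argo
    qed
  qed (auto intro!: integrable_log_kernel[OF z] integrable_cantor_mu_indicator)
  also have "\<dots> = - log_potential cantor_mu z" by (simp add: log_potential_def)
  finally show ?thesis .
qed

lemma cantor_interval_ancestor:
  assumes "(a, b) \<in> cantor_intervals (n + k)"
  obtains a' b' where "(a', b') \<in> cantor_intervals n" "a' \<le> a" "b \<le> b'"
  using assms
proof (induction k arbitrary: a b thesis)
  case (Suc k)
  from Suc.prems(2) obtain c where c: "(c, c + stage_len (n + k)) \<in> cantor_intervals (n + k)"
    "b = a + stage_len (Suc (n + k))" "a = c \<or> a = c + stage_len (n + k) - stage_len (Suc (n + k))"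
    unfolding add_Suc_right by (rule cantor_interval_child)
  obtain a' b' where "(a', b') \<in> cantor_intervals n" "a' \<le> c" "c + stage_len (n + k) \<le> b'"
    using Suc.IH[OF _ c(1)] by blast
  then show ?case
    using c stage_len_Suc_le[of "n + k"] stage_len_pos[of "Suc (n + k)"] by (intro Suc.prems(1)[of a' b']) auto
qed auto

lemma cantor_interval_left_end:
  assumes I: "(a, b) \<in> cantor_intervals m"
  shows "a \<in> cantor_K"
proof -
  have left: "(a, a + stage_len (m + k)) \<in> cantor_intervals (m + k)" for k
  proof (induction k)
    case 0
    then show ?case using I cantor_interval_length[OF I] by simp
  next
    case (Suc k)
    from cantor_interval_children(1)[OF this] show ?case by simp
  qed
  have "a \<in> cantor_stage (m + k)" for k
    unfolding in_cantor_stage_iff using left[of k] stage_len_pos[of "m + k"]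
    by (intro exI[of _ a] exI[of _ "a + stage_len (m + k)"]) auto
  moreover have "cantor_stage (m + k) \<subseteq> cantor_stage k" for k
    by (rule cantor_stage_antimono) simp
  ultimately show ?thesis unfolding cantor_K_eq by blast
qed

text \<open>The whole Cantor set is at least half the radius away from the circle, and what lies outside
  the ancestor of stage \<open>n\<close> is beyond a gap of stage \<open>n\<close>.  The weight \<open>2 ^ - n\<close> tames the large
  logarithm of the radius.\<close>

lemma stage_circle_log_potential:
  assumes I: "I \<in> cantor_intervals (n + k)" and z: "cmod (z - of_real ((fst I + snd I) / 2)) = stage_len (n + k)"
  shows "- log_potential cantor_mu z \<le> ln (2 / stage_len (n + k)) / 2 ^ n + ln (1 / stage_len n)"
    and "z \<notin> of_real ` cantor_K"
    and "\<exists>w\<in>cantor_K. dist z (of_real w) \<le> 2 * stage_len (n + k)"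
proof -
  obtain a b where ab: "I = (a, b)" by force
  define l where "l = stage_len (n + k)"
  note I' = I[unfolded ab]
  have l: "0 < l" "l \<le> 1" "l \<le> stage_len n"
    using stage_len_pos stage_len_le_1 stage_len_antimono[of n "n + k"] by (auto simp: l_def)
  have b: "b = a + l" using cantor_interval_length[OF I'] by (simp add: l_def)
  define c where "c = a + l / 2"
  have z': "dist z (of_real c) = l" using z by (simp add: ab b c_def dist_norm l_def add_divide_distrib)
  have Re: "\<bar>Re z - c\<bar> \<le> l" using abs_Re_le_cmod[of "z - of_real c"] z' by (simp add: dist_norm)
  have far: "l / 2 \<le> dist z (of_real w)" if w: "w \<in> cantor_K" for w
  proof (cases "w \<in> {a..b}")
    case True
    have "l \<le> dist z (of_real w) + dist (complex_of_real w) (of_real c)"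
      unfolding z'[symmetric] by (rule dist_triangle)
    moreover have "dist w c \<le> l / 2" using True by (auto simp: b c_def dist_real_def abs_if)
    ultimately show ?thesis by (simp add: dist_of_real)
  next
    case False
    then have "\<not> (a - 2 * l < w \<and> w < b + 2 * l)"
      using cantor_K_near_interval[OF I' w] by (auto simp: l_def)
    then have "\<bar>Re z - w\<bar> \<ge> l / 2" using Re by (auto simp: b c_def)
    then show ?thesis using abs_Re_le_cmod[of "z - of_real w"] by (simp add: dist_norm)
  qed
  obtain a' b' where J: "(a', b') \<in> cantor_intervals n" "a' \<le> a" "b \<le> b'"
    using cantor_interval_ancestor[OF I'] by blast
  have "- log_potential cantor_mu z \<le> ln (1 / (l / 2)) / 2 ^ n + ln (1 / stage_len n)"
  proof (rule minus_log_potential_le[OF J(1)])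
    fix w assume w: "w \<in> cantor_K" "w \<notin> {a'..b'}"
    then have "\<not> (a' - 2 * stage_len n < w \<and> w < b' + 2 * stage_len n)"
      using cantor_K_near_interval[OF J(1) w(1)] by auto
    then have "\<bar>Re z - w\<bar> \<ge> stage_len n" using Re J l by (auto simp: b c_def)
    then show "stage_len n \<le> dist z (of_real w)"
      using abs_Re_le_cmod[of "z - of_real w"] by (simp add: dist_norm)
  qed (use l far stage_len_pos stage_len_le_1 in auto)
  then show "- log_potential cantor_mu z \<le> ln (2 / stage_len (n + k)) / 2 ^ n + ln (1 / stage_len n)"
    by (simp add: l_def)
  show "z \<notin> of_real ` cantor_K" using far l by force
  have "dist z (of_real a) \<le> dist z (of_real c) + dist (complex_of_real c) (of_real a)"
    by (rule dist_triangle)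
  moreover have "dist c a \<le> l" using l by (simp add: c_def dist_real_def)
  ultimately have "dist z (of_real a) \<le> 2 * l" using z' by (simp add: dist_of_real)
  then show "\<exists>w\<in>cantor_K. dist z (of_real w) \<le> 2 * stage_len (n + k)"
    using cantor_interval_left_end[OF I'] by (auto simp: l_def)
qed

section \<open>Functions of polynomial growth are constant\<close>

text \<open>The difference quotient of \<open>f\<close> at \<open>z0\<close> extends holomorphically over \<open>z0\<close>.  Its integral around the
  Cantor set is \<open>2 * pi * \<i> * (L - f z0)\<close> when computed at infinity, and arbitrarily small when computed
  over the circles of a late stage.\<close>

lemma polynomial_growth_imp_constant:
  assumes f: "f holomorphic_on - of_real ` cantor_K" and lim: "(f \<longlongrightarrow> L) at_infinity"
    and growth: "\<And>z. z \<notin> of_real ` cantor_K \<Longrightarrow>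
      cmod (f z) \<le> exp (real d * max 0 (- log_potential cantor_mu z) + c)"
    and c: "c > 0" and z0: "z0 \<notin> of_real ` cantor_K"
  shows "f z0 = L"
proof -
  have op: "open (- complex_of_real ` cantor_K)"
    by (intro open_Compl compact_imp_closed compact_continuous_image compact_cantor_K continuous_intros)
  define g where "g = (\<lambda>z. if z = z0 then deriv f z0 else (f z - f z0) / (z - z0))"
  have g: "g holomorphic_on - of_real ` cantor_K"
    unfolding g_def by (rule pole_lemma_open[OF f op])
  obtain D where D: "0 < D" "\<And>w. w \<in> cantor_K \<Longrightarrow> D \<le> dist z0 (of_real w)"
    using cantor_K_distance[OF z0] by blast
  have "((\<lambda>z. g z * (z - 1/2)) \<longlongrightarrow> L - f z0) at_infinity"
  proof (rule Lim_transform_eventually)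
    have "((\<lambda>z. (f z - f z0) * ((z - 1/2) / (z - z0))) \<longlongrightarrow> (L - f z0) * 1) at_infinity"
    proof (intro tendsto_mult tendsto_diff lim tendsto_const)
      have "((\<lambda>z. 1 + (z0 - 1/2) * inverse (z - z0)) \<longlongrightarrow> 1 + (z0 - 1/2) * 0) at_infinity"
      proof (intro tendsto_add tendsto_mult tendsto_const)
        have "filterlim (\<lambda>z. z + (- z0)) at_infinity at_infinity"
          by (rule tendsto_add_filterlim_at_infinity'[OF filterlim_ident tendsto_const])
        then show "((\<lambda>z. inverse (z - z0)) \<longlongrightarrow> 0) at_infinity"
          by (intro filterlim_compose[OF tendsto_inverse_0]) simp
      qed
      moreover have "\<forall>\<^sub>F z in at_infinity. 1 + (z0 - 1/2) * inverse (z - z0) = (z - 1/2) / (z - z0)"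
      proof -
        have "\<forall>\<^sub>F z in at_infinity. z \<noteq> z0"
          by (auto simp: eventually_at_infinity intro!: exI[of _ "norm z0 + 1"])
        then show ?thesis by eventually_elim (simp add: field_simps)
      qed
      ultimately show "((\<lambda>z. (z - 1/2) / (z - z0)) \<longlongrightarrow> 1) at_infinity"
        using Lim_transform_eventually by fastforce
    qed
    then show "((\<lambda>z. (f z - f z0) * ((z - 1/2) / (z - z0))) \<longlongrightarrow> L - f z0) at_infinity" by simp
    have "\<forall>\<^sub>F z in at_infinity. z \<noteq> z0"
      by (auto simp: eventually_at_infinity intro!: exI[of _ "norm z0 + 1"])
    then show "\<forall>\<^sub>F z in at_infinity. (f z - f z0) * ((z - 1/2) / (z - z0)) = g z * (z - 1/2)"
      by eventually_elim (simp add: g_def)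
  qed
  from contour_integral_circle_at_infinity[OF g this]
  have J: "contour_integral (circlepath (1/2) 1) g = 2 * pi * \<i> * (L - f z0)" .
  \<comment> \<open>The number \<open>k\<close> of generations between ancestor and circle depends on the degree \<open>d\<close> only.\<close>
  obtain k where k: "4 * real d < 4 ^ k"
    using real_arch_pow[of 4 "4 * real d"] by auto
  define C where "C = 2 * pi * (exp (c + 1) + cmod (f z0)) * (2 / D)"
  have bound: "\<forall>\<^sub>F n in sequentially. norm (contour_integral (circlepath (1/2) 1) g) \<le> C * (1/2) ^ (Suc n + k)"
  proof -
    obtain N where "4 * real d < 2 ^ N" using real_arch_pow[of 2 "4 * real d"] by auto
    then have "\<forall>\<^sub>F n in sequentially. 4 * real d \<le> 2 ^ n"
      unfolding eventually_sequentially
      by (meson less_imp_le one_le_numeral order_trans power_increasing)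
    moreover
    obtain N where N: "(1/4) ^ N < D / 4" using real_arch_pow_inv[of "D / 4" "1/4"] D(1) by auto
    have "(1/4) ^ n \<le> D / 4" if "n \<ge> N" for n
      using power_decreasing[OF that, of "1/4::real"] N by linarith
    then have "\<forall>\<^sub>F n in sequentially. (1/4) ^ n \<le> D / 4"
      unfolding eventually_sequentially by blast
    moreover have "\<forall>\<^sub>F n in sequentially. n \<ge> (1::nat)" by (rule eventually_ge_at_top)
    ultimately show ?thesis
    proof eventually_elim
      case (elim n)
      define m where "m = Suc n + k"
      define M where "M = (4::real) ^ (n + k)"
      define l where "l = stage_len m"
      have l: "l = (1/4) ^ (4 ^ (n + k))" by (simp add: l_def m_def stage_len_Suc)
      have ln_l: "ln (1 / l) = M * ln 4" by (simp add: l M_def ln_realpow ln_div)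
      have ln_n: "ln (1 / stage_len (Suc n)) = 4 ^ n * ln 4"
        by (simp add: stage_len_Suc ln_realpow ln_div)
      have "l > 0" by (simp add: l_def stage_len_pos)
      have "M \<ge> 1" by (simp add: M_def)
      have ln4: "0 < ln (4::real)" by simp
      have gb: "cmod (g z) \<le> (exp (c + 1) + cmod (f z0)) * exp (M * ln 4 / 2) * (2 / D)"
        if I: "I \<in> cantor_intervals m" and z: "cmod (z - of_real ((fst I + snd I) / 2)) = l" for I z
      proof -
        note sc = stage_circle_log_potential[of I "Suc n" k z, folded m_def, folded l_def, OF I z]
        \<comment> \<open>Up to the constant \<open>1\<close>, both terms are at most a quarter of \<open>ln (1 / l) = M * ln 4\<close>, the first because \<open>n\<close> is large
          and the second by the choice of \<open>k\<close>.\<close>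
        have "real d * (ln (2 / l) / 2 ^ Suc n + ln (1 / stage_len (Suc n))) \<le> M * ln 4 / 2 + 1"
        proof -
          have "ln (2 / l) = ln 2 + M * ln 4"
            using \<open>l > 0\<close> ln_l by (simp add: ln_div)
          then have "real d * (ln (2 / l) / 2 ^ Suc n + ln (1 / stage_len (Suc n)))
             = (real d / 2 ^ Suc n) * (ln 2 + M * ln 4) + (real d / 4 ^ k) * (M * ln 4)"
            unfolding ln_n by (simp add: M_def power_add field_simps)
          also have "\<dots> \<le> (1 / 4) * (ln 2 + M * ln 4) + (1 / 4) * (M * ln 4)"
          proof (intro add_mono mult_right_mono)
            show "real d / 2 ^ Suc n \<le> 1 / 4" using elim(1) by (simp add: field_simps)
            show "real d / 4 ^ k \<le> 1 / 4" using k by (simp add: field_simps)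
          qed (use \<open>M \<ge> 1\<close> ln4 in auto)
          also have "\<dots> \<le> M * ln 4 / 2 + 1" using ln_le_minus_one[of 2] by (simp add: field_simps)
          finally show ?thesis .
        qed
        then have "real d * max 0 (- log_potential cantor_mu z) \<le> M * ln 4 / 2 + 1"
        proof (cases "- log_potential cantor_mu z \<le> 0")
          case True
          then show ?thesis using \<open>M \<ge> 1\<close> ln4 by (simp add: max_def)
        next
          case False
          then have "real d * max 0 (- log_potential cantor_mu z) = real d * (- log_potential cantor_mu z)"
            by simp
          also have "\<dots> \<le> real d * (ln (2 / l) / 2 ^ Suc n + ln (1 / stage_len (Suc n)))"
            by (rule mult_left_mono[OF sc(1)]) simp
          also note \<open>\<dots> \<le> M * ln 4 / 2 + 1\<close>
          finally show ?thesis .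
        qed
        then have "exp (real d * max 0 (- log_potential cantor_mu z) + c) \<le> exp (c + 1 + M * ln 4 / 2)"
          by simp
        with growth[OF sc(2)] have "cmod (f z) \<le> exp (c + 1 + M * ln 4 / 2)"
          by (rule order.trans)
        then have fz: "cmod (f z) \<le> exp (c + 1) * exp (M * ln 4 / 2)"
          by (simp add: exp_add)
        have "1 \<le> exp (M * ln 4 / 2)" using \<open>M \<ge> 1\<close> ln4 by simp
        then have "cmod (f z0) * 1 \<le> cmod (f z0) * exp (M * ln 4 / 2)"
          by (intro mult_left_mono) auto
        then have num: "cmod (f z - f z0) \<le> (exp (c + 1) + cmod (f z0)) * exp (M * ln 4 / 2)"
          using fz norm_triangle_ineq4[of "f z" "f z0"] by (simp add: algebra_simps)
        obtain w where w: "w \<in> cantor_K" "dist z (of_real w) \<le> 2 * l" using sc(3) by blast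
        have "l \<le> (1/4) ^ n"
          using stage_len_le_power[of m] power_decreasing[of n m "1/4::real"] by (simp add: l_def m_def)
        then have "2 * l \<le> D / 2" using elim(2) by simp
        moreover have "dist z0 (of_real w) \<le> dist z0 z + dist z (of_real w)" by (rule dist_triangle)
        ultimately have far: "D / 2 \<le> cmod (z - z0)"
          using D(2)[OF w(1)] w(2) by (simp add: dist_norm norm_minus_commute)
        then have "z \<noteq> z0" using D(1) by auto
        then have "cmod (g z) = cmod (f z - f z0) / cmod (z - z0)" by (simp add: g_def norm_divide)
        also have "\<dots> \<le> ((exp (c + 1) + cmod (f z0)) * exp (M * ln 4 / 2)) / (D / 2)"
          using num far D(1) by (intro frac_le) auto
        finally show ?thesis by simp
      qed
      have "norm (contour_integral (stage_circle m I) g) \<le>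
         ((exp (c + 1) + cmod (f z0)) * exp (M * ln 4 / 2) * (2 / D)) * (2 * pi * l)"
        if I: "I \<in> cantor_intervals m" for I
      proof (rule has_contour_integral_bound_circlepath)
        have "stage_circle m I = circlepath (of_real ((fst I + snd I) / 2)) l"
          by (simp add: stage_circle_def l_def)
        moreover have "g contour_integrable_on circlepath (of_real ((fst I + snd I) / 2)) l"
        proof (rule contour_integrable_holomorphic_simple[OF g op])
          have "z \<notin> of_real ` cantor_K" if "z \<in> sphere (of_real ((fst I + snd I) / 2)) l" for z :: complex
            using stage_circle_log_potential(2)[of I "Suc n" k z, folded m_def, folded l_def, OF I] that
            by (simp add: dist_norm norm_minus_commute)
          then show "path_image (circlepath (of_real ((fst I + snd I) / 2)) l) \<subseteq> - of_real ` cantor_K"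
            using \<open>l > 0\<close> unfolding path_image_circlepath_nonneg[OF less_imp_le[OF \<open>l > 0\<close>]] by blast
        qed simp
        ultimately show "(g has_contour_integral contour_integral (stage_circle m I) g)
            (circlepath (of_real ((fst I + snd I) / 2)) l)"
          using has_contour_integral_integral by metis
      qed (use gb[OF I] \<open>l > 0\<close> D(1) in \<open>auto intro!: mult_nonneg_nonneg add_nonneg_nonneg\<close>)
      then have "norm (\<Sum>I\<in>cantor_intervals m. contour_integral (stage_circle m I) g) \<le>
         (\<Sum>I\<in>cantor_intervals m. ((exp (c + 1) + cmod (f z0)) * exp (M * ln 4 / 2) * (2 / D)) * (2 * pi * l))"
        by (rule sum_norm_le)
      also have "\<dots> = C * (2 ^ m * (exp (M * ln 4 / 2) * l))"
        by (simp add: card_cantor_intervals C_def)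
      also have "\<dots> \<le> C * (1/2) ^ m"
      proof (rule mult_left_mono)
        have "ln l = - (M * ln 4)" using ln_l \<open>l > 0\<close> by (simp add: ln_div)
        then have "l = exp (- (M * ln 4))" using exp_ln[OF \<open>l > 0\<close>] by simp
        then have "exp (M * ln 4 / 2) * l = exp (- (M * ln 4 / 2))"
          by (simp add: exp_add[symmetric])
        also have "exp (- (M * ln 4 / 2)) = exp (- (M * ln 2))"
          using ln_realpow[of 2 2] by simp
        also have "exp (- (M * ln 2)) = exp (real (4 ^ (n + k)) * (- ln 2))" by (simp add: M_def)
        also have "\<dots> = (1/2) ^ (4 ^ (n + k))"
          unfolding exp_of_nat_mult by (simp add: exp_minus)
        also have "\<dots> \<le> (1/2) ^ (2 * m)"
        proof (rule power_decreasing)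
          have "2 * Suc j \<le> 4 ^ j" if "j \<ge> 1" for j :: nat
            using that by (induction j rule: dec_induct) auto
          from this[of "n + k"] show "2 * m \<le> 4 ^ (n + k)" using elim(3) by (simp add: m_def)
        qed auto
        finally have "2 ^ m * (exp (M * ln 4 / 2) * l) \<le> 2 ^ m * (1/2) ^ (2 * m)"
          by (intro mult_left_mono) auto
        also have "\<dots> = (1/2) ^ m" by (simp add: power_mult power2_eq_square power_mult_distrib[symmetric] mult_2 power_add)
        finally show "2 ^ m * (exp (M * ln 4 / 2) * l) \<le> (1/2) ^ m" .
        show "0 \<le> C" using D(1) by (simp add: C_def add_nonneg_nonneg)
      qed
      finally show ?case
        by (simp add: contour_integral_unit_circle_eq_stage_circles[OF g, of m] m_def)
    qed
  qed
  have "(\<lambda>n. C * (1/2) ^ (n + Suc k)) \<longlonglongrightarrow> C * 0"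
    by (intro tendsto_mult tendsto_const LIMSEQ_ignore_initial_segment LIMSEQ_realpow_zero) auto
  then have "norm (contour_integral (circlepath (1/2) 1) g) \<le> C * 0"
    by (rule tendsto_lowerbound[OF _ bound[unfolded add_Suc_shift]]) simp
  then have "2 * pi * \<i> * (L - f z0) = 0" using J by simp
  then show ?thesis by simp
qed

section \<open>Means over circles\<close>

text \<open>The angle is not normalised: the total mass is \<open>2 * pi\<close>.\<close>

definition circle_measure :: "real measure" where
  "circle_measure = restrict_space lborel {0..2 * pi}"

lemma space_circle_measure: "space circle_measure = {0..2 * pi}"
  by (simp add: circle_measure_def space_restrict_space)

lemma measurable_circle_measure:
  "f \<in> borel_measurable borel \<Longrightarrow> f \<in> borel_measurable circle_measure"
  unfolding circle_measure_def by (rule measurable_restrict_space1) simp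

lemma borel_measurable_cis [measurable]: "cis \<in> borel_measurable borel"
  by (intro borel_measurable_continuous_onI continuous_intros)

interpretation circle: finite_measure circle_measure
  by (rule finite_measureI)
     (simp add: space_circle_measure, simp add: circle_measure_def emeasure_restrict_space)

lemma measure_circle_measure: "measure circle_measure {0..2 * pi} = 2 * pi"
  by (simp add: circle_measure_def measure_restrict_space)

lemma circle_mean_eq:
  "circle_mean f = ereal (1 / (2 * pi)) *
     (enn2ereal (\<integral>\<^sup>+ t. e2ennreal (f t) \<partial>circle_measure)
      - enn2ereal (\<integral>\<^sup>+ t. e2ennreal (- f t) \<partial>circle_measure))"
  unfolding circle_mean_def circle_measure_def by (simp add: nn_integral_restrict_space)

text \<open>The mean does not notice null sets, so the angles at which a circle passes through the
  pole of a logarithm are harmless.\<close>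

lemma circle_mean_ereal:
  assumes u: "integrable circle_measure u" and f: "AE t in circle_measure. f t = ereal (u t)"
  shows "circle_mean f = ereal ((\<integral>t. u t \<partial>circle_measure) / (2 * pi))"
proof -
  have 1: "(\<integral>\<^sup>+ t. e2ennreal (f t) \<partial>circle_measure) = (\<integral>\<^sup>+ t. ennreal (u t) \<partial>circle_measure)"
    "(\<integral>\<^sup>+ t. e2ennreal (- f t) \<partial>circle_measure) = (\<integral>\<^sup>+ t. ennreal (- u t) \<partial>circle_measure)"
    by (intro nn_integral_cong_AE; use f in eventually_elim; simp)+
  have fin: "(\<integral>\<^sup>+ t. ennreal (u t) \<partial>circle_measure) \<noteq> \<infinity>" "(\<integral>\<^sup>+ t. ennreal (- u t) \<partial>circle_measure) \<noteq> \<infinity>"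
    using u unfolding real_integrable_def by blast+
  have "enn2ereal x = ereal (enn2real x)" if "x \<noteq> \<infinity>" for x
    using that by (cases x) auto
  then have "circle_mean f = ereal (1 / (2 * pi)) * ereal (\<integral>t. u t \<partial>circle_measure)"
    unfolding circle_mean_eq 1 real_lebesgue_integral_def[OF u] using fin by simp
  then show ?thesis by simp
qed

lemma circle_mean_mono:
  assumes "\<And>t. t \<in> {0..2 * pi} \<Longrightarrow> f t \<le> g t"
  shows "circle_mean f \<le> circle_mean g"
  unfolding circle_mean_eq
  by (intro ereal_mult_left_mono ereal_minus_mono)
     (auto intro!: nn_integral_mono e2ennreal_mono assms simp: space_circle_measure less_eq_ennreal.rep_eq[symmetric])

lemma has_bochner_integral_circle:
  fixes f :: "real \<Rightarrow> real"
  assumes f: "continuous_on {0..2 * pi} f" and I: "(f has_integral I) {0..2 * pi}"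
  shows "has_bochner_integral circle_measure f I"
proof -
  have "set_integrable lborel {0..2 * pi} f"
    by (rule borel_integrable_atLeastAtMost'[OF f])
  moreover from set_borel_integral_eq_integral(2)[OF this] I
  have "(LINT x : {0..2 * pi} | lborel. f x) = I" by (simp add: integral_unique)
  ultimately show ?thesis
    unfolding has_bochner_integral_iff circle_measure_def
    by (simp add: integrable_restrict_space integral_restrict_space set_integrable_def set_lebesgue_integral_def)
qed

lemma holomorphic_circle_mean:
  assumes h: "h holomorphic_on ball 0 R" and R: "R > 1"
  shows "has_bochner_integral circle_measure (\<lambda>t. Re (h (cis t))) (2 * pi * Re (h 0))"
proof (rule has_bochner_integral_circle)
  have "continuous_on {0..2 * pi} (\<lambda>t. h (cis t))"
    by (rule continuous_on_compose2[OF holomorphic_on_imp_continuous_on[OF h]])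
       (use R in \<open>auto intro!: continuous_intros\<close>)
  then show "continuous_on {0..2 * pi} (\<lambda>t. Re (h (cis t)))"
    by (intro continuous_intros)
  have "((\<lambda>u. h u / (u - 0)) has_contour_integral (2 * of_real pi * \<i> * h 0)) (circlepath 0 1)"
    by (rule Cauchy_integral_circlepath_simple)
       (use R in \<open>auto intro!: holomorphic_on_subset[OF h]\<close>)
  then have "((\<lambda>t. h (cis t) * \<i>) has_integral (2 * of_real pi * \<i> * h 0)) {0..2 * pi}"
    unfolding circlepath_def by (subst (asm) has_contour_integral_part_circlepath_iff) auto
  from has_integral_mult_left[OF this, of "- \<i>"]
  have "((\<lambda>t. h (cis t)) has_integral (2 * of_real pi * h 0)) {0..2 * pi}"
    by (simp add: algebra_simps)
  from has_integral_Re[OF this] show "((\<lambda>t. Re (h (cis t))) has_integral (2 * pi * Re (h 0))) {0..2 * pi}"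
    by simp
qed

text \<open>After division by \<open>a\<close> the values stay in the right half plane, where the logarithm is the real
  part of the holomorphic function \<open>Ln\<close>.\<close>

lemma log_circle_mean_inside:
  assumes "cmod b < cmod a"
  shows "has_bochner_integral circle_measure (\<lambda>t. ln (cmod (a + b * cis t))) (2 * pi * ln (cmod a))"
proof -
  define q where "q = b / a"
  have a: "a \<noteq> 0" using assms by auto
  have q: "cmod q < 1" using assms a by (simp add: q_def norm_divide field_simps)
  define R where "R = 2 / (1 + cmod q)"
  have q1: "0 < 1 + cmod q" by (simp add: add_pos_nonneg)
  have R: "R > 1" using q by (simp add: R_def pos_less_divide_eq[OF q1])
  have pos: "Re (1 + q * z) > 0" if "z \<in> ball 0 R" for z
  proof -
    have "cmod (q * z) \<le> cmod q * R" using that by (simp add: norm_mult mult_left_mono)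
    also have "\<dots> < 1" using q by (simp add: R_def pos_divide_less_eq[OF q1])
    finally show ?thesis using abs_Re_le_cmod[of "q * z"] by simp
  qed
  have "has_bochner_integral circle_measure (\<lambda>t. Re (Ln (1 + q * cis t))) (2 * pi * Re (Ln (1 + q * 0)))"
    by (rule holomorphic_circle_mean[OF _ R])
       (use pos in \<open>force intro!: holomorphic_intros simp: complex_nonpos_Reals_iff\<close>)
  moreover have "has_bochner_integral circle_measure (\<lambda>t. ln (cmod a)) (2 * pi * ln (cmod a))"
    by (simp add: has_bochner_integral_iff space_circle_measure measure_circle_measure)
  ultimately have *: "has_bochner_integral circle_measure (\<lambda>t. Re (Ln (1 + q * cis t)) + ln (cmod a)) (2 * pi * ln (cmod a))"
    using has_bochner_integral_add by fastforce
  have "Re (Ln (1 + q * cis t)) + ln (cmod a) = ln (cmod (a + b * cis t))" for t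
  proof -
    have "1 + q * cis t \<noteq> 0" using pos[of "cis t"] R by force
    moreover have "a + b * cis t = a * (1 + q * cis t)" using a by (simp add: q_def field_simps)
    ultimately show ?thesis using a by (simp add: norm_mult ln_mult)
  qed
  then show ?thesis using * by simp
qed

text \<open>Multiplication by \<open>cis (- t)\<close> and conjugation exchange the roles of \<open>a\<close> and \<open>b\<close>.\<close>

lemma log_circle_mean_outside:
  assumes "cmod a < cmod b"
  shows "has_bochner_integral circle_measure (\<lambda>t. ln (cmod (a + b * cis t))) (2 * pi * ln (cmod b))"
proof -
  have "cmod (a + b * cis t) = cmod (cnj b + cnj a * cis t)" for t
  proof -
    have "cmod (a + b * cis t) = cmod (cis (- t) * (a + b * cis t))" by (simp add: norm_mult)
    also have "cis (- t) * (a + b * cis t) = cnj (cnj b + cnj a * cis t)"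
      by (simp add: algebra_simps cis_mult cis_cnj)
    finally show ?thesis by (simp only: complex_mod_cnj)
  qed
  then show ?thesis using log_circle_mean_inside[of "cnj a" "cnj b"] assms by simp
qed

lemma countable_cis_eq: "countable {t. cis t = c}"
proof (cases "\<exists>s. cis s = c")
  case True
  then obtain s where s: "cis s = c" by blast
  have "{t. cis t = c} \<subseteq> range (\<lambda>n::int. s + 2 * pi * n)"
  proof
    fix t assume "t \<in> {t. cis t = c}"
    then have "exp (\<i> * of_real t) = exp (\<i> * of_real s)" using s by (simp add: cis_conv_exp)
    then obtain n :: int where "\<i> * of_real t = \<i> * of_real s + (of_int (2 * n) * pi) * \<i>"
      unfolding exp_eq by blast
    then have "\<i> * (of_real t - (of_real s + of_real (2 * pi * n))) = 0" by (simp add: algebra_simps)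
    then have "complex_of_real t = of_real (s + 2 * pi * n)" by simp
    then show "t \<in> range (\<lambda>n::int. s + 2 * pi * n)" unfolding of_real_eq_iff by blast
  qed
  then show ?thesis by (rule countable_subset) simp
qed simp

lemma AE_circle_nonzero:
  assumes "a \<noteq> 0"
  shows "AE t in circle_measure. a + b * cis t \<noteq> 0"
proof -
  have "{t. a + b * cis t = 0} \<subseteq> {t. cis t = - a / b}"
  proof
    fix t assume "t \<in> {t. a + b * cis t = 0}"
    then have t: "b * cis t = - a" by (simp add: add_eq_0_iff minus_equation_iff)
    then have "b \<noteq> 0" using assms by auto
    with t show "t \<in> {t. cis t = - a / b}" by (simp add: field_simps)
  qed
  then have "countable {t. a + b * cis t = 0}" using countable_cis_eq countable_subset by blast
  then have "{t. a + b * cis t = 0} \<in> null_sets lborel" by (rule countable_imp_null_set_lborel)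
  then have "AE t in lborel. \<not> a + b * cis t = 0" by (rule AE_I'[where N = "{t. a + b * cis t = 0}"]) auto
  then show ?thesis unfolding circle_measure_def by (subst AE_restrict_space_iff) auto
qed

text \<open>The circle passes through \<open>0\<close>.  Moving its centre outwards by the factor \<open>s n\<close> reduces the claim
  to \<open>log_circle_mean_inside\<close>, and the lemma of Fatou, applied to the distance of the logarithm from its
  upper bound \<open>M\<close>, gives both integrability and the inequality in the limit.\<close>

lemma log_circle_mean_boundary:
  assumes ab: "cmod a = cmod b" and a: "a \<noteq> 0"
  shows "integrable circle_measure (\<lambda>t. ln (cmod (a + b * cis t)))"
    and "2 * pi * ln (cmod a) \<le> (\<integral>t. ln (cmod (a + b * cis t)) \<partial>circle_measure)"
proof -
  \<comment> \<open>The maximum with \<open>0\<close> keeps the bound valid at zeros of the argument, where \<open>ln 0 = 0\<close>.\<close>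
  define M where "M = max 0 (ln (3 * cmod a))"
  define p where "p = (\<lambda>t. M - ln (cmod (a + b * cis t)))"
  define s where "s = (\<lambda>n::nat. 1 + 1 / Suc n)"
  define q where "q = (\<lambda>n t. M - ln (cmod (a * s n + b * cis t)))"
  have s: "1 < s n" "s n \<le> 2" for n by (auto simp: s_def)
  have slim: "s \<longlonglongrightarrow> 1"
  proof -
    have "s \<longlonglongrightarrow> 1 + 0" unfolding s_def
      by (intro tendsto_add tendsto_const LIMSEQ_Suc[OF lim_1_over_n])
    then show ?thesis by simp
  qed
  have le: "ln (cmod (a * r + b * cis t)) \<le> M" if "0 \<le> r" "r \<le> 2" for r t :: real
  proof (cases "a * r + b * cis t = 0")
    case False
    have "cmod (a * r + b * cis t) \<le> cmod (a * r) + cmod (b * cis t)" by (rule norm_triangle_ineq)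
    also have "cmod (a * r) \<le> cmod a * 2" using that by (simp add: norm_mult mult_left_mono)
    also have "cmod a * 2 + cmod (b * cis t) = 3 * cmod a" using ab by (simp add: norm_mult)
    finally have "cmod (a * r + b * cis t) \<le> 3 * cmod a" by simp
    then have "ln (cmod (a * r + b * cis t)) \<le> ln (3 * cmod a)" using False by (intro ln_mono) auto
    then show ?thesis by (simp add: M_def)
  qed (simp add: M_def)
  have p0: "0 \<le> p t" for t using le[of 1 t] by (simp add: p_def)
  have q0: "0 \<le> q n t" for n t using le[of "s n" t] s[of n] by (simp add: q_def)
  have q_int: "has_bochner_integral circle_measure (q n) (M * (2 * pi) - 2 * pi * ln (cmod (a * s n)))" for n
    unfolding q_def
  proof (intro has_bochner_integral_diff log_circle_mean_inside)
    have "0 < cmod b" using a by (simp flip: ab)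
    then have "cmod b * 1 < cmod b * s n" using s[of n] by (intro mult_strict_left_mono)
    then show "cmod b < cmod (a * s n)" using ab s[of n] by (simp add: norm_mult)
  qed (simp add: has_bochner_integral_iff space_circle_measure measure_circle_measure)
  have q_nn: "(\<integral>\<^sup>+ t. ennreal (q n t) \<partial>circle_measure) = ennreal (M * (2 * pi) - 2 * pi * ln (cmod (a * s n)))" for n
    using q_int[of n] q0 by (simp add: has_bochner_integral_iff nn_integral_eq_integral)
  have p_le: "ennreal (p t) \<le> liminf (\<lambda>n. ennreal (q n t))" if "a + b * cis t \<noteq> 0" for t
  proof -
    have "(\<lambda>n. q n t) \<longlonglongrightarrow> M - ln (cmod (a * 1 + b * cis t))"
      unfolding q_def using that
      by (intro tendsto_intros tendsto_of_real slim[THEN tendsto_of_real, simplified]) auto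
    then have "(\<lambda>n. ennreal (q n t)) \<longlonglongrightarrow> ennreal (p t)"
      unfolding p_def by (intro tendsto_ennrealI) simp
    then show ?thesis by (simp add: lim_imp_Liminf)
  qed
  have meas: "p \<in> borel_measurable circle_measure" "q n \<in> borel_measurable circle_measure" for n
    unfolding p_def q_def
    by (intro measurable_circle_measure borel_measurable_diff borel_measurable_const borel_measurable_ln
        borel_measurable_norm[THEN measurable_compose[rotated]] borel_measurable_add borel_measurable_times borel_measurable_cis)+
  have "AE t in circle_measure. ennreal (p t) \<le> liminf (\<lambda>n. ennreal (q n t))"
    using AE_circle_nonzero[OF a, of b] by eventually_elim (rule p_le)
  then have "(\<integral>\<^sup>+ t. ennreal (p t) \<partial>circle_measure) \<le> (\<integral>\<^sup>+ t. liminf (\<lambda>n. ennreal (q n t)) \<partial>circle_measure)"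
    by (rule nn_integral_mono_AE)
  also have "\<dots> \<le> liminf (\<lambda>n. \<integral>\<^sup>+ t. ennreal (q n t) \<partial>circle_measure)"
    by (rule nn_integral_liminf) (intro measurable_compose[OF meas(2)] measurable_ennreal)
  also have "\<dots> = ennreal (M * (2 * pi) - 2 * pi * ln (cmod a))"
  proof (rule lim_imp_Liminf)
    show "(\<lambda>n. \<integral>\<^sup>+ t. ennreal (q n t) \<partial>circle_measure) \<longlonglongrightarrow> ennreal (M * (2 * pi) - 2 * pi * ln (cmod a))"
      unfolding q_nn
    proof (intro tendsto_ennrealI tendsto_diff tendsto_const tendsto_mult tendsto_ln)
      show "(\<lambda>n. cmod (a * s n)) \<longlonglongrightarrow> cmod a"
        using tendsto_norm[OF tendsto_mult[OF tendsto_const[of a] tendsto_of_real[OF slim]]] by simp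
    qed (use a in auto)
  qed simp
  finally have nn: "(\<integral>\<^sup>+ t. ennreal (p t) \<partial>circle_measure) \<le> ennreal (M * (2 * pi) - 2 * pi * ln (cmod a))" .
  then have p_int: "integrable circle_measure p"
    using p0 meas(1) by (intro integrableI_nonneg) (auto simp: top_unique less_top[symmetric])
  have "integrable circle_measure (\<lambda>t. M - p t)" using p_int by simp
  then show int: "integrable circle_measure (\<lambda>t. ln (cmod (a + b * cis t)))" by (simp add: p_def)
  have Mge: "0 \<le> M * (2 * pi) - 2 * pi * ln (cmod a)"
  proof -
    have "ln (cmod a) \<le> ln (3 * cmod a)" using a by (intro ln_mono) auto
    then have "ln (cmod a) \<le> M" by (simp add: M_def)
    then show ?thesis using pi_gt_zero by (simp add: mult.commute)
  qed
  have "(\<integral>t. p t \<partial>circle_measure) \<le> M * (2 * pi) - 2 * pi * ln (cmod a)"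
    using nn Mge p0 p_int by (subst (asm) nn_integral_eq_integral) auto
  also have "(\<integral>t. p t \<partial>circle_measure) = M * (2 * pi) - (\<integral>t. ln (cmod (a + b * cis t)) \<partial>circle_measure)"
    unfolding p_def using int by (simp add: space_circle_measure measure_circle_measure)
  finally show "2 * pi * ln (cmod a) \<le> (\<integral>t. ln (cmod (a + b * cis t)) \<partial>circle_measure)" by simp
qed

lemma log_circle_mean_ge:
  assumes a: "a \<noteq> 0"
  shows "integrable circle_measure (\<lambda>t. ln (cmod (a + b * cis t)))"
    and "2 * pi * ln (cmod a) \<le> (\<integral>t. ln (cmod (a + b * cis t)) \<partial>circle_measure)"
proof -
  consider "cmod b < cmod a" | "cmod a < cmod b" | "cmod a = cmod b" by linarith
  then have "integrable circle_measure (\<lambda>t. ln (cmod (a + b * cis t))) \<and>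
     2 * pi * ln (cmod a) \<le> (\<integral>t. ln (cmod (a + b * cis t)) \<partial>circle_measure)"
  proof cases
    case 1
    then show ?thesis using log_circle_mean_inside[OF 1] by (simp add: has_bochner_integral_iff)
  next
    case 2
    then have "ln (cmod a) \<le> ln (cmod b)" using a by (intro ln_mono) auto
    then show ?thesis using log_circle_mean_outside[OF 2] by (simp add: has_bochner_integral_iff)
  next
    case 3
    then show ?thesis using log_circle_mean_boundary[OF 3 a] by simp
  qed
  then show "integrable circle_measure (\<lambda>t. ln (cmod (a + b * cis t)))"
    "2 * pi * ln (cmod a) \<le> (\<integral>t. ln (cmod (a + b * cis t)) \<partial>circle_measure)" by auto
qed

text \<open>The interchange of the two integrals, for a kernel general enough to cover both coordinates:
  \<open>z - w\<close> in the plane and \<open>1 - w * \<zeta>\<close> at infinity are affine along a circle.\<close>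

lemma integral_log_circle_mean:
  fixes A B :: "real \<Rightarrow> complex"
  assumes A: "continuous_on UNIV A" and B: "continuous_on UNIV B"
    and AB: "\<And>w. w \<in> cantor_K \<Longrightarrow> cmod (B w) < cmod (A w)"
  shows "has_bochner_integral circle_measure
      (\<lambda>t. \<integral>w. ln (cmod (A w + B w * cis t)) \<partial>cantor_mu) (2 * pi * (\<integral>w. ln (cmod (A w)) \<partial>cantor_mu))"
proof -
  have [measurable]: "A \<in> borel_measurable borel" "B \<in> borel_measurable borel"
    using A B by (simp_all add: borel_measurable_continuous_onI)
  have [measurable]: "cantor_K \<in> sets borel" by (simp add: borel_closed closed_cantor_K)
  have ne: "cantor_K \<noteq> {}" using zero_in_cantor_K by auto
  have contA: "continuous_on cantor_K A" "continuous_on cantor_K B"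
    using A B continuous_on_subset by blast+
  obtain d where d: "0 < d" "\<And>w. w \<in> cantor_K \<Longrightarrow> d \<le> cmod (A w) - cmod (B w)"
  proof -
    have "\<exists>x\<in>cantor_K. \<forall>y\<in>cantor_K. cmod (A x) - cmod (B x) \<le> cmod (A y) - cmod (B y)"
      by (intro continuous_attains_inf compact_cantor_K ne continuous_intros contA)
    then obtain x where "x \<in> cantor_K" "\<And>y. y \<in> cantor_K \<Longrightarrow> cmod (A x) - cmod (B x) \<le> cmod (A y) - cmod (B y)"
      by blast
    then show ?thesis using AB[of x] by (intro that[of "cmod (A x) - cmod (B x)"]) auto
  qed
  obtain e where e: "\<And>w. w \<in> cantor_K \<Longrightarrow> cmod (A w) + cmod (B w) \<le> e"
  proof -
    have "\<exists>x\<in>cantor_K. \<forall>y\<in>cantor_K. cmod (A y) + cmod (B y) \<le> cmod (A x) + cmod (B x)"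
      by (intro continuous_attains_sup compact_cantor_K ne continuous_intros contA)
    then show ?thesis using that by blast
  qed
  have bound: "\<bar>ln (cmod (A w + B w * cis t))\<bar> \<le> \<bar>ln d\<bar> + \<bar>ln e\<bar>" if w: "w \<in> cantor_K" for w t
  proof -
    have "cmod (A w) - cmod (B w) \<le> cmod (A w + B w * cis t)"
      using norm_triangle_ineq4[of "A w + B w * cis t" "B w * cis t"] by (simp add: norm_mult)
    then have 1: "d \<le> cmod (A w + B w * cis t)" using d(2)[OF w] by linarith
    have "cmod (A w + B w * cis t) \<le> cmod (A w) + cmod (B w)"
      using norm_triangle_ineq[of "A w" "B w * cis t"] by (simp add: norm_mult)
    then have 2: "cmod (A w + B w * cis t) \<le> e" using e[OF w] by linarith
    have "0 < cmod (A w + B w * cis t)" using 1 d(1) by linarith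
    then have "ln d \<le> ln (cmod (A w + B w * cis t))" "ln (cmod (A w + B w * cis t)) \<le> ln e"
      using 1 2 d(1) by (simp_all only: ln_mono)
    then show ?thesis by arith
  qed
  \<comment> \<open>The indicator makes the kernel bounded everywhere, so no null set of the product measure arises.\<close>
  define F where "F = (\<lambda>t w. indicator cantor_K w * ln (cmod (A w + B w * cis t)))"
  interpret P: pair_sigma_finite circle_measure cantor_mu ..
  interpret PF: finite_measure "circle_measure \<Otimes>\<^sub>M cantor_mu"
    by (rule finite_measure_pair_measure) unfold_locales
  have [measurable]: "(\<lambda>x. cis (fst x)) \<in> borel_measurable (circle_measure \<Otimes>\<^sub>M cantor_mu)"
    by (rule measurable_compose[OF measurable_fst measurable_circle_measure[OF borel_measurable_cis]])
  have F_int: "integrable (circle_measure \<Otimes>\<^sub>M cantor_mu) (case_prod F)"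
  proof (rule PF.integrable_const_bound[where B = "\<bar>ln d\<bar> + \<bar>ln e\<bar>"])
    show "case_prod F \<in> borel_measurable (circle_measure \<Otimes>\<^sub>M cantor_mu)"
      unfolding F_def case_prod_unfold by measurable
    show "AE x in circle_measure \<Otimes>\<^sub>M cantor_mu. norm (case_prod F x) \<le> \<bar>ln d\<bar> + \<bar>ln e\<bar>"
      using bound by (intro AE_I2) (auto simp: F_def indicator_def)
  qed
  have F_eq: "(\<integral>w. F t w \<partial>cantor_mu) = (\<integral>w. ln (cmod (A w + B w * cis t)) \<partial>cantor_mu)" for t
  proof (rule integral_cong_AE)
    show "AE w in cantor_mu. F t w = ln (cmod (A w + B w * cis t))"
      using AE_cantor_mu by eventually_elim (simp add: F_def)
  qed (simp_all add: F_def)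
  have "integrable circle_measure (\<lambda>t. \<integral>w. F t w \<partial>cantor_mu)"
    using P.integrable_fst[OF F_int] .
  moreover have "(\<integral>t. (\<integral>w. F t w \<partial>cantor_mu) \<partial>circle_measure) = 2 * pi * (\<integral>w. ln (cmod (A w)) \<partial>cantor_mu)"
  proof -
    have "(\<integral>t. (\<integral>w. F t w \<partial>cantor_mu) \<partial>circle_measure) = (\<integral>w. (\<integral>t. F t w \<partial>circle_measure) \<partial>cantor_mu)"
      by (rule P.Fubini_integral[OF F_int, symmetric])
    also have "\<dots> = (\<integral>w. 2 * pi * ln (cmod (A w)) \<partial>cantor_mu)"
    proof (intro integral_cong_AE)
      show "AE w in cantor_mu. (\<integral>t. F t w \<partial>circle_measure) = 2 * pi * ln (cmod (A w))"
        using AE_cantor_mu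
      proof eventually_elim
        case (elim w)
        then show ?case
          using log_circle_mean_inside[OF AB[OF elim]] by (simp add: F_def has_bochner_integral_iff)
      qed
      show "(\<lambda>w. \<integral>t. F t w \<partial>circle_measure) \<in> borel_measurable cantor_mu"
        using P.integrable_snd[OF F_int] by simp
    qed measurable
    finally show ?thesis by simp
  qed
  ultimately show ?thesis by (simp add: has_bochner_integral_iff F_eq)
qed

section \<open>The potential off the Cantor set and at infinity\<close>

abbreviation complex_K :: "complex set" where
  "complex_K \<equiv> of_real ` cantor_K"

lemma compact_complex_K: "compact complex_K"
  by (intro compact_continuous_image compact_cantor_K continuous_intros)

lemma open_Compl_complex_K: "open (- complex_K)"
  by (intro open_Compl compact_imp_closed compact_complex_K)

lemma abs_ln_diff_le:
  fixes x y r :: real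
  assumes "0 < r" "r \<le> x" "r \<le> y"
  shows "\<bar>ln x - ln y\<bar> \<le> \<bar>x - y\<bar> / r"
proof -
  have *: "ln u - ln v \<le> \<bar>u - v\<bar> / r" if "r \<le> u" "r \<le> v" for u v
  proof -
    have "ln u - ln v \<le> (u - v) / v" using that assms(1) by (intro ln_diff_le) auto
    also have "\<dots> \<le> \<bar>u - v\<bar> / r" using that assms(1) by (intro frac_le) auto
    finally show ?thesis .
  qed
  show ?thesis using *[of x y] *[of y x] assms by (simp add: abs_minus_commute abs_le_iff)
qed

text \<open>The logarithm is Lipschitz with constant \<open>1 / r\<close> at distance \<open>r\<close> from its singularity.\<close>

lemma log_potential_lipschitz:
  assumes r: "0 < r" "\<And>w. w \<in> cantor_K \<Longrightarrow> r \<le> dist z (of_real w)" "\<And>w. w \<in> cantor_K \<Longrightarrow> r \<le> dist z' (of_real w)"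
  shows "\<bar>log_potential cantor_mu z - log_potential cantor_mu z'\<bar> \<le> dist z z' / r"
proof -
  have z: "z \<notin> complex_K" "z' \<notin> complex_K" using r by force+
  note int = integrable_log_kernel[OF z(1)] integrable_log_kernel[OF z(2)]
  have "\<bar>log_potential cantor_mu z - log_potential cantor_mu z'\<bar> =
      \<bar>\<integral>w. ln (cmod (z - of_real w)) - ln (cmod (z' - of_real w)) \<partial>cantor_mu\<bar>"
    unfolding log_potential_def by (simp add: Bochner_Integration.integral_diff[OF int])
  also have "\<dots> \<le> (\<integral>w. \<bar>ln (cmod (z - of_real w)) - ln (cmod (z' - of_real w))\<bar> \<partial>cantor_mu)"
    by (rule integral_abs_bound)
  also have "\<dots> \<le> (\<integral>w. dist z z' / r \<partial>cantor_mu)"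
  proof (rule integral_mono_AE)
    show "AE w in cantor_mu. \<bar>ln (cmod (z - of_real w)) - ln (cmod (z' - of_real w))\<bar> \<le> dist z z' / r"
      using AE_cantor_mu
    proof eventually_elim
      case (elim w)
      have "\<bar>ln (cmod (z - of_real w)) - ln (cmod (z' - of_real w))\<bar> \<le> \<bar>cmod (z - of_real w) - cmod (z' - of_real w)\<bar> / r"
        using r elim by (intro abs_ln_diff_le) (auto simp: dist_norm)
      also have "\<bar>cmod (z - of_real w) - cmod (z' - of_real w)\<bar> \<le> dist z z'"
        using norm_triangle_ineq3[of "z - of_real w" "z' - of_real w"] by (simp add: dist_norm)
      finally show ?case using r(1) by (simp add: divide_right_mono)
    qed
  qed (use int in auto)
  also have "\<dots> = dist z z' / r" using cantor.prob_space by simp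
  finally show ?thesis .
qed

lemma continuous_on_log_potential: "continuous_on (- complex_K) (log_potential cantor_mu)"
proof (intro continuous_at_imp_continuous_on ballI)
  fix z :: complex assume "z \<in> - complex_K"
  then obtain d where d: "0 < d" "\<And>w. w \<in> cantor_K \<Longrightarrow> d \<le> dist z (of_real w)"
    using cantor_K_distance[of z] by blast
  show "isCont (log_potential cantor_mu) z"
    unfolding continuous_at_eps_delta
  proof (intro allI impI)
    fix e :: real assume "e > 0"
    show "\<exists>\<delta>>0. \<forall>x'. dist x' z < \<delta> \<longrightarrow> dist (log_potential cantor_mu x') (log_potential cantor_mu z) < e"
    proof (intro exI[of _ "min (d / 2) (e * d / 4)"] conjI allI impI)
      fix x assume x: "dist x z < min (d / 2) (e * d / 4)"
      have "\<bar>log_potential cantor_mu x - log_potential cantor_mu z\<bar> \<le> dist x z / (d / 2)"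
      proof (rule log_potential_lipschitz)
        fix w assume w: "w \<in> cantor_K"
        have "dist z (of_real w) \<le> dist z x + dist x (of_real w)" by (rule dist_triangle)
        then show "d / 2 \<le> dist x (of_real w)" using d(2)[OF w] x by (simp add: dist_commute)
        show "d / 2 \<le> dist z (of_real w)" using d(1) d(2)[OF w] by simp
      qed (use d in auto)
      also have "\<dots> < e"
      proof -
        have "dist x z < e * d / 4" using x by simp
        also have "\<dots> < e * (d / 2)" using d(1) \<open>e > 0\<close> by simp
        finally show ?thesis using d(1) by (simp add: pos_divide_less_eq)
      qed
      finally show "dist (log_potential cantor_mu x) (log_potential cantor_mu z) < e"
        by (simp add: dist_real_def)
    qed (use d \<open>e > 0\<close> in auto)
  qed
qed

lemma log_potential_ge_at_infinity:
  assumes z: "2 < cmod z"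
  shows "ln (cmod z - 1) \<le> log_potential cantor_mu z"
proof -
  have far: "cmod z - 1 \<le> cmod (z - of_real w)" if "w \<in> cantor_K" for w
  proof -
    have "cmod z \<le> cmod (z - of_real w) + cmod (of_real w)" using norm_triangle_ineq[of "z - of_real w" "of_real w"] by simp
    moreover have "cmod (of_real w) \<le> 1" using cantor_K_subset that by auto
    ultimately show ?thesis by simp
  qed
  have zK: "z \<notin> complex_K" using far z by force
  have "ln (cmod z - 1) = (\<integral>w. ln (cmod z - 1) \<partial>cantor_mu)" using cantor.prob_space by simp
  also have "\<dots> \<le> log_potential cantor_mu z"
    unfolding log_potential_def
  proof (rule integral_mono_AE)
    show "AE w in cantor_mu. ln (cmod z - 1) \<le> ln (cmod (z - of_real w))"
      using AE_cantor_mu by eventually_elim (use far z in \<open>auto intro!: ln_mono\<close>)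
  qed (use integrable_log_kernel[OF zK] in auto)
  finally show ?thesis .
qed

text \<open>Otherwise \<open>c\<close> itself has the form \<open>a + \<zeta> * b\<close> with \<open>\<zeta> = (c - a) / b\<close> in the unit disc.\<close>

lemma disc_avoids_point:
  fixes a b c :: complex
  assumes "\<And>\<zeta>. cmod \<zeta> \<le> 1 \<Longrightarrow> a + \<zeta> * b \<noteq> c"
  shows "cmod b < cmod (a - c)"
proof (rule ccontr)
  assume *: "\<not> cmod b < cmod (a - c)"
  have "a \<noteq> c" using assms[of 0] by simp
  with * have b: "b \<noteq> 0" by auto
  have "cmod ((c - a) / b) \<le> 1" using * b by (simp add: norm_divide norm_minus_commute)
  from assms[OF this] show False using b by simp
qed

lemma log_potential_mean:
  assumes "\<And>\<zeta>. cmod \<zeta> \<le> 1 \<Longrightarrow> a + \<zeta> * b \<notin> complex_K"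
  shows "has_bochner_integral circle_measure (\<lambda>t. log_potential cantor_mu (a + b * cis t))
    (2 * pi * log_potential cantor_mu a)"
proof -
  have "cmod b < cmod (a - of_real w)" if "w \<in> cantor_K" for w
    using assms that by (intro disc_avoids_point) auto
  then have "has_bochner_integral circle_measure
      (\<lambda>t. \<integral>w. ln (cmod ((a - of_real w) + b * cis t)) \<partial>cantor_mu) (2 * pi * (\<integral>w. ln (cmod (a - of_real w)) \<partial>cantor_mu))"
    by (intro integral_log_circle_mean continuous_intros) auto
  then show ?thesis by (simp add: log_potential_def algebra_simps)
qed

text \<open>The harmonic part of the exhaustion in the coordinate \<open>\<zeta> = 1 / z\<close>, up to sign: the singularity
  \<open>ln \<bar>\<zeta>\<bar>\<close> has been split off.\<close>

definition inverted_potential :: "complex \<Rightarrow> real" where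
  "inverted_potential \<zeta> = (\<integral>w. ln (cmod (1 - of_real w * \<zeta>)) \<partial>cantor_mu)"

lemma inverted_potential_mean:
  assumes "\<And>\<zeta>. cmod \<zeta> \<le> 1 \<Longrightarrow> a + \<zeta> * b = 0 \<or> 1 / (a + \<zeta> * b) \<notin> complex_K"
  shows "has_bochner_integral circle_measure (\<lambda>t. inverted_potential (a + b * cis t))
    (2 * pi * inverted_potential a)"
proof -
  have "cmod (- of_real w * b) < cmod (1 - of_real w * a)" if w: "w \<in> cantor_K" for w
  proof (cases "w = 0")
    case False
    have "cmod b < cmod (a - 1 / of_real w)"
    proof (rule disc_avoids_point)
      fix \<zeta> :: complex assume "cmod \<zeta> \<le> 1"
      from assms[OF this] show "a + \<zeta> * b \<noteq> 1 / of_real w" using False w by auto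
    qed
    then have "cmod (of_real w) * cmod b < cmod (of_real w) * cmod (a - 1 / of_real w)"
      using False by (intro mult_strict_left_mono) auto
    also have "\<dots> = cmod (1 - of_real w * a)"
      unfolding norm_mult[symmetric] using False by (simp add: right_diff_distrib norm_minus_commute)
    finally show ?thesis by (simp add: norm_mult)
  qed simp
  then have "has_bochner_integral circle_measure
      (\<lambda>t. \<integral>w. ln (cmod ((1 - of_real w * a) + (- of_real w * b) * cis t)) \<partial>cantor_mu)
      (2 * pi * (\<integral>w. ln (cmod (1 - of_real w * a)) \<partial>cantor_mu))"
    by (intro integral_log_circle_mean continuous_intros)
  then show ?thesis by (simp add: inverted_potential_def algebra_simps)
qed

lemma log_potential_inverse:
  assumes "\<zeta> \<noteq> 0" "1 / \<zeta> \<notin> complex_K"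
  shows "- log_potential cantor_mu (1 / \<zeta>) = ln (cmod \<zeta>) - inverted_potential \<zeta>"
proof -
  note int = integrable_log_kernel[OF assms(2)]
  have "inverted_potential \<zeta> = (\<integral>w. ln (cmod \<zeta>) + ln (cmod (1 / \<zeta> - of_real w)) \<partial>cantor_mu)"
    unfolding inverted_potential_def
  proof (rule integral_cong_AE)
    show "AE w in cantor_mu. ln (cmod (1 - of_real w * \<zeta>)) = ln (cmod \<zeta>) + ln (cmod (1 / \<zeta> - of_real w))"
      using AE_cantor_mu
    proof eventually_elim
      case (elim w)
      have "1 / \<zeta> - of_real w \<noteq> 0" using assms(2) elim by auto
      moreover have "1 - of_real w * \<zeta> = \<zeta> * (1 / \<zeta> - of_real w)" using assms(1) by (simp add: algebra_simps)
      ultimately show ?case using assms(1) by (simp add: norm_mult ln_mult)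
    qed
  qed simp_all
  also have "\<dots> = ln (cmod \<zeta>) + log_potential cantor_mu (1 / \<zeta>)"
    using int cantor.prob_space by (simp add: log_potential_def)
  finally show ?thesis by simp
qed

lemma cantor_phi_mean:
  assumes "\<And>\<zeta>. cmod \<zeta> \<le> 1 \<Longrightarrow> a + \<zeta> * b \<notin> complex_K"
  shows "circle_mean (\<lambda>t. cantor_phi (Some (a + b * cis t))) = cantor_phi (Some a)"
proof -
  have "has_bochner_integral circle_measure (\<lambda>t. - log_potential cantor_mu (a + b * cis t))
    (- (2 * pi * log_potential cantor_mu a))"
    by (intro has_bochner_integral_minus log_potential_mean assms)
  then show ?thesis
    by (subst circle_mean_ereal[where u = "\<lambda>t. - log_potential cantor_mu (a + b * cis t)"])
       (auto simp: cantor_phi_def has_bochner_integral_iff)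
qed

text \<open>The inverse of the chart at infinity.\<close>

definition invert :: "complex \<Rightarrow> complex option" where
  "invert \<zeta> = (if \<zeta> = 0 then None else Some (1 / \<zeta>))"

text \<open>At \<open>a = 0\<close> the value is \<open>- \<infinity>\<close>.  Elsewhere the harmonic part contributes an equality, and the
  logarithm an inequality that is strict when \<open>0\<close> is an interior point of the disc.\<close>

lemma cantor_phi_submean_at_infinity:
  assumes disc: "\<And>\<zeta>. cmod \<zeta> \<le> 1 \<Longrightarrow> a + \<zeta> * b = 0 \<or> 1 / (a + \<zeta> * b) \<notin> complex_K"
  shows "cantor_phi (invert a) \<le> circle_mean (\<lambda>t. cantor_phi (invert (a + b * cis t)))"
proof (cases "a = 0")
  case True
  then show ?thesis by (simp add: invert_def cantor_phi_def)
next
  case False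
  let ?u = "\<lambda>t. ln (cmod (a + b * cis t)) - inverted_potential (a + b * cis t)"
  note V = inverted_potential_mean[OF disc]
  note log = log_circle_mean_ge[OF False, of b]
  have phi: "cantor_phi (invert (a + \<zeta> * b)) = ereal (ln (cmod (a + \<zeta> * b)) - inverted_potential (a + \<zeta> * b))"
    if "a + \<zeta> * b \<noteq> 0" "cmod \<zeta> \<le> 1" for \<zeta>
    using disc[OF that(2)] that log_potential_inverse[OF that(1)] by (auto simp: invert_def cantor_phi_def)
  have u: "integrable circle_measure ?u"
    using V log(1) by (intro Bochner_Integration.integrable_diff) (auto simp: has_bochner_integral_iff)
  have mean: "circle_mean (\<lambda>t. cantor_phi (invert (a + b * cis t))) = ereal ((\<integral>t. ?u t \<partial>circle_measure) / (2 * pi))"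
  proof (rule circle_mean_ereal[OF u])
    show "AE t in circle_measure. cantor_phi (invert (a + b * cis t)) = ereal (?u t)"
      using AE_circle_nonzero[OF False, of b]
    proof eventually_elim
      case (elim t)
      then show ?case using phi[of "cis t"] by (simp add: mult.commute)
    qed
  qed
  have "2 * pi * (ln (cmod a) - inverted_potential a) \<le> (\<integral>t. ?u t \<partial>circle_measure)"
    using V log by (subst Bochner_Integration.integral_diff) (auto simp: has_bochner_integral_iff right_diff_distrib)
  then have "ln (cmod a) - inverted_potential a \<le> (\<integral>t. ?u t \<partial>circle_measure) / (2 * pi)"
    by (simp add: field_simps)
  then show ?thesis
    unfolding mean using phi[of 0] False by simp
qed

lemma norm_square_circle_mean:
  "has_bochner_integral circle_measure (\<lambda>t. (cmod (a + of_real r * cis t))\<^sup>2) (2 * pi * ((cmod a)\<^sup>2 + r\<^sup>2))"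
proof -
  have 1: "has_bochner_integral circle_measure (\<lambda>t. Re (2 * of_real r * cnj a * cis t)) (2 * pi * Re (2 * of_real r * cnj a * 0))"
    by (rule holomorphic_circle_mean[of "\<lambda>z. 2 * of_real r * cnj a * z" 2]) (auto intro!: holomorphic_intros)
  have 2: "has_bochner_integral circle_measure (\<lambda>t. (cmod a)\<^sup>2 + r\<^sup>2) (2 * pi * ((cmod a)\<^sup>2 + r\<^sup>2))"
    by (simp add: has_bochner_integral_iff space_circle_measure measure_circle_measure)
  have "(cmod (a + of_real r * cis t))\<^sup>2 = ((cmod a)\<^sup>2 + r\<^sup>2) + Re (2 * of_real r * cnj a * cis t)" for t
  proof -
    have "(cmod (a + of_real r * cis t))\<^sup>2 = (Re a + r * cos t)\<^sup>2 + (Im a + r * sin t)\<^sup>2"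
      by (simp add: cmod_power2)
    also have "\<dots> = (((Re a)\<^sup>2 + (Im a)\<^sup>2) + r\<^sup>2 * ((sin t)\<^sup>2 + (cos t)\<^sup>2)) + Re (2 * of_real r * cnj a * cis t)"
      by (simp add: power2_eq_square algebra_simps del: sin_cos_squared_add sin_cos_squared_add2 sin_cos_squared_add3)
    finally show ?thesis by (simp add: cmod_power2)
  qed
  then show ?thesis using has_bochner_integral_add[OF 2 1] by simp
qed

text \<open>Within the length of stage \<open>n + 1\<close> the bound of \<open>le_minus_log_potential\<close> is at least
  \<open>(2 ^ n - 2) * ln 2\<close>.\<close>

lemma cantor_phi_large_near_K:
  obtains e where "0 < e" "\<And>z w. z \<notin> complex_K \<Longrightarrow> w \<in> cantor_K \<Longrightarrow> dist z (of_real w) < e \<Longrightarrow>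
    C \<le> - log_potential cantor_mu z"
proof -
  obtain n where n: "(C + 2 * ln 2) / ln 2 < 2 ^ n"
    using real_arch_pow[of 2 "(C + 2 * ln 2) / ln 2"] by auto
  define l where "l = stage_len (Suc n)"
  have l: "0 < l" "4 * l \<le> 1" using stage_len_pos stage_len_Suc_le[of n] stage_len_le_1[of n] by (auto simp: l_def intro: order.trans)
  have ln_l: "ln l = - (4 ^ n * ln 4)" by (simp add: l_def stage_len_Suc ln_realpow ln_div)
  show ?thesis
  proof (rule that)
    fix z :: complex and w assume z: "z \<notin> complex_K" and w: "w \<in> cantor_K" and zw: "dist z (of_real w) < l"
    obtain a b where J: "(a, b) \<in> cantor_intervals (Suc n)" "w \<in> {a..b}" using cantor_K_interval[OF w] by blast
    have "ln (1 / (2 * l)) / 2 ^ Suc n - ln 2 \<le> - log_potential cantor_mu z"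
    proof (rule le_minus_log_potential[OF z J(1)])
      fix v assume v: "v \<in> cantor_K"
      have tri: "dist z (of_real v) \<le> dist z (of_real w) + dist w v"
        using dist_triangle[of z "of_real v" "of_real w"] by (simp add: dist_of_real)
      show "dist z (of_real v) \<le> 2 * l" if "v \<in> {a..b}"
        using tri zw that J(2) cantor_interval_length[OF J(1)] by (auto simp: dist_real_def l_def)
      have "w \<in> {0..1}" "v \<in> {0..1}" using v w cantor_K_subset by blast+
      then have "dist w v \<le> 1" by (auto simp: dist_real_def abs_if)
      then show "dist z (of_real v) \<le> 2" using tri zw l by simp
    qed (use l in auto)
    moreover have "C \<le> ln (1 / (2 * l)) / 2 ^ Suc n - ln 2"
    proof -
      have ln4: "ln 4 = 2 * ln (2::real)" using ln_realpow[of 2 2] by simp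
      have "C \<le> 2 ^ n * ln 2 - 2 * ln 2" using n by (simp add: pos_divide_less_eq)
      also have "\<dots> \<le> (2 ^ n * ln 2 - ln 2 / 2 ^ Suc n) - ln 2"
      proof -
        have "ln 2 / 2 ^ Suc n \<le> ln 2 / (1::real)" by (intro divide_left_mono) (auto intro: one_le_power simp del: power_Suc)
        then show ?thesis by simp
      qed
      also have "\<dots> = ln (1 / (2 * l)) / 2 ^ Suc n - ln 2"
      proof -
        have "(4::real) ^ n = 2 ^ n * 2 ^ n" by (simp add: power_mult_distrib[symmetric])
        moreover have "ln (1 / (2 * l)) = 4 ^ n * (2 * ln 2) - ln 2"
          using l(1) ln_l by (simp add: ln_div ln_mult ln4)
        ultimately show ?thesis by (simp add: diff_divide_distrib)
      qed
      finally show ?thesis .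
    qed
    ultimately show "C \<le> - log_potential cantor_mu z" by linarith
  qed (rule l)
qed

section \<open>The domain as an open subset of the sphere\<close>

lemma topspace_sphere: "topspace sphere_topology = UNIV"
  using notin_range_Some by (auto simp: sphere_topology_def)

lemma topspace_cantor_X: "topspace cantor_X = insert None (Some ` (- complex_K))"
proof -
  have "x = None \<or> x \<in> range Some" for x :: "complex option" by (cases x) auto
  then show ?thesis by (auto simp: cantor_X_def topspace_sphere image_iff)
qed

lemma Some_in_topspace [simp]: "Some z \<in> topspace cantor_X \<longleftrightarrow> z \<notin> complex_K"
  and None_in_topspace [simp]: "None \<in> topspace cantor_X"
  by (auto simp: topspace_cantor_X)

lemma openin_sphere:
  "openin sphere_topology V \<longleftrightarrow> open (Some -` V) \<and> (None \<in> V \<longrightarrow> compact (- (Some -` V)))"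
proof
  assume "openin sphere_topology V"
  then consider U where "open U" "V = Some ` U" | C where "compact C" "V = insert None (Some ` (- C))"
    unfolding sphere_topology_def openin_Alexandroff_compactification
    by (auto simp: Compl_eq_Diff_UNIV)
  then show "open (Some -` V) \<and> (None \<in> V \<longrightarrow> compact (- (Some -` V)))"
  proof cases
    case 1
    then show ?thesis by (simp add: inj_vimage_image_eq)
  next
    case 2
    then have "Some -` V = - C" by auto
    with 2 show ?thesis by (simp add: compact_imp_closed open_Compl)
  qed
next
  assume V: "open (Some -` V) \<and> (None \<in> V \<longrightarrow> compact (- (Some -` V)))"
  show "openin sphere_topology V"
  proof (cases "None \<in> V")
    case True
    have "x \<in> V \<longleftrightarrow> x \<in> insert None (Some ` (- (- (Some -` V))))" for x
      using True by (cases x) auto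
    then have "V = insert None (Some ` (UNIV - (- (Some -` V))))"
      unfolding Compl_eq_Diff_UNIV[symmetric] by (rule set_eqI)
    then have "V = insert None (Some ` (topspace euclidean - (- (Some -` V))))"
      by (simp only: topspace_euclidean)
    moreover have "compactin euclidean (- (Some -` V))" "closedin euclidean (- (Some -` V))"
      using V True by (simp_all add: closed_Compl)
    ultimately show ?thesis
      unfolding sphere_topology_def openin_Alexandroff_compactification by blast
  next
    case False
    have "x \<in> V \<longleftrightarrow> x \<in> Some ` (Some -` V)" for x
      using False by (cases x) auto
    then have "V = Some ` (Some -` V)" by blast
    then show ?thesis
      unfolding sphere_topology_def openin_Alexandroff_compactification using V by auto
  qed
qed

lemma openin_sphere_topspace: "openin sphere_topology (topspace cantor_X)"
proof -
  have "Some -` topspace cantor_X = - complex_K" by auto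
  then show ?thesis unfolding openin_sphere using compact_complex_K open_Compl_complex_K by simp
qed

lemma cantor_X_eq: "cantor_X = subtopology sphere_topology (topspace cantor_X)"
  by (simp add: cantor_X_def topspace_sphere)

lemma openin_cantor_X:
  "openin cantor_X V \<longleftrightarrow> V \<subseteq> topspace cantor_X \<and> open (Some -` V) \<and> (None \<in> V \<longrightarrow> compact (- (Some -` V)))"
proof -
  have "openin cantor_X V \<longleftrightarrow> openin sphere_topology V \<and> V \<subseteq> topspace cantor_X"
    by (subst cantor_X_eq) (rule openin_open_subtopology[OF openin_sphere_topspace])
  then show ?thesis by (auto simp: openin_sphere)
qed

lemma compactin_cantor_X: "compactin cantor_X L \<longleftrightarrow> compactin sphere_topology L \<and> L \<subseteq> topspace cantor_X"
  by (subst cantor_X_eq) (rule compactin_subtopology)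

lemma Hausdorff_sphere: "Hausdorff_space sphere_topology"
  unfolding sphere_topology_def Hausdorff_space_Alexandroff_compactification
  by (simp add: locally_compact_space_euclidean)

lemma Hausdorff_cantor_X: "Hausdorff_space cantor_X"
  by (simp add: cantor_X_def Hausdorff_space_subtopology Hausdorff_sphere)

text \<open>These sets form a compact exhaustion of the domain: they are closed in the sphere, and by
  \<open>compactin_subset_away_from_K\<close> every compact set lies in one of them.\<close>

definition away_from_K :: "real \<Rightarrow> complex option set" where
  "away_from_K e = insert None (Some ` {z. \<forall>w\<in>cantor_K. e \<le> dist z (of_real w)})"

lemma Some_in_away [simp]: "Some z \<in> away_from_K e \<longleftrightarrow> (\<forall>w\<in>cantor_K. e \<le> dist z (of_real w))"
  and None_in_away [simp]: "None \<in> away_from_K e"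
  by (auto simp: away_from_K_def)

lemma compactin_away_from_K:
  assumes "0 < e"
  shows "compactin cantor_X (away_from_K e)"
  unfolding compactin_cantor_X
proof
  have "Some -` (- away_from_K e) = (\<Union>w\<in>cantor_K. ball (of_real w) e)"
    by (auto simp: dist_commute not_le)
  then have "openin sphere_topology (- away_from_K e)"
    by (simp add: openin_sphere open_UN)
  then have "closedin sphere_topology (away_from_K e)"
    by (simp add: closedin_def topspace_sphere Compl_eq_Diff_UNIV)
  then show "compactin sphere_topology (away_from_K e)"
    by (intro closedin_compact_space) (simp_all add: sphere_topology_def)
  show "away_from_K e \<subseteq> topspace cantor_X"
    using assms by (auto simp: away_from_K_def topspace_cantor_X) force
qed

text \<open>A compact subset is closed in the sphere, so it has positive distance from the compact Cantor set.\<close>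

lemma compactin_subset_away_from_K:
  assumes L: "compactin cantor_X L"
  obtains e where "0 < e" "L \<subseteq> away_from_K e"
proof -
  have "closedin sphere_topology L"
    using L Hausdorff_sphere compactin_imp_closedin unfolding compactin_cantor_X by blast
  then have "openin sphere_topology (- L)"
    by (simp add: closedin_def topspace_sphere Compl_eq_Diff_UNIV)
  then have "closed (Some -` L)"
    by (simp add: openin_sphere vimage_Compl closed_def)
  moreover have "complex_K \<inter> Some -` L = {}"
    using L unfolding compactin_cantor_X by auto
  ultimately have "\<exists>d>0. \<forall>x\<in>complex_K. \<forall>y\<in>Some -` L. d \<le> dist x y"
    by (rule separate_compact_closed[OF compact_complex_K])
  then obtain d where d: "0 < d" "\<forall>x\<in>complex_K. \<forall>y\<in>Some -` L. d \<le> dist x y" by blast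
  have "p \<in> away_from_K d" if "p \<in> L" for p
    using that d(2) by (cases p) (auto simp: dist_commute)
  with d(1) show ?thesis using that by blast
qed

lemma compactin_closed_subset:
  assumes "closedin cantor_X L" "L \<subseteq> away_from_K e" "0 < e"
  shows "compactin cantor_X L"
  using closed_compactin[OF compactin_away_from_K[OF assms(3)] assms(2,1)] .

lemma continuous_map_cantor_X:
  fixes F :: "complex option \<Rightarrow> 'b::topological_space"
  assumes cont: "continuous_on (- complex_K) (\<lambda>z. F (Some z))"
    and lim: "((\<lambda>z. F (Some z)) \<longlongrightarrow> F None) at_infinity"
  shows "continuous_map cantor_X euclidean F"
  unfolding continuous_map_def
proof (intro conjI allI impI)
  fix W :: "'b set" assume "openin euclidean W"
  then have W: "open W" by simp
  let ?V = "{p \<in> topspace cantor_X. F p \<in> W}"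
  have eq: "Some -` ?V = (\<lambda>z. F (Some z)) -` W \<inter> (- complex_K)" by auto
  have op: "open (Some -` ?V)"
    unfolding eq by (rule continuous_open_preimage[OF cont open_Compl_complex_K W, unfolded Int_commute[of "- complex_K"]])
  moreover have "compact (- (Some -` ?V))" if "None \<in> ?V"
  proof -
    have "\<forall>\<^sub>F z in at_infinity. F (Some z) \<in> W"
      using topological_tendstoD[OF lim W] that by simp
    then obtain B where B: "\<And>z. B \<le> norm z \<Longrightarrow> F (Some z) \<in> W"
      unfolding eventually_at_infinity by blast
    have "- (Some -` ?V) \<subseteq> cball 0 B \<union> complex_K"
      using B by (auto simp: not_le[symmetric])
    then have "bounded (- (Some -` ?V))"
      using bounded_subset compact_imp_bounded[OF compact_complex_K] bounded_cball bounded_Un by metis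
    with op show ?thesis by (simp add: compact_eq_bounded_closed closed_def)
  qed
  ultimately show "openin cantor_X ?V" by (auto simp: openin_cantor_X)
qed simp

text \<open>Finite points inherit a basis from the plane; at infinity the complements of discs of
  integral radius are cofinal among the neighbourhoods.\<close>

lemma second_countable_sphere: "second_countable sphere_topology"
proof -
  obtain B :: "complex set set" where B: "countable B" "\<And>b. b \<in> B \<Longrightarrow> open b"
    "\<And>U. open U \<Longrightarrow> \<exists>B'\<subseteq>B. U = \<Union>B'"
    using ex_countable_basis[where 'a = complex] unfolding topological_basis_def by metis
  let ?B = "(\<lambda>b. Some ` b) ` B \<union> range (\<lambda>n::nat. insert None (Some ` (- cball 0 (real n))))"
  show ?thesis
    unfolding second_countable_def
  proof (intro exI[of _ ?B] conjI ballI allI impI)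
    show "countable ?B" using B(1) by auto
    fix V assume "V \<in> ?B"
    then consider b where "b \<in> B" "V = Some ` b" | n :: nat where "V = insert None (Some ` (- cball 0 (real n)))" by blast
    then show "openin sphere_topology V"
    proof cases
      case 1
      then show ?thesis using B(2)[of b] by (auto simp: openin_sphere inj_vimage_image_eq)
    next
      case 2
      then have "Some -` V = - cball 0 (real n)" by auto
      then show ?thesis by (simp add: openin_sphere open_Compl)
    qed
  next
    fix U x assume "openin sphere_topology U \<and> x \<in> U"
    then have U: "open (Some -` U)" "None \<in> U \<Longrightarrow> compact (- (Some -` U))" and x: "x \<in> U"
      by (auto simp: openin_sphere)
    show "\<exists>V\<in>?B. x \<in> V \<and> V \<subseteq> U"
    proof (cases x)
      case None
      then have "bounded (- (Some -` U))" using U(2) x compact_imp_bounded by auto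
      then obtain r where "\<And>z. z \<in> - (Some -` U) \<Longrightarrow> norm z \<le> r" unfolding bounded_iff by blast
      moreover obtain n :: nat where "r \<le> real n" using real_arch_simple by blast
      ultimately have "insert None (Some ` (- cball 0 (real n))) \<subseteq> U"
        using None x by (force simp: not_le)
      then show ?thesis
        using None by (intro bexI[of _ "insert None (Some ` (- cball 0 (real n)))"] UnI2 rangeI) simp
    next
      case (Some z)
      obtain B' where "B' \<subseteq> B" "Some -` U = \<Union>B'" using B(3)[OF U(1)] by blast
      moreover have "z \<in> Some -` U" using x Some by simp
      ultimately obtain b where "b \<in> B" "z \<in> b" "b \<subseteq> Some -` U" by blast
      then show ?thesis using Some by (intro bexI[of _ "Some ` b"] UnI1 imageI) auto
    qed
  qed
qed

lemma second_countable_cantor_X: "second_countable cantor_X"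
  unfolding cantor_X_def by (rule second_countable_subtopology[OF second_countable_sphere])

section \<open>Holomorphic functions in the two charts\<close>

text \<open>In dimension one a complex linear derivative is multiplication by a number.\<close>

lemma holomorphic_SCV_1_iff:
  fixes F :: "complex ^ 1 \<Rightarrow> complex"
  assumes S: "open S" and F: "\<And>x. x $ 1 \<in> S \<Longrightarrow> F x = g (x $ 1)"
  shows "holomorphic_SCV {x. x $ 1 \<in> S} F \<longleftrightarrow> g holomorphic_on S"
proof
  assume L: "holomorphic_SCV {x. x $ 1 \<in> S} F"
  have "g field_differentiable at z" if z: "z \<in> S" for z
  proof -
    obtain f' where f': "(F has_derivative f') (at (vec z))" "\<And>c v. f' (c *s v) = c * f' v"
    proof -
      have "vec z \<in> {x :: complex ^ 1. x $ 1 \<in> S}" using z by simp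
      with L show ?thesis using that unfolding holomorphic_SCV_def by blast
    qed
    have lin: "(vec has_derivative (vec :: complex \<Rightarrow> complex ^ 1)) (at z)"
      by (intro bounded_linear_imp_has_derivative)
         (auto intro!: bounded_linearI' simp: vec_eq_iff)
    have "((\<lambda>c. F (vec c)) has_derivative (\<lambda>c. f' (vec c))) (at z)"
      by (rule has_derivative_compose[OF lin f'(1)])
    moreover have "f' (vec c) = f' (vec 1) * c" for c
      using f'(2)[of c "vec 1"] by (simp add: vector_scalar_mult_def vec_def mult.commute)
    ultimately have "((\<lambda>c. F (vec c)) has_field_derivative f' (vec 1)) (at z)"
      by (simp add: has_field_derivative_def)
    then have "(g has_field_derivative f' (vec 1)) (at z)"
      by (rule DERIV_cong_ev[THEN iffD1, OF refl _ refl, rotated])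
         (use F S z in \<open>auto simp: eventually_nhds intro!: exI[of _ S]\<close>)
    then show ?thesis by (auto simp: field_differentiable_def)
  qed
  then show "g holomorphic_on S"
    using S holomorphic_on_open field_differentiable_def by blast
next
  assume R: "g holomorphic_on S"
  show "holomorphic_SCV {x. x $ 1 \<in> S} F"
    unfolding holomorphic_SCV_def
  proof
    fix x :: "complex ^ 1" assume x: "x \<in> {x. x $ 1 \<in> S}"
    then obtain d where "(g has_field_derivative d) (at (x $ 1))"
      using R S unfolding holomorphic_on_open[OF S] by auto
    then have g: "(g has_derivative (\<lambda>h. d * h)) (at (x $ 1))" by (simp add: has_field_derivative_def)
    have nth: "((\<lambda>v::complex ^ 1. v $ 1) has_derivative (\<lambda>v. v $ 1)) (at x)"
      by (intro bounded_linear_imp_has_derivative bounded_linear_vec_nth)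
    have "((\<lambda>v. g (v $ 1)) has_derivative (\<lambda>v. d * v $ 1)) (at x)"
      by (rule has_derivative_compose[OF nth g])
    moreover have "open {x :: complex ^ 1. x $ 1 \<in> S}"
      using open_vimage[OF S, of "\<lambda>x::complex ^ 1. x $ 1"] by (simp add: vimage_def continuous_on_component)
    ultimately have "(F has_derivative (\<lambda>v. d * v $ 1)) (at x)"
      by (rule has_derivative_transform_within_open) (use x F in auto)
    then show "\<exists>f'. (F has_derivative f') (at x) \<and> (\<forall>c v. f' (c *s v) = c * f' v)"
      by (intro exI[of _ "\<lambda>v :: complex ^ 1. d * v $ 1"]) (auto simp: vector_scalar_mult_def)
  qed
qed

definition chart0 :: "complex option \<Rightarrow> complex ^ 1" where
  "chart0 p = vec (the p)"

definition chart1 :: "complex option \<Rightarrow> complex ^ 1" where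
  "chart1 p = (case p of None \<Rightarrow> vec 0 | Some z \<Rightarrow> vec (1 / z))"

lemma chart0_component [simp]: "chart0 (Some z) $ i = z"
  by (simp add: chart0_def)

lemma chart1_component [simp]: "chart1 None $ i = 0" "chart1 (Some z) $ i = 1 / z"
  by (simp_all add: chart1_def)

text \<open>The domain of the first chart.  The second chart is defined on the whole domain, as the origin
  belongs to the Cantor set.\<close>

definition finite_part :: "complex option set" where
  "finite_part = Some ` (- complex_K)"

definition inverted_domain :: "complex set" where
  "inverted_domain = {\<zeta>. \<zeta> = 0 \<or> 1 / \<zeta> \<notin> complex_K}"

lemma zero_in_complex_K: "0 \<in> complex_K"
  using zero_in_cantor_K by force

lemma cantor_X_atlas_eq: "cantor_X_atlas = {(finite_part, chart0), (topspace cantor_X, chart1)}"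
proof -
  have "range Some \<inter> topspace cantor_X = finite_part"
    by (auto simp: finite_part_def)
  moreover have "(UNIV - {Some 0}) \<inter> topspace cantor_X = topspace cantor_X"
    using zero_in_complex_K by (auto simp: topspace_cantor_X)
  moreover have "(\<lambda>p. vec (the p)) = chart0"
    "(\<lambda>p. case p of None \<Rightarrow> vec 0 | Some z \<Rightarrow> vec (1 / z)) = chart1"
    unfolding chart0_def[abs_def] chart1_def[abs_def] by (rule refl)+
  ultimately show ?thesis
    unfolding cantor_X_atlas_def restrict_atlas_def sphere_atlas_def
    by (simp only: image_insert image_empty case_prod_conv)
qed

lemma index_1: "(x :: complex ^ 1) $ i = x $ 1"
  by (simp add: num1_eq_iff[THEN iffD2, of i 1])

lemma vec_1_eq: "(vec ((x :: complex ^ 1) $ 1) :: complex ^ 1) = x"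
  by (simp add: vec_eq_iff)

lemma chart0_image: "chart0 ` Some ` S = {x. x $ 1 \<in> S}"
proof (intro equalityI subsetI)
  fix x :: "complex ^ 1" assume "x \<in> {x. x $ 1 \<in> S}"
  moreover have "x = chart0 (Some (x $ 1))" by (simp add: vec_eq_iff)
  ultimately show "x \<in> chart0 ` Some ` S" by blast
qed auto

lemma inj_chart0: "inj_on chart0 (Some ` S)"
  by (rule inj_on_inverseI[of _ "\<lambda>x :: complex ^ 1. Some (x $ 1)"]) auto

lemma chart1_invert: "chart1 (invert \<zeta>) = vec \<zeta>"
  by (simp add: invert_def vec_eq_iff)

lemma invert_chart1: "p \<in> topspace cantor_X \<Longrightarrow> invert (chart1 p $ 1) = p"
  using zero_in_complex_K by (cases p) (auto simp: invert_def)

lemma invert_in_topspace: "invert \<zeta> \<in> topspace cantor_X \<longleftrightarrow> \<zeta> \<in> inverted_domain"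
  by (simp add: invert_def inverted_domain_def)

lemma chart1_image:
  assumes "V \<subseteq> topspace cantor_X"
  shows "chart1 ` V = {x. invert (x $ 1) \<in> V}"
proof (intro equalityI subsetI)
  fix x :: "complex ^ 1" assume "x \<in> chart1 ` V"
  then obtain p where "p \<in> V" "x = chart1 p" by blast
  then show "x \<in> {x. invert (x $ 1) \<in> V}" using invert_chart1[of p] assms by auto
next
  fix x :: "complex ^ 1" assume "x \<in> {x. invert (x $ 1) \<in> V}"
  then have "invert (x $ 1) \<in> V" by simp
  moreover have "x = chart1 (invert (x $ 1))" unfolding chart1_invert vec_1_eq ..
  ultimately show "x \<in> chart1 ` V" by (rule rev_image_eqI)
qed

lemma inj_chart1: "inj_on chart1 (topspace cantor_X)"
  by (rule inj_on_inverseI[of _ "\<lambda>x :: complex ^ 1. invert (x $ 1)"]) (rule invert_chart1)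

lemma inv_chart0:
  fixes x :: "complex ^ 1"
  assumes "x $ 1 \<in> - complex_K"
  shows "inv_into finite_part chart0 x = Some (x $ 1)"
  using inv_into_f_f[OF inj_chart0[of "- complex_K"], of "Some (x $ 1)"] assms
  by (simp add: finite_part_def chart0_def vec_1_eq)

lemma inv_chart1:
  fixes x :: "complex ^ 1"
  assumes "x $ 1 \<in> inverted_domain"
  shows "inv_into (topspace cantor_X) chart1 x = invert (x $ 1)"
  using inv_into_f_f[OF inj_chart1, of "invert (x $ 1)"] assms
  by (simp add: invert_in_topspace chart1_invert vec_1_eq)

lemma open_vimage_invert:
  assumes "openin cantor_X V"
  shows "open {\<zeta>. invert \<zeta> \<in> V}"
proof -
  let ?A = "{\<zeta>. \<zeta> \<noteq> 0 \<and> Some (1 / \<zeta>) \<in> V}"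
  have V: "open (Some -` V)" "None \<in> V \<Longrightarrow> compact (- (Some -` V))"
    using assms by (auto simp: openin_cantor_X)
  have "continuous_on (- {0}) (\<lambda>\<zeta>::complex. 1 / \<zeta>)"
    by (intro continuous_intros) auto
  then have "open (- {0} \<inter> (\<lambda>\<zeta>. 1 / \<zeta>) -` (Some -` V))"
    by (rule continuous_open_preimage[OF _ _ V(1)]) auto
  also have "- {0} \<inter> (\<lambda>\<zeta>. 1 / \<zeta>) -` (Some -` V) = ?A" by auto
  finally have A: "open ?A" .
  show ?thesis
  proof (cases "None \<in> V")
    case True
    obtain B where B: "0 < B" "\<And>z. z \<in> - (Some -` V) \<Longrightarrow> norm z \<le> B"
      using compact_imp_bounded[OF V(2)[OF True]] unfolding bounded_pos by blast
    have "invert \<zeta> \<in> V" if "\<zeta> \<in> ball 0 (1 / B)" for \<zeta>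
    proof (cases "\<zeta> = 0")
      case False
      have "norm (1 / \<zeta>) > B" using that False B(1) by (simp add: norm_divide field_simps)
      then show ?thesis using B(2)[of "1 / \<zeta>"] False by (auto simp: invert_def)
    qed (use True in \<open>simp add: invert_def\<close>)
    moreover have "invert \<zeta> \<in> V \<longleftrightarrow> \<zeta> \<in> ?A \<union> {0}" for \<zeta>
      using True by (simp add: invert_def)
    ultimately have "{\<zeta>. invert \<zeta> \<in> V} = ?A \<union> ball 0 (1 / B)"
      using B(1) by fastforce
    then show ?thesis using A by (simp add: open_Un)
  next
    case False
    then have "{\<zeta>. invert \<zeta> \<in> V} = ?A" by (auto simp: invert_def)
    then show ?thesis using A by simp
  qed
qed

lemma inverted_domain_eq: "inverted_domain = {\<zeta>. invert \<zeta> \<in> topspace cantor_X}"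
  by (simp add: invert_in_topspace)

lemma open_inverted_domain: "open inverted_domain"
  unfolding inverted_domain_eq by (rule open_vimage_invert) simp

lemma openin_finite_part: "openin cantor_X finite_part"
proof -
  have "Some -` finite_part = - complex_K" by (auto simp: finite_part_def)
  moreover have "None \<notin> finite_part" by (auto simp: finite_part_def)
  ultimately show ?thesis
    using open_Compl_complex_K by (auto simp: openin_cantor_X finite_part_def)
qed

lemma open_Collect_component: "open S \<Longrightarrow> open {x :: complex ^ 1. x $ 1 \<in> S}"
  using open_vimage[of S "\<lambda>x::complex ^ 1. x $ 1"] by (simp add: vimage_def continuous_on_component)

lemma continuous_on_vec: "continuous_on A (vec :: complex \<Rightarrow> complex ^ 1)"
  unfolding vec_def by (intro continuous_on_vec_lambda continuous_intros)

lemma homeomorphic_chart: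
  fixes h :: "'a \<Rightarrow> 'b::topological_space"
  assumes U: "openin T U" and inj: "inj_on h U"
    and cont: "\<And>W. open W \<Longrightarrow> openin T {p \<in> U. h p \<in> W}"
    and op: "\<And>V. openin T V \<Longrightarrow> V \<subseteq> U \<Longrightarrow> open (h ` V)"
  shows "openin T U \<and> open (h ` U) \<and> homeomorphic_map (subtopology T U) (top_of_set (h ` U)) h"
proof (intro conjI U op order_refl bijective_open_imp_homeomorphic_map)
  have top: "topspace (subtopology T U) = U" using openin_subset[OF U] by auto
  then show "h ` topspace (subtopology T U) = topspace (top_of_set (h ` U))" by simp
  show "inj_on h (topspace (subtopology T U))" using inj top by simp
  show "continuous_map (subtopology T U) (top_of_set (h ` U)) h"
    unfolding continuous_map_in_subtopology
  proof
    show "continuous_map (subtopology T U) euclidean h"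
      unfolding continuous_map_def top
    proof (intro conjI allI impI)
      fix W :: "'b set" assume "openin euclidean W"
      then show "openin (subtopology T U) {p \<in> U. h p \<in> W}"
        using cont[of W] openin_open_subtopology[OF U] by auto
    qed simp
    show "h \<in> topspace (subtopology T U) \<rightarrow> h ` U" using top by auto
  qed
  show "open_map (subtopology T U) (top_of_set (h ` U)) h"
    unfolding open_map_def
  proof (intro allI impI)
    fix V assume "openin (subtopology T U) V"
    then have "openin T V" "V \<subseteq> U" using openin_open_subtopology[OF U] by auto
    then have "open (h ` V)" "h ` V \<subseteq> h ` U" using op by auto
    then show "openin (top_of_set (h ` U)) (h ` V)"
      by (simp add: open_subset)
  qed
qed

lemma chart0_homeomorphic:
  "openin cantor_X finite_part \<and> open (chart0 ` finite_part) \<and>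
   homeomorphic_map (subtopology cantor_X finite_part) (top_of_set (chart0 ` finite_part)) chart0"
proof (rule homeomorphic_chart[OF openin_finite_part])
  show "inj_on chart0 finite_part" unfolding finite_part_def by (rule inj_chart0)
  fix W :: "(complex ^ 1) set" assume W: "open W"
  have "Some -` {p \<in> finite_part. chart0 p \<in> W} = vec -` W \<inter> (- complex_K)"
    by (auto simp: finite_part_def chart0_def)
  moreover have "open (vec -` W :: complex set)" by (rule open_vimage[OF W continuous_on_vec])
  ultimately show "openin cantor_X {p \<in> finite_part. chart0 p \<in> W}"
    using open_Compl_complex_K by (auto simp: openin_cantor_X finite_part_def open_Int)
next
  fix V assume V: "openin cantor_X V" "V \<subseteq> finite_part"
  then have "Some ` (Some -` V) = V" by (auto simp: finite_part_def)
  with chart0_image[of "Some -` V"] have "chart0 ` V = {x. x $ 1 \<in> Some -` V}" by (simp only:)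
  moreover have "open (Some -` V)" using V(1) by (simp add: openin_cantor_X)
  ultimately show "open (chart0 ` V)" using open_Collect_component by metis
qed

lemma continuous_map_chart1: "continuous_map cantor_X euclidean chart1"
proof (rule continuous_map_cantor_X)
  have "z \<noteq> 0" if "z \<in> - complex_K" for z using that zero_in_complex_K by auto
  then show "continuous_on (- complex_K) (\<lambda>z. chart1 (Some z))"
    unfolding chart1_def by (auto intro!: continuous_on_compose2[OF continuous_on_vec[of UNIV]] continuous_intros)
  have "((\<lambda>z::complex. 1 / z) \<longlongrightarrow> 0) at_infinity"
    using tendsto_inverse_0 by (simp add: inverse_eq_divide[symmetric])
  then have "((\<lambda>z. vec (1 / z) :: complex ^ 1) \<longlongrightarrow> vec 0) at_infinity"
    unfolding vec_def by (intro tendsto_vec_lambda)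
  then show "((\<lambda>z. chart1 (Some z)) \<longlongrightarrow> chart1 None) at_infinity"
    by (simp add: chart1_def)
qed

lemma chart1_homeomorphic:
  "openin cantor_X (topspace cantor_X) \<and> open (chart1 ` topspace cantor_X) \<and>
   homeomorphic_map (subtopology cantor_X (topspace cantor_X)) (top_of_set (chart1 ` topspace cantor_X)) chart1"
proof (rule homeomorphic_chart[OF openin_topspace inj_chart1])
  fix W :: "(complex ^ 1) set" assume W: "open W"
  then show "openin cantor_X {p \<in> topspace cantor_X. chart1 p \<in> W}"
    using continuous_map_chart1 unfolding continuous_map_def by auto
next
  fix V assume V: "openin cantor_X V" "V \<subseteq> topspace cantor_X"
  show "open (chart1 ` V)"
    using open_Collect_component[OF open_vimage_invert[OF V(1)]] by (simp add: chart1_image[OF V(2)])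
qed

lemma holo_fun_cantor_X_iff:
  "holo_fun cantor_X cantor_X_atlas f \<longleftrightarrow>
    (\<lambda>z. f (Some z)) holomorphic_on - complex_K \<and> (\<lambda>\<zeta>. f (invert \<zeta>)) holomorphic_on inverted_domain"
proof -
  have im: "chart0 ` finite_part = {x. x $ 1 \<in> - complex_K}"
    "chart1 ` topspace cantor_X = {x. x $ 1 \<in> inverted_domain}"
    unfolding finite_part_def chart0_image chart1_image[OF order_refl] invert_in_topspace by simp_all
  have "holomorphic_SCV {x. x $ 1 \<in> - complex_K} (\<lambda>x. f (inv_into finite_part chart0 x)) \<longleftrightarrow>
      (\<lambda>z. f (Some z)) holomorphic_on - complex_K"
    by (rule holomorphic_SCV_1_iff[OF open_Compl_complex_K]) (simp add: inv_chart0)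
  moreover have "holomorphic_SCV {x. x $ 1 \<in> inverted_domain} (\<lambda>x. f (inv_into (topspace cantor_X) chart1 x)) \<longleftrightarrow>
      (\<lambda>\<zeta>. f (invert \<zeta>)) holomorphic_on inverted_domain"
    by (rule holomorphic_SCV_1_iff[OF open_inverted_domain]) (simp add: inv_chart1)
  ultimately show ?thesis
    unfolding holo_fun_def cantor_X_atlas_eq by (simp add: im)
qed

lemma complex_manifold_cantor_X: "complex_manifold cantor_X cantor_X_atlas"
  unfolding complex_manifold_def
proof (intro conjI)
  show "Hausdorff_space cantor_X" by (rule Hausdorff_cantor_X)
  show "second_countable cantor_X" by (rule second_countable_cantor_X)
  have fp: "finite_part \<subseteq> topspace cantor_X" by (auto simp: finite_part_def)
  show "(\<Union>(U, h)\<in>cantor_X_atlas. U) = topspace cantor_X"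
    using fp by (auto simp: cantor_X_atlas_eq)
  show "\<forall>(U, h)\<in>cantor_X_atlas. openin cantor_X U \<and> open (h ` U) \<and>
      homeomorphic_map (subtopology cantor_X U) (top_of_set (h ` U)) h"
    using chart0_homeomorphic chart1_homeomorphic by (simp add: cantor_X_atlas_eq)
  let ?S = "- complex_K" and ?R = "{\<zeta>. \<zeta> \<noteq> 0 \<and> 1 / \<zeta> \<notin> complex_K}"
  have nz: "z \<noteq> 0" if "z \<notin> complex_K" for z using that zero_in_complex_K by auto
  have "{\<zeta>. invert \<zeta> \<in> finite_part} = ?R" by (auto simp: invert_def finite_part_def)
  then have im1: "chart1 ` finite_part = {x. x $ 1 \<in> ?R}" and R: "open ?R"
    using chart1_image[OF fp] open_vimage_invert[OF openin_finite_part] by auto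
  have im0: "chart0 ` finite_part = {x. x $ 1 \<in> ?S}" unfolding finite_part_def by (rule chart0_image)
  have im2: "chart1 ` topspace cantor_X = {x. x $ 1 \<in> inverted_domain}"
    unfolding chart1_image[OF order_refl] invert_in_topspace by simp
  have "holomorphic_SCV {x. x $ 1 \<in> ?S} (\<lambda>x. chart0 (inv_into finite_part chart0 x) $ i)" for i
    by (subst holomorphic_SCV_1_iff[where g = "\<lambda>z. z", OF open_Compl_complex_K])
       (auto simp: inv_chart0 chart0_def index_1[of _ i] intro: holomorphic_intros)
  moreover have "holomorphic_SCV {x. x $ 1 \<in> ?S} (\<lambda>x. chart1 (inv_into finite_part chart0 x) $ i)" for i
    by (subst holomorphic_SCV_1_iff[where g = "\<lambda>z. 1 / z", OF open_Compl_complex_K])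
       (auto simp: inv_chart0 index_1[of _ i] zero_in_complex_K intro!: holomorphic_intros nz)
  moreover have "holomorphic_SCV {x. x $ 1 \<in> ?R} (\<lambda>x. chart0 (inv_into (topspace cantor_X) chart1 x) $ i)" for i
    by (subst holomorphic_SCV_1_iff[where g = "\<lambda>z. 1 / z", OF R])
       (auto simp: inv_chart1 inverted_domain_def invert_def chart0_def index_1[of _ i] zero_in_complex_K intro!: holomorphic_intros)
  moreover have "holomorphic_SCV {x. x $ 1 \<in> inverted_domain}
      (\<lambda>x. chart1 (inv_into (topspace cantor_X) chart1 x) $ i)" for i
    by (subst holomorphic_SCV_1_iff[where g = "\<lambda>z. z", OF open_inverted_domain])
       (auto simp: inv_chart1 chart1_invert index_1[of _ i] intro: holomorphic_intros)
  moreover have "finite_part \<inter> topspace cantor_X = finite_part" "topspace cantor_X \<inter> finite_part = finite_part"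
    using fp by auto
  ultimately show "\<forall>(U, h)\<in>cantor_X_atlas. \<forall>(V, k)\<in>cantor_X_atlas. \<forall>i.
      holomorphic_SCV (h ` (U \<inter> V)) (\<lambda>x. k (inv_into U h x) $ i)"
    by (simp add: cantor_X_atlas_eq im0 im1 im2)
qed

section \<open>The domain is a Stein manifold\<close>

text \<open>This is continuity at \<open>0\<close> in the coordinate at infinity.\<close>

lemma holo_fun_tendsto_at_infinity:
  assumes "holo_fun cantor_X cantor_X_atlas f"
  shows "((\<lambda>z. f (Some z)) \<longlongrightarrow> f None) at_infinity"
proof -
  have "continuous_on inverted_domain (\<lambda>\<zeta>. f (invert \<zeta>))"
    using assms holomorphic_on_imp_continuous_on unfolding holo_fun_cantor_X_iff by blast
  moreover have "0 \<in> inverted_domain" by (simp add: inverted_domain_def)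
  ultimately have "isCont (\<lambda>\<zeta>. f (invert \<zeta>)) 0"
    using open_inverted_domain by (simp add: continuous_on_eq_continuous_at)
  from isCont_tendsto_compose[OF this tendsto_inverse_0]
  have lim: "((\<lambda>z. f (invert (inverse z))) \<longlongrightarrow> f None) at_infinity"
    by (simp add: invert_def)
  have "\<forall>\<^sub>F z::complex in at_infinity. z \<noteq> 0"
    by (auto simp: eventually_at_infinity intro!: exI[of _ 1])
  then have "\<forall>\<^sub>F z in at_infinity. f (invert (inverse z)) = f (Some z)"
    by eventually_elim (simp add: invert_def inverse_eq_divide)
  with lim show ?thesis by (rule Lim_transform_eventually)
qed

lemma holo_fun_continuous:
  assumes "holo_fun cantor_X cantor_X_atlas f"
  shows "continuous_map cantor_X euclidean f"
proof (rule continuous_map_cantor_X)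
  show "continuous_on (- complex_K) (\<lambda>z. f (Some z))"
    using assms holomorphic_on_imp_continuous_on unfolding holo_fun_cantor_X_iff by blast
qed (rule holo_fun_tendsto_at_infinity[OF assms])

text \<open>These functions have their only pole in the Cantor set.\<close>

definition reciprocal :: "real \<Rightarrow> complex option \<Rightarrow> complex" where
  "reciprocal k p = (case p of None \<Rightarrow> 0 | Some z \<Rightarrow> 1 / (z - of_real k))"

lemma reciprocal_simps [simp]: "reciprocal k None = 0" "reciprocal k (Some z) = 1 / (z - of_real k)"
  by (simp_all add: reciprocal_def)

lemma holo_fun_reciprocal:
  assumes k: "k \<in> cantor_K"
  shows "holo_fun cantor_X cantor_X_atlas (reciprocal k)"
  unfolding holo_fun_cantor_X_iff
proof
  show "(\<lambda>z. reciprocal k (Some z)) holomorphic_on - complex_K"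
    using k by (auto intro!: holomorphic_intros)
  have nz: "1 - of_real k * \<zeta> \<noteq> 0" if "\<zeta> \<in> inverted_domain" for \<zeta>
  proof
    assume *: "1 - of_real k * \<zeta> = 0"
    then have "\<zeta> \<noteq> 0" by auto
    with * have "1 / \<zeta> = of_real k" by (simp add: field_simps)
    then show False using that k \<open>\<zeta> \<noteq> 0\<close> by (simp add: inverted_domain_def)
  qed
  have "reciprocal k (invert \<zeta>) = \<zeta> / (1 - of_real k * \<zeta>)" if "\<zeta> \<in> inverted_domain" for \<zeta>
  proof (cases "\<zeta> = 0")
    case False
    then have "1 / \<zeta> - of_real k = (1 - of_real k * \<zeta>) / \<zeta>" by (simp add: field_simps)
    then show ?thesis using False by (simp add: invert_def)
  qed (simp add: invert_def)
  moreover have "(\<lambda>\<zeta>. \<zeta> / (1 - of_real k * \<zeta>)) holomorphic_on inverted_domain"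
    by (intro holomorphic_intros nz)
  ultimately show "(\<lambda>\<zeta>. reciprocal k (invert \<zeta>)) holomorphic_on inverted_domain"
    by (simp cong: holomorphic_cong)
qed

text \<open>The complement of the hull is the union of the open sets on which some holomorphic function exceeds
  a bound valid on \<open>L\<close>.\<close>

lemma closedin_holo_hull: "closedin cantor_X (holo_hull cantor_X cantor_X_atlas L)"
proof -
  let ?P = "{(f, M). holo_fun cantor_X cantor_X_atlas f \<and> (\<forall>y\<in>L. cmod (f y) \<le> M)}"
  have eq: "topspace cantor_X - holo_hull cantor_X cantor_X_atlas L =
      (\<Union>(f, M)\<in>?P. {x \<in> topspace cantor_X. f x \<in> - cball 0 M})"
    unfolding holo_hull_def by (auto simp: not_le) (meson not_le)+
  have "openin cantor_X {x \<in> topspace cantor_X. f x \<in> - cball 0 M}"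
    if "holo_fun cantor_X cantor_X_atlas f" for f M
    by (rule openin_continuous_map_preimage[OF holo_fun_continuous[OF that]]) (simp add: open_Compl)
  then have "openin cantor_X (topspace cantor_X - holo_hull cantor_X cantor_X_atlas L)"
    unfolding eq by (intro openin_Union) auto
  then show ?thesis
    by (simp add: closedin_def holo_hull_def)
qed

text \<open>If \<open>L\<close> keeps the distance \<open>e\<close> from the Cantor set, then \<open>\<bar>1 / (z - k)\<bar> \<le> 1 / e\<close> on \<open>L\<close> and hence
  on the hull, which therefore keeps the same distance.\<close>

lemma compactin_holo_hull:
  assumes L: "compactin cantor_X L"
  shows "compactin cantor_X (holo_hull cantor_X cantor_X_atlas L)"
proof -
  obtain e where e: "0 < e" "L \<subseteq> away_from_K e"
    using compactin_subset_away_from_K[OF L] by blast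
  have "p \<in> away_from_K e" if p: "p \<in> holo_hull cantor_X cantor_X_atlas L" for p
  proof (cases p)
    case (Some z)
    have "e \<le> dist z (of_real k)" if k: "k \<in> cantor_K" for k
    proof -
      have "cmod (reciprocal k y) \<le> 1 / e" if "y \<in> L" for y
      proof (cases y)
        case (Some x)
        then have "e \<le> dist x (of_real k)" using e(2) that k by auto
        then have "1 / cmod (x - of_real k) \<le> 1 / e" using e(1) by (intro frac_le) (auto simp: dist_norm)
        then show ?thesis using Some by (simp add: norm_divide)
      qed (use e in simp)
      then have "cmod (reciprocal k p) \<le> 1 / e"
        using p holo_fun_reciprocal[OF k] unfolding holo_hull_def by blast
      then have *: "1 / cmod (z - of_real k) \<le> 1 / e" using Some by (simp add: norm_divide)
      have "p \<in> topspace cantor_X" using p by (simp add: holo_hull_def)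
      then have "0 < cmod (z - of_real k)" using Some k by auto
      with * e(1) show ?thesis by (simp add: dist_norm field_simps)
    qed
    then show ?thesis using Some by simp
  qed simp
  then show ?thesis
    using compactin_closed_subset[OF closedin_holo_hull _ e(1)] by blast
qed

lemma stein_manifold_cantor_X: "stein_manifold cantor_X cantor_X_atlas"
  unfolding stein_manifold_def
proof (intro conjI allI ballI impI)
  show "complex_manifold cantor_X cantor_X_atlas" by (rule complex_manifold_cantor_X)
  show "compactin cantor_X (holo_hull cantor_X cantor_X_atlas L)" if "compactin cantor_X L" for L
    using that by (rule compactin_holo_hull)
  fix x y assume xy: "x \<in> topspace cantor_X" "y \<in> topspace cantor_X" "x \<noteq> y"
  have nz: "z \<noteq> 0" if "z \<notin> complex_K" for z using that zero_in_complex_K by auto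
  have "reciprocal 0 x \<noteq> reciprocal 0 y"
    using xy nz by (cases x; cases y) auto
  then show "\<exists>f. holo_fun cantor_X cantor_X_atlas f \<and> f x \<noteq> f y"
    using holo_fun_reciprocal[OF zero_in_cantor_K] by blast
qed

section \<open>The potential is a special exhaustion function\<close>

lemma continuous_cantor_phi: "continuous_map cantor_X euclidean cantor_phi"
proof (rule continuous_map_cantor_X)
  have "continuous_on (- complex_K) (\<lambda>z. - log_potential cantor_mu z)"
    by (intro continuous_intros continuous_on_log_potential)
  then show "continuous_on (- complex_K) (\<lambda>z. cantor_phi (Some z))"
    unfolding cantor_phi_def by (auto intro: continuous_on_ereal)
  show "((\<lambda>z. cantor_phi (Some z)) \<longlongrightarrow> cantor_phi None) at_infinity"
    unfolding cantor_phi_def option.case tendsto_MInfty eventually_at_infinity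
  proof
    fix r :: real
    show "\<exists>b. \<forall>x. b \<le> cmod x \<longrightarrow> ereal (- log_potential cantor_mu x) < ereal r"
    proof (intro exI[of _ "exp (- r) + 3"] allI impI)
      fix x :: complex assume x: "exp (- r) + 3 \<le> cmod x"
      moreover have "0 < exp (- r)" by simp
      ultimately have "2 < cmod x" "exp (- r) < cmod x - 1" by linarith+
      then have "ln (exp (- r)) < ln (cmod x - 1)" by (subst ln_less_cancel_iff) auto
      then show "ereal (- log_potential cantor_mu x) < ereal r"
        using log_potential_ge_at_infinity[OF \<open>2 < cmod x\<close>] by simp
    qed
  qed
qed

lemma chart0_disc:
  fixes a b :: "complex ^ 1"
  assumes "\<And>\<zeta>. cmod \<zeta> \<le> 1 \<Longrightarrow> a + \<zeta> *s b \<in> chart0 ` Some ` S" "cmod \<zeta> \<le> 1"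
  shows "a $ 1 + \<zeta> * b $ 1 \<in> S"
  using assms(1)[OF assms(2)] unfolding chart0_image by simp

lemma psh_on_cantor_phi:
  assumes W: "W \<subseteq> topspace cantor_X"
  shows "psh_on cantor_X cantor_X_atlas W cantor_phi"
  unfolding psh_on_def
proof
  show "usc_on cantor_X W cantor_phi"
    unfolding usc_on_def
  proof (intro conjI ballI allI)
    show "cantor_phi x \<noteq> \<infinity>" for x by (auto simp: cantor_phi_def split: option.splits)
    fix c
    have "continuous_map (subtopology cantor_X W) euclidean cantor_phi"
      by (rule continuous_map_from_subtopology[OF continuous_cantor_phi])
    then have "openin (subtopology cantor_X W) {x \<in> topspace (subtopology cantor_X W). cantor_phi x \<in> {..<c}}"
      by (rule openin_continuous_map_preimage) simp
    moreover have "topspace (subtopology cantor_X W) = W" using W by auto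
    ultimately show "openin (subtopology cantor_X W) {x \<in> W. cantor_phi x < c}"
      by (simp only: lessThan_iff)
  qed
  have "cantor_phi (inv_into finite_part chart0 a) \<le> circle_mean (\<lambda>t. cantor_phi (inv_into finite_part chart0 (a + cis t *s b)))"
    if disc: "\<forall>\<zeta>. cmod \<zeta> \<le> 1 \<longrightarrow> a + \<zeta> *s b \<in> chart0 ` (finite_part \<inter> W)" for a b :: "complex ^ 1"
  proof -
    have in_S: "a $ 1 + \<zeta> * b $ 1 \<in> - complex_K" if "cmod \<zeta> \<le> 1" for \<zeta>
      by (rule chart0_disc[OF _ that]) (use disc in \<open>auto simp: finite_part_def\<close>)
    have inv: "inv_into finite_part chart0 (a + \<zeta> *s b) = Some (a $ 1 + \<zeta> * b $ 1)" if "cmod \<zeta> \<le> 1" for \<zeta>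
      using in_S[OF that] by (subst inv_chart0) auto
    have "circle_mean (\<lambda>t. cantor_phi (inv_into finite_part chart0 (a + cis t *s b))) =
        circle_mean (\<lambda>t. cantor_phi (Some (a $ 1 + b $ 1 * cis t)))"
      by (simp add: inv mult.commute)
    also have "\<dots> = cantor_phi (Some (a $ 1))"
      by (rule cantor_phi_mean) (use in_S in auto)
    also have "\<dots> = cantor_phi (inv_into finite_part chart0 a)" using inv[of 0] by simp
    finally show ?thesis by simp
  qed
  moreover have "cantor_phi (inv_into (topspace cantor_X) chart1 a) \<le>
      circle_mean (\<lambda>t. cantor_phi (inv_into (topspace cantor_X) chart1 (a + cis t *s b)))"
    if disc: "\<forall>\<zeta>. cmod \<zeta> \<le> 1 \<longrightarrow> a + \<zeta> *s b \<in> chart1 ` (topspace cantor_X \<inter> W)" for a b :: "complex ^ 1"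
  proof -
    have "a + \<zeta> *s b \<in> chart1 ` topspace cantor_X" if "cmod \<zeta> \<le> 1" for \<zeta>
      using disc that by blast
    then have in_S: "a $ 1 + \<zeta> * b $ 1 \<in> inverted_domain" if "cmod \<zeta> \<le> 1" for \<zeta>
      using that unfolding chart1_image[OF order_refl] invert_in_topspace by simp
    have inv: "inv_into (topspace cantor_X) chart1 (a + \<zeta> *s b) = invert (a $ 1 + \<zeta> * b $ 1)" if "cmod \<zeta> \<le> 1" for \<zeta>
      using in_S[OF that] by (subst inv_chart1) auto
    have "cantor_phi (invert (a $ 1)) \<le> circle_mean (\<lambda>t. cantor_phi (invert (a $ 1 + b $ 1 * cis t)))"
      by (rule cantor_phi_submean_at_infinity) (use in_S in \<open>auto simp: inverted_domain_def\<close>)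
    also have "\<dots> = circle_mean (\<lambda>t. cantor_phi (inv_into (topspace cantor_X) chart1 (a + cis t *s b)))"
      by (simp add: inv mult.commute)
    also have "cantor_phi (invert (a $ 1)) = cantor_phi (inv_into (topspace cantor_X) chart1 a)" using inv[of 0] by simp
    finally show ?thesis .
  qed
  ultimately show "\<forall>(U, h)\<in>cantor_X_atlas. \<forall>a b. (\<forall>\<zeta>. cmod \<zeta> \<le> 1 \<longrightarrow> a + \<zeta> *s b \<in> h ` (U \<inter> W)) \<longrightarrow>
      cantor_phi (inv_into U h a) \<le> circle_mean (\<lambda>t. cantor_phi (inv_into U h (a + cis t *s b)))"
    by (simp add: cantor_X_atlas_eq)
qed

text \<open>If no maximum is attained, the sets on which \<open>v\<close> is smaller than one of its values cover the
  compact set; a finite subcover contradicts the largest of its finitely many values.\<close>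

lemma usc_attains_max:
  fixes v :: "'a \<Rightarrow> ereal"
  assumes C: "compactin T C" "C \<noteq> {}" and usc: "\<And>c. openin (subtopology T C) {x \<in> C. v x < c}"
  shows "\<exists>x\<in>C. \<forall>y\<in>C. v y \<le> v x"
proof (rule ccontr)
  assume no: "\<not> ?thesis"
  let ?U = "(\<lambda>y. {x \<in> C. v x < v y}) ` C"
  have "compactin (subtopology T C) C" using C(1) by (simp add: compactin_subtopology)
  moreover have "\<And>U. U \<in> ?U \<Longrightarrow> openin (subtopology T C) U" using usc by auto
  moreover have "C \<subseteq> \<Union>?U" using no by (fastforce simp: not_le)
  ultimately obtain F where F: "finite F" "F \<subseteq> ?U" "C \<subseteq> \<Union>F"
    unfolding compactin_def by meson
  from F(1,2) obtain D where D: "finite D" "D \<subseteq> C" "F = (\<lambda>y. {x \<in> C. v x < v y}) ` D"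
    by (meson finite_subset_image)
  have "D \<noteq> {}" using C(2) F(3) D(3) by auto
  then have "Max (v ` D) \<in> v ` D" using D(1) by (intro Max_in) auto
  then obtain y where y: "Max (v ` D) = v y" "y \<in> D" by (rule imageE)
  then obtain y' where "y' \<in> D" "v y < v y'" using F(3) D(2,3) by blast
  moreover have "v y' \<le> v y" using Max_ge[of "v ` D" "v y'"] D(1) \<open>y' \<in> D\<close> unfolding y(1) by simp
  ultimately show False by simp
qed

lemma usc_add_continuous:
  fixes v :: "'a \<Rightarrow> ereal" and g :: "'a \<Rightarrow> real"
  assumes usc: "\<And>c. openin S {x \<in> topspace S. v x < c}" and g: "continuous_map S euclideanreal g"
  shows "openin S {x \<in> topspace S. v x + ereal (g x) < c}"
proof -
  have eq: "{x \<in> topspace S. v x + ereal (g x) < c} =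
    (\<Union>q::real. {x \<in> topspace S. v x < ereal q} \<inter> {x \<in> topspace S. g x \<in> {s. ereal (q + s) < c}})"
  proof (intro equalityI subsetI)
    fix x assume x: "x \<in> {x \<in> topspace S. v x + ereal (g x) < c}"
    then have "v x < c - ereal (g x)" by (simp add: ereal_less_minus_iff)
    then obtain q where q: "v x < ereal q" "ereal q < c - ereal (g x)" using ereal_dense2 by blast
    then have "ereal (q + g x) < c" by (simp add: ereal_less_minus_iff)
    with q x show "x \<in> (\<Union>q::real. {x \<in> topspace S. v x < ereal q} \<inter> {x \<in> topspace S. g x \<in> {s. ereal (q + s) < c}})"
      by auto
  next
    fix x assume "x \<in> (\<Union>q::real. {x \<in> topspace S. v x < ereal q} \<inter> {x \<in> topspace S. g x \<in> {s. ereal (q + s) < c}})"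
    then obtain q where q: "x \<in> topspace S" "v x < ereal q" "ereal (q + g x) < c" by auto
    then have "v x + ereal (g x) < ereal q + ereal (g x)" by (cases "v x") auto
    with q show "x \<in> {x \<in> topspace S. v x + ereal (g x) < c}" by auto
  qed
  have "openin S {x \<in> topspace S. g x \<in> {s. ereal (q + s) < c}}" for q
  proof -
    have "open {s. ereal (q + s) < c}"
      by (intro open_Collect_less continuous_intros)
    then show ?thesis by (intro openin_continuous_map_preimage[OF g]) simp
  qed
  then show ?thesis
    unfolding eq by (intro openin_Union) (use usc in \<open>blast intro: openin_Int\<close>)
qed

text \<open>The maximum principle for the difference of \<open>v\<close> and the harmonic function \<open>cantor_phi\<close>.  Adding
  \<open>e * \<bar>z\<bar>\<^sup>2\<close> makes the difference strictly subharmonic: its circle means exceed the value at the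
  centre by at least \<open>e * r\<^sup>2\<close>, so it cannot have a maximum inside \<open>G\<close>.  Then \<open>e\<close> tends to \<open>0\<close>.\<close>

lemma maximal_psh_on_cantor_phi:
  "maximal_psh_on cantor_X cantor_X_atlas (topspace cantor_X - {None}) cantor_phi"
  unfolding maximal_psh_on_def
proof (intro conjI allI impI ballI)
  show "psh_on cantor_X cantor_X_atlas (topspace cantor_X - {None}) cantor_phi"
    by (rule psh_on_cantor_phi) auto
  fix G v x
  let ?C = "cantor_X closure_of G"
  assume asm: "openin cantor_X G \<and> compactin cantor_X ?C \<and> ?C \<subseteq> topspace cantor_X - {None} \<and>
      usc_on cantor_X ?C v \<and> psh_on cantor_X cantor_X_atlas G v \<and>
      (\<forall>x\<in>cantor_X frontier_of G. v x \<le> cantor_phi x)" and x: "x \<in> G"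
  then have G: "openin cantor_X G" "compactin cantor_X ?C" "?C \<subseteq> topspace cantor_X - {None}"
    and usc: "\<And>x. x \<in> ?C \<Longrightarrow> v x \<noteq> \<infinity>" "\<And>c. openin (subtopology cantor_X ?C) {x \<in> ?C. v x < c}"
    and psh: "psh_on cantor_X cantor_X_atlas G v"
    and fr: "\<And>x. x \<in> cantor_X frontier_of G \<Longrightarrow> v x \<le> cantor_phi x"
    by (auto simp: usc_on_def)
  have GC: "G \<subseteq> ?C" using G(1) by (simp add: closure_of_subset openin_subset)
  have some: "\<exists>z. p = Some z \<and> z \<notin> complex_K" if "p \<in> ?C" for p
    using G(3) that by (auto simp: topspace_cantor_X)
  define U where "U = (\<lambda>p. log_potential cantor_mu (the p))"
  define N where "N = (\<lambda>p::complex option. (cmod (the p))\<^sup>2)"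
  have phi: "cantor_phi p = ereal (- U p)" if "p \<in> ?C" for p
    using some[OF that] by (auto simp: cantor_phi_def U_def)
  have top: "topspace (subtopology cantor_X ?C) = ?C"
    using closure_of_subset_topspace[of cantor_X G] by auto
  have contS: "continuous_map (subtopology cantor_X finite_part) euclidean (\<lambda>p. F (the p))"
    if F: "continuous_on (- complex_K) F" for F :: "complex \<Rightarrow> real"
    unfolding continuous_map_def
  proof (intro conjI allI impI)
    fix W :: "real set" assume "openin euclidean W"
    then have "open (- complex_K \<inter> F -` W)"
      using continuous_open_preimage[OF F open_Compl_complex_K] by simp
    moreover have "Some -` {p \<in> finite_part. F (the p) \<in> W} = - complex_K \<inter> F -` W"
      by (auto simp: finite_part_def)
    ultimately have "openin cantor_X {p \<in> finite_part. F (the p) \<in> W}"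
      by (auto simp: openin_cantor_X finite_part_def)
    moreover have "topspace (subtopology cantor_X finite_part) = finite_part" by (auto simp: finite_part_def)
    ultimately show "openin (subtopology cantor_X finite_part)
        {p \<in> topspace (subtopology cantor_X finite_part). F (the p) \<in> W}"
      using openin_open_subtopology[OF openin_finite_part] by auto
  qed simp
  have "?C \<subseteq> finite_part" using some by (auto simp: finite_part_def)
  then have contC: "continuous_map (subtopology cantor_X ?C) euclidean (\<lambda>p. F (the p))"
    if F: "continuous_on (- complex_K) F" for F :: "complex \<Rightarrow> real"
    using contS[OF F] continuous_map_from_subtopology_mono by blast
  have bdd: "\<exists>B. \<forall>p\<in>?C. N p \<le> B"
  proof -
    have "continuous_map (subtopology cantor_X ?C) euclideanreal N"
      unfolding N_def by (intro contC continuous_intros)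
    then have "compactin euclideanreal (N ` ?C)"
      using G(2) by (intro image_compactin[of "subtopology cantor_X ?C" ?C]) (simp_all add: compactin_subtopology)
    then have "bounded (N ` ?C)" by (simp add: compact_imp_bounded)
    then show ?thesis unfolding bounded_real by (meson abs_le_iff imageI)
  qed
  then obtain B where B: "\<And>p. p \<in> ?C \<Longrightarrow> N p \<le> B" by blast
  have main: "v x \<le> cantor_phi x + ereal (e * B)" if e: "0 < e" for e
  proof -
    let ?w = "\<lambda>p. v p + ereal (U p + e * N p)"
    \<comment> \<open>An interior maximum is impossible unless it is \<open>- \<infinity>\<close>, and on the frontier the value is at most \<open>e * B\<close>.\<close>
    have "\<exists>p\<in>?C. \<forall>q\<in>?C. ?w q \<le> ?w p"
    proof (rule usc_attains_max[OF G(2)])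
      show "?C \<noteq> {}" using x GC by auto
      fix c
      have "continuous_map (subtopology cantor_X ?C) euclideanreal (\<lambda>p. U p + e * N p)"
        unfolding U_def N_def
        by (intro contC continuous_intros continuous_on_log_potential)
      from usc_add_continuous[OF _ this, of v c] show "openin (subtopology cantor_X ?C) {x \<in> ?C. ?w x < c}"
        using usc(2) by (simp only: top)
    qed
    then obtain p where p: "p \<in> ?C" "\<And>q. q \<in> ?C \<Longrightarrow> ?w q \<le> ?w p" by blast
    have "?w p \<le> ereal (e * B)"
    proof (cases "p \<in> G")
      case False
      then have "p \<in> cantor_X frontier_of G" using p(1) G(1) by (simp add: frontier_of_def interior_of_openin)
      from fr[OF this] have "v p \<le> ereal (- U p)" unfolding phi[OF p(1)] .
      then have "?w p \<le> ereal (- U p) + ereal (U p + e * N p)" by (intro add_right_mono)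
      also have "\<dots> \<le> ereal (e * B)" using B[OF p(1)] e by simp
      finally show ?thesis .
    next
      case True
      show ?thesis
      proof (cases "v p = -\<infinity>")
        case False
        with usc(1)[OF p(1)] obtain m where m: "v p = ereal m" by (cases "v p") auto
        obtain z where z: "p = Some z" "z \<notin> complex_K" using some[OF p(1)] by blast
        have "open (Some -` G)" using G(1) by (simp add: openin_cantor_X)
        moreover have "z \<in> Some -` G" using True z by simp
        ultimately obtain r where r: "0 < r" "cball z r \<subseteq> Some -` G"
          unfolding open_contains_cball by blast
        define M where "M = m + U p + e * N p"
        have disc: "Some (z + \<zeta> * of_real r) \<in> G" if "cmod \<zeta> \<le> 1" for \<zeta>
        proof -
          have "z + \<zeta> * of_real r \<in> cball z r"
            using that r(1) by (simp add: dist_norm norm_mult mult_left_le_one_le)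
          then show ?thesis using r(2) by blast
        qed
        have discK: "z + \<zeta> * of_real r \<notin> complex_K" if "cmod \<zeta> \<le> 1" for \<zeta>
          using disc[OF that] GC some by blast
        have inv: "inv_into finite_part chart0 (vec z + \<zeta> *s vec (of_real r)) = Some (z + \<zeta> * of_real r)"
          if "cmod \<zeta> \<le> 1" for \<zeta>
          using discK[OF that] by (subst inv_chart0) auto
        have "\<forall>\<zeta>. cmod \<zeta> \<le> 1 \<longrightarrow> vec z + \<zeta> *s vec (of_real r) \<in> chart0 ` (finite_part \<inter> G)"
        proof (intro allI impI)
          fix \<zeta> :: complex assume "cmod \<zeta> \<le> 1"
          have "vec z + \<zeta> *s vec (of_real r) = chart0 (Some (z + \<zeta> * of_real r))"
            by (simp add: vec_eq_iff)
          then show "vec z + \<zeta> *s vec (of_real r) \<in> chart0 ` (finite_part \<inter> G)"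
            using disc[OF \<open>cmod \<zeta> \<le> 1\<close>] discK[OF \<open>cmod \<zeta> \<le> 1\<close>] by (auto simp: finite_part_def)
        qed
        then have "v (inv_into finite_part chart0 (vec z)) \<le>
            circle_mean (\<lambda>t. v (inv_into finite_part chart0 (vec z + cis t *s vec (of_real r))))"
          using psh unfolding psh_on_def cantor_X_atlas_eq by blast
        then have "v p \<le> circle_mean (\<lambda>t. v (Some (z + cis t * of_real r)))"
          using inv[of 0] z by (simp add: inv)
        also have "\<dots> \<le> circle_mean (\<lambda>t. ereal (M - log_potential cantor_mu (z + of_real r * cis t)
            - e * (cmod (z + of_real r * cis t))\<^sup>2))"
        proof (rule circle_mean_mono)
          fix t
          let ?q = "Some (z + cis t * of_real r)"
          have q: "?q \<in> ?C" using disc[of "cis t"] GC by auto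
          have "v ?q + ereal (U ?q + e * N ?q) \<le> ereal M" using p(2)[OF q] m by (simp add: M_def add.assoc)
          then have "v ?q \<le> ereal (M - (U ?q + e * N ?q))"
            by (cases "v ?q") auto
          then show "v ?q \<le> ereal (M - log_potential cantor_mu (z + of_real r * cis t)
            - e * (cmod (z + of_real r * cis t))\<^sup>2)"
            by (simp add: U_def N_def mult.commute diff_diff_eq)
        qed
        also have "\<dots> = ereal (M - U p - e * (N p + r\<^sup>2))"
        proof -
          have "has_bochner_integral circle_measure (\<lambda>t. M) (M * (2 * pi))"
            by (simp add: has_bochner_integral_iff space_circle_measure measure_circle_measure)
          then have "has_bochner_integral circle_measure
             (\<lambda>t. M - log_potential cantor_mu (z + of_real r * cis t) - e * (cmod (z + of_real r * cis t))\<^sup>2)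
             (M * (2 * pi) - 2 * pi * log_potential cantor_mu z - e * (2 * pi * ((cmod z)\<^sup>2 + r\<^sup>2)))"
            by (intro has_bochner_integral_diff has_bochner_integral_mult_right log_potential_mean norm_square_circle_mean)
               (use discK in auto)
          then show ?thesis
            by (subst circle_mean_ereal) (auto simp: has_bochner_integral_iff U_def N_def z field_simps)
        qed
        finally have "m \<le> M - U p - e * (N p + r\<^sup>2)" using m by simp
        moreover have "0 < e * r\<^sup>2" using e r(1) by simp
        ultimately show ?thesis by (simp add: M_def algebra_simps)
      qed simp
    qed
    then have "?w x \<le> ereal (e * B)" using p(2)[of x] x GC by (meson order.trans subsetD)
    moreover have "0 \<le> e * N x" using e by (simp add: N_def)
    ultimately have "v x \<le> ereal (- U x + e * B)"
      using usc(1)[of x] x GC by (cases "v x") auto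
    then show ?thesis using phi[of x] x GC by auto
  qed
  show "v x \<le> cantor_phi x"
  proof (rule ereal_le_epsilon2)
      fix e :: real assume "e > 0"
      have "0 \<le> B" using B[of x] x GC by (auto simp: N_def intro: order.trans[OF zero_le_power2])
      then have "e / (B + 1) * B \<le> e" "0 < e / (B + 1)" using \<open>e > 0\<close> by (auto simp: field_simps)
      with main[of "e / (B + 1)"] have "v x \<le> cantor_phi x + ereal (e / (B + 1) * B)" by simp
      also have "\<dots> \<le> cantor_phi x + ereal e" using \<open>e / (B + 1) * B \<le> e\<close> by (intro add_left_mono) simp
      finally show "v x \<le> cantor_phi x + ereal e" .
  qed
qed

lemma special_exhaustion_cantor_phi: "special_exhaustion cantor_X cantor_X_atlas cantor_phi"
  unfolding special_exhaustion_def
proof (intro conjI allI)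
  show "psh_on cantor_X cantor_X_atlas (topspace cantor_X) cantor_phi"
    by (rule psh_on_cantor_phi) simp
  show "compactin cantor_X (cantor_X closure_of {x \<in> topspace cantor_X. cantor_phi x < ereal C})" for C
  proof -
    obtain e where e: "0 < e" "\<And>z w. z \<notin> complex_K \<Longrightarrow> w \<in> cantor_K \<Longrightarrow> dist z (of_real w) < e \<Longrightarrow>
        C \<le> - log_potential cantor_mu z"
      using cantor_phi_large_near_K by blast
    have "p \<in> away_from_K e" if "p \<in> topspace cantor_X" "cantor_phi p < ereal C" for p
      using that e(2) by (cases p) (force simp: cantor_phi_def not_le[symmetric])+
    then have "{x \<in> topspace cantor_X. cantor_phi x < ereal C} \<subseteq> away_from_K e" by blast
    moreover have "closedin cantor_X (away_from_K e)"
      using compactin_imp_closedin[OF Hausdorff_cantor_X compactin_away_from_K[OF e(1)]] .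
    ultimately have "cantor_X closure_of {x \<in> topspace cantor_X. cantor_phi x < ereal C} \<subseteq> away_from_K e"
      by (rule closure_of_minimal)
    then show ?thesis using compactin_closed_subset[OF closedin_closure_of _ e(1)] by blast
  qed
  show "\<exists>L. compactin cantor_X L \<and> maximal_psh_on cantor_X cantor_X_atlas (topspace cantor_X - L) cantor_phi"
    using maximal_psh_on_cantor_phi by (intro exI[of _ "{None}"]) simp
qed

section \<open>Conclusion\<close>

lemma polynomial_fun_cantor_X_constant:
  assumes "polynomial_fun cantor_X cantor_X_atlas cantor_phi f" and x: "x \<in> topspace cantor_X"
  shows "f x = f None"
proof (cases x)
  case (Some z)
  from assms(1) obtain d :: nat and c :: real where f: "holo_fun cantor_X cantor_X_atlas f" and c: "c > 0"
    and bound: "\<And>x. x \<in> topspace cantor_X \<Longrightarrow>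
      ln_ereal (cmod (f x)) \<le> ereal (real d) * max 0 (cantor_phi x) + ereal c"
    unfolding polynomial_fun_def by blast
  have "f (Some z) = f None"
  proof (rule polynomial_growth_imp_constant[where f = "\<lambda>z. f (Some z)"])
    show "(\<lambda>z. f (Some z)) holomorphic_on - complex_K" using f by (simp add: holo_fun_cantor_X_iff)
    show "((\<lambda>z. f (Some z)) \<longlongrightarrow> f None) at_infinity" by (rule holo_fun_tendsto_at_infinity[OF f])
    show "z \<notin> complex_K" using x Some by simp
    fix y assume y: "y \<notin> complex_K"
    show "cmod (f (Some y)) \<le> exp (real d * max 0 (- log_potential cantor_mu y) + c)"
    proof (cases "f (Some y) = 0")
      case False
      have "max 0 (cantor_phi (Some y)) = ereal (max 0 (- log_potential cantor_mu y))"
        by (simp add: cantor_phi_def max_def zero_ereal_def)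
      moreover have "ln_ereal (cmod (f (Some y))) = ereal (ln (cmod (f (Some y))))"
        using False by (simp add: ln_ereal_def)
      ultimately have "ereal (ln (cmod (f (Some y)))) \<le>
          ereal (real d) * ereal (max 0 (- log_potential cantor_mu y)) + ereal c"
        using bound[of "Some y"] y by (simp only: Some_in_topspace not_False_eq_True)
      then have "ln (cmod (f (Some y))) \<le> real d * max 0 (- log_potential cantor_mu y) + c"
        unfolding times_ereal.simps plus_ereal.simps ereal_less_eq .
      then have "exp (ln (cmod (f (Some y)))) \<le> exp (real d * max 0 (- log_potential cantor_mu y) + c)"
        by (simp only: exp_le_cancel_iff)
      then show ?thesis using False by simp
    qed simp
  qed (rule c)
  then show ?thesis using Some by simp
qed simp

text \<open>The function \<open>1 / z\<close> takes the values \<open>1 / 2\<close> and \<open>0\<close> at \<open>2\<close> and at infinity; no constant is within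
  \<open>1 / 4\<close> of both.\<close>

lemma not_regular_parabolic_cantor_X: "\<not> regular_parabolic cantor_X cantor_X_atlas cantor_phi"
proof
  assume "regular_parabolic cantor_X cantor_X_atlas cantor_phi"
  moreover have "2 \<notin> complex_K"
  proof
    assume "2 \<in> complex_K"
    then obtain w where "w \<in> cantor_K" "complex_of_real 2 = of_real w" by auto
    then show False using cantor_K_subset unfolding of_real_eq_iff by auto
  qed
  then have L: "Some 2 \<in> topspace cantor_X" by simp
  then have "compactin cantor_X {Some 2, None}" by (intro finite_imp_compactin) auto
  ultimately obtain p where p: "polynomial_fun cantor_X cantor_X_atlas cantor_phi p"
    "\<forall>x\<in>{Some 2, None}. cmod (reciprocal 0 x - p x) < 1 / 4"
    using holo_fun_reciprocal[OF zero_in_cantor_K] unfolding regular_parabolic_def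
    by (metis zero_less_divide_1_iff zero_less_numeral)
  have "p (Some 2) = p None" by (rule polynomial_fun_cantor_X_constant[OF p(1) L])
  then have "cmod (1 / 2 - p None) < 1 / 4" "cmod (- p None) < 1 / 4" using p(2) by auto
  moreover have "cmod (1 / 2) \<le> cmod (1 / 2 - p None) + cmod (p None)"
    using norm_triangle_ineq[of "1 / 2 - p None" "p None"] by simp
  ultimately show False by (simp add: norm_divide)
qed

theorem mainTheorem2:
  shows "S_star_parabolic cantor_X cantor_X_atlas cantor_phi \<and>
    (\<forall>f. polynomial_fun cantor_X cantor_X_atlas cantor_phi f \<longrightarrow>
       (\<exists>c. \<forall>x\<in>topspace cantor_X. f x = c)) \<and>
    \<not> regular_parabolic cantor_X cantor_X_atlas cantor_phi"
proof (intro conjI allI impI)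
  show "S_star_parabolic cantor_X cantor_X_atlas cantor_phi"
    unfolding S_star_parabolic_def
    using stein_manifold_cantor_X special_exhaustion_cantor_phi continuous_cantor_phi by blast
  show "\<exists>c. \<forall>x\<in>topspace cantor_X. f x = c" if "polynomial_fun cantor_X cantor_X_atlas cantor_phi f" for f
    using polynomial_fun_cantor_X_constant[OF that] by blast
qed (rule not_regular_parabolic_cantor_X)

end
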